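(* Let $\mu\ge 0$, let $n\ge 0$ and $0\le k\le n$ be integers, and let $\xi_\nu=\frac{\nu\pi}{n+1}$, $\zeta_\nu=(\cos\xi_\nu,\sin\xi_\nu,0)$. Let $f\in L^2(H_\mu;S^2)$ be even in $x_3$, i.e. $f(x_1,x_2,x_3)=f(x_1,x_2,-x_3)$. Then for $\mathbf x=(x_1,x_2,x_3)\in S^2$, $$\operatorname{proj}_{\mathcal H_k^\mu}f(\mathbf x)=\frac{1}{n+1}\sum_{\nu=0}^{n}a_\mu\int_{-1}^1Q^\mu f(\zeta_\nu;t)\,D_k^{\mu+1/2}(\xi_\nu,t;x_1,x_2)\,dt .$$
   Context: Sphere: $S^2=\{\mathbf x\in\mathbb R^3:\|\mathbf x\|=1\}$ with surface measure $d\omega$ and weight $H_\mu(\mathbf x)=|x_3|^{2\mu}$. $\mathcal H_k^\mu$ is the space of (restrictions to $S^2$ of) homogeneous polynomials of degree $k$ in three variables that are orthogonal, with respect to $H_\mu\,d\omega$ on $S^2$, to all polynomials of degree $<k$; $L^2(H_\mu;S^2)=\bigoplus_{k\ge0}\mathcal H_k^\mu$, and $\operatorname{proj}_{\mathcal H_k^\mu}$ is the orthogonal projection onto $\mathcal H_k^\mu$. Attenuated spherical transform: for $\zeta=(\cos\theta,\sin\theta,0)$ and $-1<t<1$, $Q^\mu f(\zeta;t)$ is the integral of $f(\mathbf x)|x_3|^{2\mu}$ over the circle $\{\mathbf x\in S^2:\langle\mathbf x,\zeta\rangle=t\}$, normalized as $$Q^\mu f(\zeta;t)=\frac12\int_0^{2\pi}f(\mathbf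 x(\alpha))\,|x_3(\alpha)|^{2\mu}\,d\alpha,$$ $$\mathbf x(\alpha)=\bigl(t\cos\theta-\sqrt{1-t^2}\cos\alpha\sin\theta,\ t\sin\theta+\sqrt{1-t^2}\cos\alpha\cos\theta,\ \sqrt{1-t^2}\sin\alpha\bigr)$$ (defined for a.e. $t$ for $f\in L^2(H_\mu;S^2)$). Disk: $B^2$ is the closed unit disk in $\mathbb R^2$; $W_\mu(x,y)=(1-x^2-y^2)^{\mu-1/2}$; $a_\mu=(\mu+1/2)/\pi=1/\int_{B^2}W_\mu$. $\mathcal V_k^2(W_\mu)$ is the space of polynomials in two variables of degree $k$ (together with $0$) orthogonal to all polynomials of degree $<k$ under $\langle P,Q\rangle_\mu=a_\mu\int_{B^2}PQW_\mu\,dx\,dy$. $(a)_k=a(a+1)\cdots(a+k-1)$. $C_k^\lambda$ is the Gegenbauer polynomial of degree $k$, orthogonal for $(1-s^2)^{\lambda-1/2}$ on $[-1,1]$, with $C_k^\lambda(1)=(2\lambda)_k/k!$. $p_l^{(\alpha,\beta)}$ is the Jacobi polynomial of degree $l$ with positive leading coefficient, orthonormal for the weight $(1-t)^\alpha(1+t)^\beta$ normalized to have integral $1$ on $[-1,1]$. Orthonormal basis of $\mathcal V_k^2(W_\mu)$: in polar coordinates $x=r\cos\phi$, $y=r\sin\phi$, $$P_{l,\varepsilon}^k(x,y)=h_{l,k}\,p_l^{(\mu-1/2,\,k-2l)}(2r^2-1)\,r^{k-2l}S_{k-2l,\varepsilon}(\phi),$$ where $S_{j,0}(\phi)=\cos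 j\phi$, $S_{j,1}(\phi)=\sin j\phi$, $0\le 2l\le k$ if $\varepsilon=0$, $0\le 2l\le k-1$ if $\varepsilon=1$, and $$h_{l,k}^2=\frac1{d_{l,k}}\,\frac{\Gamma(k-2l+\mu+3/2)}{\Gamma(\mu+3/2)\Gamma(k-2l+1)},\quad h_{l,k}>0,\qquad d_{l,k}=\tfrac12\ (2l<k),\quad d_{l,k}=1\ (2l=k).$$ $$\lambda_{l,k}^\mu=\frac{l!\,(k-l)!\,(k-l+\mu+\frac12)}{(\mu+\frac12)_l\,(\mu+\frac32)_{k-l}\,(k+\mu+\frac12)},\qquad D_k^{\mu+1/2}(\xi;x,y)=\sum_{l,\varepsilon}\lambda_{l,k}^\mu\,P_{l,\varepsilon}^k(\cos\xi,\sin\xi)\,P_{l,\varepsilon}^k(x,y)$$ (sum over all admissible pairs $(l,\varepsilon)$), and $$D_k^{\mu+1/2}(\xi,t;x,y)=\frac{k+\mu+1/2}{\mu+1/2}\,C_k^{\mu+1/2}(t)\,D_k^{\mu+1/2}(\xi;x,y).$$ *)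

theory Defs
  imports "HOL-Analysis.Analysis"
begin

text \<open>
  Surface measure on the unit sphere, by integration in polar coordinates: the area of \<open>A\<close> is
  \<open>DIM('a)\<close> times the volume of the cone \<open>{r x. x \<in> A, 0 < r < 1}\<close>; recall \<open>sgn x = x /\<^sub>R norm x\<close>.
  The underlying space is the sphere itself, with its Borel sets.
\<close>

definition sphere_measure :: "'a::euclidean_space measure" where
  "sphere_measure =
     scale_measure (of_nat DIM('a))
       (distr (restrict_space lborel (ball 0 1 - {0})) (restrict_space borel (sphere 0 1)) sgn)"

lemma space_sphere_measure [simp]: "space sphere_measure = sphere 0 1"
  by (simp add: sphere_measure_def space_restrict_space space_scale_measure)

lemma sets_sphere_measure [measurable_cong]:
  "sets sphere_measure = sets (restrict_space borel (sphere 0 1))"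
  by (simp add: sphere_measure_def)

lemma sgn_measurable_sphere:
  "(sgn :: 'a::euclidean_space \<Rightarrow> 'a) \<in>
     measurable (restrict_space lborel (ball 0 1 - {0})) (restrict_space borel (sphere 0 1))"
proof (rule measurable_restrict_space2)
  show "sgn \<in> space (restrict_space lborel (ball 0 1 - {0})) \<rightarrow> sphere (0::'a) 1"
    by (auto simp: space_restrict_space norm_sgn)
  have "(\<lambda>x::'a. inverse (norm x) *\<^sub>R x) \<in> borel_measurable lborel"
    by measurable
  then have "(sgn :: 'a \<Rightarrow> 'a) \<in> borel_measurable lborel"
    by (simp add: sgn_div_norm[abs_def])
  then show "(sgn :: 'a \<Rightarrow> 'a) \<in> borel_measurable (restrict_space lborel (ball 0 1 - {0}))"
    by (rule measurable_restrict_space1)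
qed

lemma emeasure_sphere_measure:
  "emeasure sphere_measure (sphere (0::real^3) 1) = ennreal (4 * pi)"
proof -
  have *: "(sgn -` sphere (0::real^3) 1 \<inter> (ball 0 1 - {0})) = ball 0 1 - {0}"
    by (auto simp: norm_sgn)
  have "emeasure sphere_measure (sphere (0::real^3) 1) = 3 * emeasure lborel (ball (0::real^3) 1 - {0})"
    unfolding sphere_measure_def
    by (subst emeasure_scale_measure, subst emeasure_distr[OF sgn_measurable_sphere])
       (auto simp: * space_restrict_space emeasure_restrict_space sets_restrict_space)
  also have "emeasure lborel (ball (0::real^3) 1 - {0}) = emeasure lborel (ball (0::real^3) 1)"
    by (rule emeasure_Diff_null_set) auto
  also have "\<dots> = ennreal (4 / 3 * pi)"
    by (simp add: emeasure_ball unit_ball_vol_3)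
  also have "3 * \<dots> = ennreal (4 * pi)"
    by (simp flip: ennreal_mult' ennreal_numeral)
  finally show ?thesis .
qed

text \<open>The case distinction is needed because \<open>0 powr 0 = 0\<close>; for \<open>\<mu> = 0\<close> the weight is \<open>1\<close>.\<close>

definition sphere_weight :: "real \<Rightarrow> real^3 \<Rightarrow> real" where
  "sphere_weight \<mu> x = (if \<mu> = 0 then 1 else \<bar>x$3\<bar> powr (2 * \<mu>))"

definition sphere_inner :: "real \<Rightarrow> (real^3 \<Rightarrow> real) \<Rightarrow> (real^3 \<Rightarrow> real) \<Rightarrow> real" where
  "sphere_inner \<mu> f g = (LINT x|sphere_measure. f x * g x * sphere_weight \<mu> x)"

text \<open>Elements of \<open>L\<^sup>2\<close> are given by Borel representatives; values outside the sphere are irrelevant.\<close>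

definition sphere_L2 :: "real \<Rightarrow> (real^3 \<Rightarrow> real) set" where
  "sphere_L2 \<mu> = {f \<in> borel_measurable sphere_measure.
                    integrable sphere_measure (\<lambda>x. (f x)\<^sup>2 * sphere_weight \<mu> x)}"

definition poly3 :: "(nat \<times> nat \<times> nat) set \<Rightarrow> (nat \<times> nat \<times> nat \<Rightarrow> real) \<Rightarrow> real^3 \<Rightarrow> real" where
  "poly3 E c x = (\<Sum>(i, j, m)\<in>E. c (i, j, m) * (x$1)^i * (x$2)^j * (x$3)^m)"

definition homogeneous_polys :: "nat \<Rightarrow> (real^3 \<Rightarrow> real) set" where
  "homogeneous_polys k = range (poly3 {(i, j, m). i + j + m = k})"

definition polys_below :: "nat \<Rightarrow> (real^3 \<Rightarrow> real) set" where
  "polys_below k = range (poly3 {(i, j, m). i + j + m < k})"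

definition sphere_harmonics :: "real \<Rightarrow> nat \<Rightarrow> (real^3 \<Rightarrow> real) set" where
  "sphere_harmonics \<mu> k =
     {restrict p (sphere 0 1) | p.
        p \<in> homogeneous_polys k \<and> (\<forall>q\<in>polys_below k. sphere_inner \<mu> p q = 0)}"

definition proj_harmonics :: "real \<Rightarrow> nat \<Rightarrow> (real^3 \<Rightarrow> real) \<Rightarrow> real^3 \<Rightarrow> real" where
  "proj_harmonics \<mu> k f =
     (THE p. p \<in> sphere_harmonics \<mu> k \<and>
             (\<forall>q\<in>sphere_harmonics \<mu> k. sphere_inner \<mu> (\<lambda>x. f x - p x) q = 0))"

text \<open>For \<open>\<zeta> = (cos \<theta>, sin \<theta>, 0)\<close>, the circle of all \<open>x\<close> on the sphere with \<open>x \<bullet> \<zeta> = t\<close>.\<close>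

definition circle_point :: "real^3 \<Rightarrow> real \<Rightarrow> real \<Rightarrow> real^3" where
  "circle_point \<zeta> t \<alpha> =
     vector [t * \<zeta>$1 - sqrt (1 - t\<^sup>2) * cos \<alpha> * \<zeta>$2,
             t * \<zeta>$2 + sqrt (1 - t\<^sup>2) * cos \<alpha> * \<zeta>$1,
             sqrt (1 - t\<^sup>2) * sin \<alpha>]"

definition spherical_transform :: "real \<Rightarrow> (real^3 \<Rightarrow> real) \<Rightarrow> real^3 \<Rightarrow> real \<Rightarrow> real" where
  "spherical_transform \<mu> f \<zeta> t =
     1 / 2 * (LBINT \<alpha>:{0..2 * pi}. f (circle_point \<zeta> t \<alpha>) * sphere_weight \<mu> (circle_point \<zeta> t \<alpha>))"

definition gegenbauer :: "real \<Rightarrow> nat \<Rightarrow> real poly" where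
  "gegenbauer a k =
     (THE p. degree p = k \<and>
             (\<forall>q. degree q < k \<longrightarrow>
                (LBINT s:{-1..1}. poly p s * poly q s * (1 - s\<^sup>2) powr (a - 1 / 2)) = 0) \<and>
             poly p 1 = pochhammer (2 * a) k / fact k)"

definition jacobi_weight :: "real \<Rightarrow> real \<Rightarrow> real \<Rightarrow> real" where
  "jacobi_weight \<alpha> \<beta> t = (1 - t) powr \<alpha> * (1 + t) powr \<beta>"

definition jacobi_inner :: "real \<Rightarrow> real \<Rightarrow> real poly \<Rightarrow> real poly \<Rightarrow> real" where
  "jacobi_inner \<alpha> \<beta> p q =
     (LBINT t:{-1..1}. poly p t * poly q t * jacobi_weight \<alpha> \<beta> t) /
     (LBINT t:{-1..1}. jacobi_weight \<alpha> \<beta> t)"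

definition jacobi_orthonormal :: "real \<Rightarrow> real \<Rightarrow> nat \<Rightarrow> real poly" where
  "jacobi_orthonormal \<alpha> \<beta> l =
     (THE p. degree p = l \<and> lead_coeff p > 0 \<and> jacobi_inner \<alpha> \<beta> p p = 1 \<and>
             (\<forall>q. degree q < l \<longrightarrow> jacobi_inner \<alpha> \<beta> p q = 0))"

text \<open>The reciprocal of the integral of \<open>(1 - x\<^sup>2 - y\<^sup>2) powr (\<mu> - 1/2)\<close> over the unit disk.\<close>

definition disk_const :: "real \<Rightarrow> real" where
  "disk_const \<mu> = (\<mu> + 1 / 2) / pi"

definition ang :: "nat \<Rightarrow> nat \<Rightarrow> real \<Rightarrow> real" where
  "ang j \<epsilon> \<phi> = (if \<epsilon> = 0 then cos (real j * \<phi>) else sin (real j * \<phi>))"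

definition disk_norm :: "real \<Rightarrow> nat \<Rightarrow> nat \<Rightarrow> real" where
  "disk_norm \<mu> l k =
     sqrt (1 / (if 2 * l = k then 1 else 1 / 2) *
           (Gamma (real (k - 2 * l) + \<mu> + 3 / 2) /
            (Gamma (\<mu> + 3 / 2) * Gamma (real (k - 2 * l) + 1))))"

text \<open>
  \<open>\<epsilon> \<in> {0, 1}\<close> selects cosine or sine; polar coordinates are the modulus and the argument of \<open>x + i y\<close>.
\<close>

definition disk_basis :: "real \<Rightarrow> nat \<Rightarrow> nat \<Rightarrow> nat \<Rightarrow> real \<Rightarrow> real \<Rightarrow> real" where
  "disk_basis \<mu> k l \<epsilon> x y =
     (let r = cmod (Complex x y); \<phi> = Arg (Complex x y) in
      disk_norm \<mu> l k * poly (jacobi_orthonormal (\<mu> - 1 / 2) (real (k - 2 * l)) l) (2 * r\<^sup>2 - 1) *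
      r ^ (k - 2 * l) * ang (k - 2 * l) \<epsilon> \<phi>)"

definition disk_index :: "nat \<Rightarrow> (nat \<times> nat) set" where
  "disk_index k = {(l, \<epsilon>). \<epsilon> = 0 \<and> 2 * l \<le> k \<or> \<epsilon> = 1 \<and> 2 * l + 1 \<le> k}"

definition kernel_coeff :: "real \<Rightarrow> nat \<Rightarrow> nat \<Rightarrow> real" where
  "kernel_coeff \<mu> l k =
     fact l * fact (k - l) * (real (k - l) + \<mu> + 1 / 2) /
     (pochhammer (\<mu> + 1 / 2) l * pochhammer (\<mu> + 3 / 2) (k - l) * (real k + \<mu> + 1 / 2))"

text \<open>
  \<open>angular_kernel \<mu> k\<close> and \<open>recon_kernel \<mu> k\<close> are the kernels \<open>D\<^sub>k(\<xi>; x, y)\<close> and \<open>D\<^sub>k(\<xi>, t; x, y)\<close>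
  with upper index \<open>\<mu> + 1/2\<close>.
\<close>

definition angular_kernel :: "real \<Rightarrow> nat \<Rightarrow> real \<Rightarrow> real \<Rightarrow> real \<Rightarrow> real" where
  "angular_kernel \<mu> k \<xi> x y =
     (\<Sum>(l, \<epsilon>)\<in>disk_index k.
        kernel_coeff \<mu> l k * disk_basis \<mu> k l \<epsilon> (cos \<xi>) (sin \<xi>) * disk_basis \<mu> k l \<epsilon> x y)"

definition recon_kernel :: "real \<Rightarrow> nat \<Rightarrow> real \<Rightarrow> real \<Rightarrow> real \<Rightarrow> real \<Rightarrow> real" where
  "recon_kernel \<mu> k \<xi> t x y =
     (real k + \<mu> + 1 / 2) / (\<mu> + 1 / 2) * poly (gegenbauer (\<mu> + 1 / 2) k) t *
     angular_kernel \<mu> k \<xi> x y"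

end

theory Submission
  imports Defs "HOL-Library.Real_Mod"
begin

text \<open>
  For \<open>\<zeta>\<close> on the equator let \<open>R \<zeta>\<close> be \<open>y \<mapsto> (k + \<mu> + 1/2) / (\<mu> + 1/2) * C\<^sub>k (y \<bullet> \<zeta>)\<close>, suitably normalized.
  By the Funk-Hecke formula it reproduces harmonics at \<open>\<zeta>\<close>: the inner product of \<open>R \<zeta>\<close> and \<open>q\<close> is
  \<open>q \<zeta>\<close>. Integrating along the circles \<open>y \<bullet> \<zeta> = t\<close> first, the \<open>\<nu>\<close>-th integral in the theorem is the
  coefficient \<open>c \<nu>\<close>, the inner product of \<open>f\<close> and \<open>R (\<zeta> \<nu>)\<close>, times the angular kernel \<open>D \<nu>\<close>.

  The factors \<open>\<lambda>\<close> of the angular kernel are exactly such that \<open>D \<nu>\<close> restricts to the Dirichlet kernel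
  on the equator. A harmonic polynomial that is even in \<open>x\<^sub>3\<close> is determined by its values on the
  equator, where it only has the frequencies \<open>k - 2 i\<close>, so \<open>k \<le> n\<close> gives the sampling identity
  \<open>v = 1/(n+1) * (\<Sum>\<nu>. v (\<zeta> \<nu>) * D \<nu>)\<close>. Dually \<open>q = (\<Sum>\<nu>. b \<nu> * R (\<zeta> \<nu>))\<close>, where \<open>b \<nu>\<close> is the inner product
  of \<open>q\<close> and \<open>D \<nu>\<close> divided by \<open>n + 1\<close>. Hence \<open>f\<close> and the right-hand side \<open>1/(n+1) * (\<Sum>\<nu>. c \<nu> * D \<nu>)\<close> have
  the same inner product \<open>\<Sum>\<nu>. b \<nu> * c \<nu>\<close> with every such \<open>q\<close>.
\<close>

text \<open>The weight calls for two coordinate systems. Around the third axis it depends on the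
  height alone, so integrals separate into an angular part and a Jacobi part with exponent \<mu> -
  1/2. Around an equatorial direction the third coordinate is sqrt (1 - t^2) sin \<alpha>, and the
  weight separates into |sin \<alpha>|^(2 \<mu>) and (1 - t^2)^\<mu>. The latter is the Gegenbauer
  weight of index \<mu> + 1/2, the upper index of the kernels. Rotation invariance of the surface
  measure, which is defined by volumes of cones, links the two.

  Evenness is essential: a polynomial odd in x_3 vanishes on the equator and is invisible from
  equatorial directions.

  No dimension count enters. Polynomials are kept as homogeneous functions on the whole space, and
  identities between them rest on one fact: a homogeneous polynomial orthogonal to itself is zero.
  The classical polynomials are given only by characterizing properties, so their norms are first
  derived from a hypergeometric sum.\<close>

section \<open>Spherical coordinates\<close>

text \<open>Archimedes' coordinates, height and longitude around the third axis. In them the area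
  element is dt d\<alpha> with density 1.\<close>

definition axis_point :: "real \<Rightarrow> real \<Rightarrow> real^3" where
  "axis_point t \<alpha> = vector [sqrt (1 - t\<^sup>2) * cos \<alpha>, sqrt (1 - t\<^sup>2) * sin \<alpha>, t]"

lemma axis_point_nth [simp]:
  "axis_point t \<alpha> $ 1 = sqrt (1 - t\<^sup>2) * cos \<alpha>"
  "axis_point t \<alpha> $ 2 = sqrt (1 - t\<^sup>2) * sin \<alpha>"
  "axis_point t \<alpha> $ 3 = t"
  by (simp_all add: axis_point_def)

lemma norm_vec3: "norm (x :: real^3) = sqrt ((x$1)\<^sup>2 + (x$2)\<^sup>2 + (x$3)\<^sup>2)"
  by (simp add: norm_vec_def L2_set_def sum_3)

lemma norm_axis_point: "\<bar>t\<bar> \<le> 1 \<Longrightarrow> norm (axis_point t \<alpha>) = 1"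
proof -
  assume "\<bar>t\<bar> \<le> 1"
  then have "t\<^sup>2 \<le> 1" by (simp add: abs_square_le_1)
  moreover have "(1 - t\<^sup>2) * (cos \<alpha>)\<^sup>2 + (1 - t\<^sup>2) * (sin \<alpha>)\<^sup>2 = 1 - t\<^sup>2"
    by (simp add: distrib_left[symmetric])
  ultimately show ?thesis
    by (simp add: norm_vec3 power_mult_distrib)
qed

text \<open>Open on all sides: the square root is not differentiable at the heights -1 and 1, and a
  closed turn would break injectivity.\<close>

definition spherical_box :: "(real^3) set" where
  "spherical_box = {u. 0 < u$1 \<and> u$1 < 1 \<and> -1 < u$2 \<and> u$2 < 1 \<and> 0 < u$3 \<and> u$3 < 2 * pi}"

definition spherical_map :: "real^3 \<Rightarrow> real^3" where
  "spherical_map u = u$1 *\<^sub>R axis_point (u$2) (u$3)"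

definition spherical_deriv :: "real^3 \<Rightarrow> real^3 \<Rightarrow> real^3" where
  "spherical_deriv u h =
     (let r = u$1; t = u$2; c = cos (u$3); s = sin (u$3); w = sqrt (1 - t\<^sup>2) in
      vector [h$1 * w * c - r * t / w * c * h$2 - r * w * s * h$3,
              h$1 * w * s - r * t / w * s * h$2 + r * w * c * h$3,
              h$1 * t + r * h$2])"

lemma has_derivative_vec3I:
  fixes f :: "'a::real_normed_vector \<Rightarrow> real^3"
  assumes "((\<lambda>x. f x $ 1) has_derivative (\<lambda>x. f' x $ 1)) (at a within S)"
    "((\<lambda>x. f x $ 2) has_derivative (\<lambda>x. f' x $ 2)) (at a within S)"
    "((\<lambda>x. f x $ 3) has_derivative (\<lambda>x. f' x $ 3)) (at a within S)"
  shows "(f has_derivative f') (at a within S)"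
  unfolding has_derivative_componentwise_within[of f]
proof
  fix i :: "real^3" assume "i \<in> Basis"
  then obtain k where "i = axis k 1"
    by (auto simp: Basis_vec_def)
  with assms exhaust_3[of k] show "((\<lambda>x. f x \<bullet> i) has_derivative (\<lambda>x. f' x \<bullet> i)) (at a within S)"
    by (auto simp: inner_axis)
qed

lemma has_derivative_vec_nth [derivative_intros]:
  "((\<lambda>x. x $ i) has_derivative (\<lambda>x. x $ i)) F"
  by (rule bounded_linear_imp_has_derivative) (rule bounded_linear_vec_nth)

lemma spherical_map_has_derivative:
  assumes "u \<in> spherical_box"
  shows "(spherical_map has_derivative spherical_deriv u) (at u within S)"
proof -
  from assms have t: "\<bar>u$2\<bar> < 1" by (auto simp: spherical_box_def)
  then have pos: "0 < 1 - (u$2)\<^sup>2"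
    by (simp add: abs_square_less_1)
  have w: "((\<lambda>x::real^3. sqrt (1 - (x$2)\<^sup>2)) has_derivative
          (\<lambda>h. - (u$2) / sqrt (1 - (u$2)\<^sup>2) * h$2)) (at u within S)"
    using pos by (auto intro!: derivative_eq_intros simp: fun_eq_iff field_simps)
  have c: "((\<lambda>x::real^3. cos (x$3)) has_derivative (\<lambda>h. - sin (u$3) * h$3)) (at u within S)"
    and s: "((\<lambda>x::real^3. sin (x$3)) has_derivative (\<lambda>h. cos (u$3) * h$3)) (at u within S)"
    by (auto intro!: derivative_eq_intros)
  have i: "((\<lambda>x::real^3. x$i) has_derivative (\<lambda>h. h$i)) (at u within S)" for i
    by (rule has_derivative_vec_nth)
  show ?thesis
  proof (rule has_derivative_vec3I)
    show "((\<lambda>x. spherical_map x $ 1) has_derivative (\<lambda>x. spherical_deriv u x $ 1)) (at u within S)"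
      using has_derivative_mult[OF i[of 1] has_derivative_mult[OF w c]]
      by (simp add: spherical_map_def spherical_deriv_def Let_def algebra_simps)
    show "((\<lambda>x. spherical_map x $ 2) has_derivative (\<lambda>x. spherical_deriv u x $ 2)) (at u within S)"
      using has_derivative_mult[OF i[of 1] has_derivative_mult[OF w s]]
      by (simp add: spherical_map_def spherical_deriv_def Let_def algebra_simps)
    show "((\<lambda>x. spherical_map x $ 3) has_derivative (\<lambda>x. spherical_deriv u x $ 3)) (at u within S)"
      using has_derivative_mult[OF i[of 1] i[of 2]]
      by (simp add: spherical_map_def spherical_deriv_def Let_def algebra_simps)
  qed
qed

text \<open>Using the height instead of the polar angle removes the sine factor of the usual
  Jacobian, so that only r^2 remains.\<close>

lemma abs_det_spherical_deriv:
  assumes "u \<in> spherical_box"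
  shows "\<bar>det (matrix (spherical_deriv u))\<bar> = (u$1)\<^sup>2"
proof -
  from assms have t: "\<bar>u$2\<bar> < 1" by (auto simp: spherical_box_def)
  then have pos: "0 < 1 - (u$2)\<^sup>2"
    by (simp add: abs_square_less_1)
  define w where "w = sqrt (1 - (u$2)\<^sup>2)"
  have w: "w \<noteq> 0" "w * w = 1 - (u$2)\<^sup>2"
    using pos by (simp_all add: w_def)
  \<comment> \<open>With t / w as a separate unknown \<open>q\<close> and \<open>q * w = t\<close>,
    the determinant is a polynomial identity modulo three relations.\<close>
  define q where "q = u$2 / w"
  have qw: "q * w = u$2" using w by (simp add: q_def)
  have cs: "sin (u$3) * sin (u$3) = 1 - cos (u$3) * cos (u$3)"
    using sin_cos_squared_add3[of "u$3"] by (simp add: algebra_simps)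
  have "det (matrix (spherical_deriv u)) =
      w * cos (u$3) * (- (u$1 * w * cos (u$3)) * u$1)
      - u$1 * q * cos (u$3) * (u$1 * w * cos (u$3) * u$2)
      - u$1 * w * sin (u$3) * (w * sin (u$3) * u$1 + u$1 * q * sin (u$3) * u$2)"
    unfolding det_3 matrix_def spherical_deriv_def Let_def w_def[symmetric]
    by (simp add: axis_def q_def algebra_simps)
  also have "\<dots> = - (u$1 * u$1)"
    using w(2) qw cs unfolding power2_eq_square by algebra
  finally show ?thesis by (simp add: power2_eq_square)
qed

lemma spherical_map_inj: "inj_on spherical_map spherical_box"
proof (rule inj_onI)
  fix u v assume u: "u \<in> spherical_box" and v: "v \<in> spherical_box"
    and eq: "spherical_map u = spherical_map v"
  have n: "norm (spherical_map u) = u$1" if "u \<in> spherical_box" for u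
    using that norm_axis_point[of "u$2" "u$3"]
    by (simp add: spherical_map_def spherical_box_def abs_le_iff less_imp_le)
  from n[OF u] n[OF v] eq have 1: "u$1 = v$1" by simp
  with eq u have ax: "axis_point (u$2) (u$3) = axis_point (v$2) (v$3)"
    by (auto simp: spherical_map_def spherical_box_def)
  from arg_cong[OF ax, of "\<lambda>x. x$3"] have 2: "u$2 = v$2" by simp
  have "0 < 1 - (v$2)\<^sup>2"
    using v by (simp add: abs_square_less_1 spherical_box_def abs_less_iff)
  with arg_cong[OF ax, of "\<lambda>x. x$1"] arg_cong[OF ax, of "\<lambda>x. x$2"] 2
  have "cos (u$3) = cos (v$3)" "sin (u$3) = sin (v$3)" by simp_all
  then obtain n :: int where n: "u$3 = v$3 + 2 * pi * n"
    using sin_cos_eq_iff by metis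
  have "\<bar>u$3 - v$3\<bar> < 2 * pi"
    using u v by (auto simp: spherical_box_def)
  with n have "2 * pi * \<bar>real_of_int n\<bar> < 2 * pi * 1" by (simp add: abs_mult)
  then have "\<bar>real_of_int n\<bar> < 1" by (subst (asm) mult_less_cancel_left_pos) auto
  then have "n = 0" by linarith
  with n 1 2 show "u = v" by (simp add: vec_eq_iff forall_3)
qed

text \<open>The box omits longitude 0 and the poles. Both lie in the plane x_2 = 0, a null
  set.\<close>

lemma cone_diff_spherical_map:
  "{x :: real^3. norm x < 1 \<and> x \<noteq> 0} - spherical_map ` spherical_box \<subseteq> {x. x$2 = 0}"
proof clarify
  fix x :: "real^3" assume x: "norm x < 1" "x \<noteq> 0" "x \<notin> spherical_map ` spherical_box"
  show "x$2 = 0"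
  proof (rule ccontr)
    assume x2: "x$2 \<noteq> 0"
    define r t w where "r = norm x" and "t = x$3 / r" and "w = sqrt (1 - t\<^sup>2)"
    have r: "0 < r" "r < 1" using x by (auto simp: r_def)
    have r2: "r\<^sup>2 = (x$1)\<^sup>2 + (x$2)\<^sup>2 + (x$3)\<^sup>2" by (simp add: r_def norm_vec3)
    have t2: "1 - t\<^sup>2 = ((x$1)\<^sup>2 + (x$2)\<^sup>2) / r\<^sup>2"
    proof -
      have "1 - t\<^sup>2 = (r\<^sup>2 - (x$3)\<^sup>2) / r\<^sup>2"
        using r by (simp add: t_def power_divide diff_divide_distrib)
      then show ?thesis by (simp add: r2)
    qed
    also have "\<dots> > 0" using r x2 by (auto intro!: divide_pos_pos add_nonneg_pos)
    finally have t1: "1 - t\<^sup>2 > 0" .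
    then have w: "w > 0" "w\<^sup>2 = 1 - t\<^sup>2" by (simp_all add: w_def)
    have "(x$1 / (r * w))\<^sup>2 + (x$2 / (r * w))\<^sup>2 = ((x$1)\<^sup>2 + (x$2)\<^sup>2) / (r\<^sup>2 * w\<^sup>2)"
      by (simp add: power_divide power_mult_distrib add_divide_distrib)
    also have "r\<^sup>2 * w\<^sup>2 = (x$1)\<^sup>2 + (x$2)\<^sup>2" using r by (simp add: w t2)
    also have "((x$1)\<^sup>2 + (x$2)\<^sup>2) / \<dots> = 1" using x2 by (simp add: add_nonneg_eq_0_iff)
    finally obtain \<alpha> where \<alpha>: "0 \<le> \<alpha>" "\<alpha> < 2 * pi" "x$1 / (r * w) = cos \<alpha>" "x$2 / (r * w) = sin \<alpha>"
      using sincos_total_2pi by metis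
    have "\<alpha> \<noteq> 0" using \<alpha> x2 r w by auto
    moreover have "\<bar>t\<bar> < 1" using t1 by (simp add: abs_square_less_1[symmetric])
    ultimately have "(vector [r, t, \<alpha>] :: real^3) \<in> spherical_box"
      using r \<alpha> by (auto simp: spherical_box_def)
    moreover have "spherical_map (vector [r, t, \<alpha>]) = x"
      using r w by (simp add: spherical_map_def vec_eq_iff forall_3 \<alpha>(3,4)[symmetric] w_def[symmetric])
         (simp add: t_def)
    ultimately show False using x by force
  qed
qed

section \<open>Surface measure as the image of plane measure on a rectangle\<close>

lemma vector3_measurable [measurable]:
  "(\<lambda>(a, b, c). vector [a, b, c] :: real^3) \<in> borel_measurable borel"
proof -
  have "(\<lambda>(a, b, c). vector [a, b, c] :: real^3) = (\<lambda>p. fst p *\<^sub>R axis 1 1 + fst (snd p) *\<^sub>R axis 2 1 + snd (snd p) *\<^sub>R axis 3 1)"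
    by (auto simp: fun_eq_iff vec_eq_iff forall_3 axis_def)
  then show ?thesis
    by (simp only:) (intro borel_measurable_continuous_onI continuous_intros)
qed

lemma emeasure_lborel_Times:
  fixes A :: "'a::euclidean_space set" and B :: "'b::euclidean_space set"
  assumes "A \<in> sets borel" "B \<in> sets borel"
  shows "emeasure lborel (A \<times> B) = emeasure lborel A * emeasure lborel B"
  using assms by (simp add: lborel_prod[symmetric] lborel.emeasure_pair_measure_Times)

text \<open>Moves integrals over \<open>real^3\<close> to nested pairs, where Tonelli separates the
  radius from height and longitude.\<close>

lemma distr_lborel_vector3:
  "distr lborel borel (\<lambda>(a, b, c). vector [a, b, c] :: real^3) = lborel"
proof (rule lborel_eqI[symmetric])
  fix l u :: "real^3" assume le: "\<And>b. b \<in> Basis \<Longrightarrow> l \<bullet> b \<le> u \<bullet> b"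
  have lu: "l$i \<le> u$i" for i
    using le[of "axis i 1"] by (auto simp: Basis_vec_def inner_axis)
  have vim: "(\<lambda>(a, b, c). vector [a, b, c] :: real^3) -` box l u =
      box (l$1) (u$1) \<times> box (l$2) (u$2) \<times> box (l$3) (u$3)"
    by (auto simp: mem_box_cart forall_3)
  have "emeasure (distr lborel borel (\<lambda>(a, b, c). vector [a, b, c] :: real^3)) (box l u) =
      emeasure lborel (box (l$1) (u$1) \<times> box (l$2) (u$2) \<times> box (l$3) (u$3))"
    by (subst emeasure_distr) (simp_all add: vim)
  also have "\<dots> = ennreal (u$1 - l$1) * (ennreal (u$2 - l$2) * ennreal (u$3 - l$3))"
    using lu by (simp add: emeasure_lborel_Times borel_Times)
  also have "\<dots> = ennreal (\<Prod>b\<in>Basis. (u - l) \<bullet> b)"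
  proof -
    have "(\<Prod>b\<in>Basis. (u - l) \<bullet> b) = (\<Prod>i\<in>UNIV. (u - l) $ i)"
    proof -
      have B: "(Basis :: (real^3) set) = (\<lambda>i. axis i 1) ` UNIV"
        by (auto simp: Basis_vec_def)
      show ?thesis unfolding B
        by (subst prod.reindex) (auto simp: inj_on_def axis_eq_axis inner_axis)
    qed
    also have "\<dots> = (u$1 - l$1) * ((u$2 - l$2) * (u$3 - l$3))"
    proof -
      have "(\<Prod>i\<in>UNIV. f i) = f 1 * (f 2 * f 3)" for f :: "3 \<Rightarrow> real"
        unfolding UNIV_3 by simp
      then show ?thesis by simp
    qed
    finally show ?thesis using lu by (simp add: ennreal_mult'[symmetric])
  qed
  finally show "emeasure (distr lborel borel (\<lambda>(a, b, c). vector [a, b, c] :: real^3)) (box l u) =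
     ennreal (\<Prod>b\<in>Basis. (u - l) \<bullet> b)" .
qed simp

lemma axis_point_measurable [measurable]:
  "(\<lambda>(t, \<alpha>). axis_point t \<alpha>) \<in> borel_measurable borel"
proof -
  have "(\<lambda>(t, \<alpha>). axis_point t \<alpha>) =
      (\<lambda>(t, \<alpha>). (sqrt (1 - t\<^sup>2) * cos \<alpha>) *\<^sub>R axis 1 1 + (sqrt (1 - t\<^sup>2) * sin \<alpha>) *\<^sub>R axis 2 1 + t *\<^sub>R axis 3 1)"
    by (auto simp: fun_eq_iff vec_eq_iff forall_3 axis_def)
  then show ?thesis
    by (simp only: case_prod_unfold) (intro borel_measurable_continuous_onI continuous_intros)
qed

text \<open>Closed, to match the set integrals in \<open>spherical_transform\<close> and in the
  theorem.\<close>

definition cylinder :: "(real \<times> real) measure" where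
  "cylinder = restrict_space lborel ({-1..1} \<times> {0..2 * pi})"

text \<open>Change of variables in polar coordinates. The Jacobian r^2 separates from the angular
  part, and its integral over the unit interval is 1/3, which cancels the factor 3 from
  \<open>sphere_measure\<close>.\<close>

lemma emeasure_cone:
  assumes A: "A \<in> sets borel" "A \<subseteq> sphere (0 :: real^3) 1"
  shows "3 * emeasure lborel {x. norm x < 1 \<and> x \<noteq> 0 \<and> sgn x \<in> A} =
    emeasure lborel {(t, \<alpha>). -1 < t \<and> t < 1 \<and> 0 < \<alpha> \<and> \<alpha> < 2 * pi \<and> axis_point t \<alpha> \<in> A}"
proof -
  define E where "E = {(t, \<alpha>). -1 < t \<and> t < 1 \<and> 0 < \<alpha> \<and> \<alpha> < 2 * pi \<and> axis_point t \<alpha> \<in> A}"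
  define C where "C = {x. norm x < 1 \<and> x \<noteq> 0 \<and> sgn x \<in> A}"
  define S where "S = {u \<in> spherical_box. axis_point (u$2) (u$3) \<in> A}"
  \<comment> \<open>The Jacobian of \<open>spherical_map\<close> on \<open>S\<close>, extended by
    zero. Its integral is first found by Tonelli and then passed as a \<open>has_integral\<close>
    fact to the change of variables.\<close>
  define f where "f = (\<lambda>u::real^3. indicator S u * (u$1)\<^sup>2)"
  have [measurable]: "A \<in> sets borel" by fact
  have E_eq: "E = ({-1<..<1} \<times> {0<..<2*pi}) \<inter> (\<lambda>(t, \<alpha>). axis_point t \<alpha>) -` A"
    by (auto simp: E_def)
  have E_meas [measurable]: "E \<in> sets borel"
    unfolding E_eq
  proof (rule sets.Int)
    show "(\<lambda>(t, \<alpha>). axis_point t \<alpha>) -` A \<in> sets borel"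
      by (rule measurable_sets_borel[OF axis_point_measurable]) fact
  qed (intro borel_open open_Times open_greaterThanLessThan)
  have "S = (\<lambda>u::real^3. (u$1, u$2, u$3)) -` ({0<..<1} \<times> E)"
    by (auto simp: S_def E_def spherical_box_def)
  moreover have m3: "(\<lambda>u::real^3. (u$1, u$2, u$3)) \<in> borel_measurable borel"
    by (intro borel_measurable_continuous_onI continuous_intros)
  ultimately have S_meas [measurable]: "S \<in> sets borel"
    by (auto intro!: measurable_sets_borel[OF m3] borel_Times)
  have f_meas [measurable]: "f \<in> borel_measurable borel"
    unfolding f_def by measurable
  have "(\<integral>\<^sup>+u. f u \<partial>lborel) =
      (\<integral>\<^sup>+p. f ((\<lambda>(a, b, c). vector [a, b, c]) p) \<partial>lborel)"
    by (subst distr_lborel_vector3[symmetric], subst nn_integral_distr) auto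
  also have "\<dots> = (\<integral>\<^sup>+p. ennreal (indicator {0<..<1} (fst p) * (fst p)\<^sup>2) * indicator E (snd p)
       \<partial>(lborel \<Otimes>\<^sub>M lborel))"
    unfolding lborel_prod
    by (intro nn_integral_cong)
       (auto simp: f_def S_def E_def spherical_box_def indicator_def split: if_splits)
  also have "\<dots> = (\<integral>\<^sup>+a. \<integral>\<^sup>+p. ennreal (indicator {0<..<1} a * a\<^sup>2) * indicator E p \<partial>lborel \<partial>lborel)"
    by (subst lborel.nn_integral_fst[symmetric]) auto
  also have "\<dots> = (\<integral>\<^sup>+a. ennreal (indicator {0<..<1} a * a\<^sup>2) \<partial>lborel) * emeasure lborel E"
    by (simp add: nn_integral_cmult nn_integral_multc)
  also have "(\<integral>\<^sup>+a. ennreal (indicator {0<..<1} a * a\<^sup>2) \<partial>lborel) = ennreal (1 / 3)"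
  proof -
    have "((\<lambda>a::real. a\<^sup>2) has_integral (1 ^ 3 / 3 - 0 ^ 3 / 3)) {0..1}"
      by (rule fundamental_theorem_of_calculus)
         (auto intro!: derivative_eq_intros simp flip: has_real_derivative_iff_has_vector_derivative)
    then have "((\<lambda>a::real. a\<^sup>2) has_integral (1 / 3)) {0<..<1}"
      by (simp add: has_integral_Icc_iff_Ioo)
    from nn_integral_has_integral_lebesgue[OF _ this] show ?thesis by simp
  qed
  finally have nn: "(\<integral>\<^sup>+u. f u \<partial>lborel) = ennreal (1 / 3) * emeasure lborel E" .
  have "emeasure lborel E \<le> emeasure lborel (cbox (-1, 0) (1, 2 * pi) :: (real \<times> real) set)"
    by (rule emeasure_mono) (auto simp: E_def)
  also have "\<dots> < \<infinity>" by (rule emeasure_lborel_cbox_finite)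
  finally have Efin: "emeasure lborel E < \<infinity>" .
  define r where "r = 1 / 3 * measure lborel E"
  have r: "(\<integral>\<^sup>+u. f u \<partial>lborel) = ennreal r" "0 \<le> r"
    using Efin by (simp_all add: nn r_def emeasure_eq_ennreal_measure flip: ennreal_mult)
  have "(f has_integral r) UNIV"
    by (rule nn_integral_has_integral[OF f_meas _ r]) (simp add: f_def)
  moreover have "f = (\<lambda>u. if u \<in> S then \<bar>det (matrix (spherical_deriv u))\<bar> else 0)"
    by (auto simp: f_def fun_eq_iff S_def abs_det_spherical_deriv)
  ultimately have hi: "((\<lambda>u. \<bar>det (matrix (spherical_deriv u))\<bar>) has_integral r) S"
    by (simp only: has_integral_restrict_UNIV)
  have "spherical_map ` S \<in> lmeasurable \<and> measure lebesgue (spherical_map ` S) = r"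
  proof (subst has_measure_differentiable_image)
    show "inj_on spherical_map S"
      by (rule inj_on_subset[OF spherical_map_inj]) (auto simp: S_def)
    show "(spherical_map has_derivative spherical_deriv u) (at u within S)" if "u \<in> S" for u
      using that by (intro spherical_map_has_derivative) (auto simp: S_def)
  qed (use hi S_meas in auto)
  then have im: "spherical_map ` S \<in> lmeasurable" "emeasure lebesgue (spherical_map ` S) = ennreal r"
    by (auto simp: emeasure_eq_measure2)
  have sub: "spherical_map ` S \<subseteq> C"
  proof clarify
    fix u assume u: "u \<in> S"
    then have "norm (axis_point (u$2) (u$3)) = 1"
      by (intro norm_axis_point) (auto simp: S_def spherical_box_def)
    then show "spherical_map u \<in> C"
      using u by (auto simp: C_def spherical_map_def S_def spherical_box_def sgn_scaleR)
         (auto simp: sgn_div_norm)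
  qed
  have "C - spherical_map ` S \<subseteq> {x. x$2 = 0}"
  proof
    fix x assume x: "x \<in> C - spherical_map ` S"
    show "x \<in> {x. x$2 = 0}"
    proof (rule ccontr)
      assume "x \<notin> {x. x$2 = 0}"
      with x cone_diff_spherical_map obtain u where u: "u \<in> spherical_box" "x = spherical_map u"
        by (auto simp: C_def)
      then have "norm (axis_point (u$2) (u$3)) = 1"
        by (intro norm_axis_point) (auto simp: spherical_box_def)
      then have "sgn x = axis_point (u$2) (u$3)"
        using u by (auto simp: spherical_map_def spherical_box_def sgn_scaleR)
           (auto simp: sgn_div_norm)
      with x u show False by (auto simp: C_def S_def)
    qed
  qed
  \<comment> \<open>Only a null part of the cone is missed, so the image of \<open>S\<close> already
    has its full volume.\<close>
  then have null: "C - spherical_map ` S \<in> null_sets lebesgue"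
    using negligible_standard_hyperplane_cart negligible_iff_null_sets negligible_subset by blast
  have C_meas [measurable]: "C \<in> sets borel"
  proof -
    have "(\<lambda>x::real^3. inverse (norm x) *\<^sub>R x) \<in> borel_measurable borel" by measurable
    then have [measurable]: "(sgn :: real^3 \<Rightarrow> _) \<in> borel_measurable borel"
      by (simp add: sgn_div_norm[abs_def])
    show ?thesis unfolding C_def by measurable
  qed
  have "emeasure lborel C = emeasure lebesgue C" by simp
  also have "\<dots> = emeasure lebesgue (spherical_map ` S \<union> (C - spherical_map ` S))"
    using sub by (simp add: Un_absorb1)
  also have "\<dots> = ennreal r"
    using im null by (subst emeasure_Un_null_set) (auto simp: fmeasurableD)
  finally have "3 * emeasure lborel C = 3 * ennreal (1/3) * emeasure lborel E"
    using nn r by (simp add: mult.assoc)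
  also have "3 * ennreal (1/3) = 1"
    by (simp flip: ennreal_numeral ennreal_mult')
  finally show ?thesis by (simp add: C_def E_def)
qed

lemma emeasure_sphere_measure_eq:
  assumes "A \<in> sets sphere_measure"
  shows "emeasure sphere_measure (A :: (real^3) set) =
    3 * emeasure lborel {x. norm x < 1 \<and> x \<noteq> 0 \<and> sgn x \<in> A}"
proof -
  have *: "sgn -` A \<inter> (ball 0 1 - {0}) = {x. norm x < 1 \<and> x \<noteq> 0 \<and> sgn x \<in> A}"
    by auto
  have A: "A \<in> sets (restrict_space borel (sphere 0 1))"
    using assms by (simp add: sets_sphere_measure)
  have "emeasure sphere_measure A =
      3 * emeasure (restrict_space lborel (ball 0 1 - {0})) {x. norm x < 1 \<and> x \<noteq> 0 \<and> sgn x \<in> A}"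
    unfolding sphere_measure_def using A
    by (subst emeasure_scale_measure, subst emeasure_distr[OF sgn_measurable_sphere])
       (simp_all add: * space_restrict_space)
  also have "emeasure (restrict_space lborel (ball 0 1 - {0})) {x. norm x < 1 \<and> x \<noteq> 0 \<and> sgn x \<in> A} =
      emeasure lborel {x. norm x < 1 \<and> x \<noteq> 0 \<and> sgn x \<in> A}"
    by (rule emeasure_restrict_space) auto
  finally show ?thesis .
qed

lemma sets_sphere_measureD:
  assumes "A \<in> sets (sphere_measure :: (real^3) measure)"
  shows "A \<in> sets borel" "A \<subseteq> sphere 0 1"
proof -
  have "A \<in> sets (restrict_space borel (sphere (0 :: real^3) 1))"
    using assms by (simp add: sets_sphere_measure)
  moreover have "sphere (0 :: real^3) 1 \<inter> space borel \<in> sets borel"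
    by (simp add: borel_closed)
  ultimately show "A \<in> sets borel" "A \<subseteq> sphere 0 1"
    by (auto simp: sets_restrict_space_iff)
qed

lemma axis_point_measurable_cylinder:
  "(\<lambda>(t, \<alpha>). axis_point t \<alpha>) \<in> measurable cylinder (restrict_space borel (sphere 0 1))"
  unfolding cylinder_def
proof (rule measurable_restrict_space2)
  show "(\<lambda>(t, \<alpha>). axis_point t \<alpha>) \<in> space (restrict_space lborel ({-1..1} \<times> {0..2 * pi})) \<rightarrow> sphere 0 1"
    by (auto simp: space_restrict_space intro!: norm_axis_point)
qed (auto intro!: measurable_restrict_space1)

text \<open>Archimedes' theorem: the radial projection between the sphere and the cylinder around it
  preserves area.\<close>

lemma sphere_measure_axis_point:
  "sphere_measure = distr cylinder (restrict_space borel (sphere 0 1)) (\<lambda>(t, \<alpha>). axis_point t \<alpha>)"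
proof (rule measure_eqI)
  fix A :: "(real^3) set" assume A: "A \<in> sets sphere_measure"
  note A' = sets_sphere_measureD[OF A]
  define F where "F = ({-1..1} \<times> {0..2 * pi}) \<inter> (\<lambda>(t, \<alpha>). axis_point t \<alpha>) -` A"
  define E where "E = {(t, \<alpha>). -1 < t \<and> t < 1 \<and> 0 < \<alpha> \<and> \<alpha> < 2 * pi \<and> axis_point t \<alpha> \<in> A}"
  have vim: "(\<lambda>(t, \<alpha>). axis_point t \<alpha>) -` A \<in> sets borel"
    by (rule measurable_sets_borel[OF axis_point_measurable]) fact
  have F: "F \<in> sets borel"
    unfolding F_def by (intro sets.Int vim borel_closed closed_Times) auto
  have E_eq: "E = ({-1<..<1} \<times> {0<..<2*pi}) \<inter> (\<lambda>(t, \<alpha>). axis_point t \<alpha>) -` A"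
    by (auto simp: E_def)
  have E: "E \<in> sets borel"
    unfolding E_eq by (intro sets.Int vim borel_open open_Times) auto
  have "emeasure (distr cylinder (restrict_space borel (sphere 0 1)) (\<lambda>(t, \<alpha>). axis_point t \<alpha>)) A
      = emeasure cylinder F"
    using A
    by (subst emeasure_distr[OF axis_point_measurable_cylinder])
       (auto simp: sets_sphere_measure F_def cylinder_def space_restrict_space intro!: arg_cong[where f = "emeasure _"])
  also have "\<dots> = emeasure lborel F"
    unfolding cylinder_def
    by (subst emeasure_restrict_space) (auto simp: F_def intro!: borel_closed closed_Times)
  \<comment> \<open>The closed and the open rectangle differ at most by points of four
    lines.\<close>
  also have "\<dots> = emeasure lborel E"
  proof (rule emeasure_eq_AE)
    have null: "{a} \<times> UNIV \<in> null_sets (lborel :: (real \<times> real) measure)"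
      "UNIV \<times> {a} \<in> null_sets (lborel :: (real \<times> real) measure)" for a :: real
      by (auto simp: null_sets_def emeasure_lborel_Times borel_Times)
    have "AE p in lborel. p \<notin> {-1 :: real} \<times> UNIV \<and> p \<notin> {1} \<times> UNIV \<and> p \<notin> UNIV \<times> {0 :: real} \<and> p \<notin> UNIV \<times> {2 * pi}"
      by (intro AE_conjI AE_not_in null)
    then show "AE p in lborel. p \<in> F \<longleftrightarrow> p \<in> E"
      by eventually_elim (auto simp: E_def F_def)
  qed (use E F in auto)
  finally show "emeasure sphere_measure A =
      emeasure (distr cylinder (restrict_space borel (sphere 0 1)) (\<lambda>(t, \<alpha>). axis_point t \<alpha>)) A"
    using emeasure_cone[OF A'] by (simp add: emeasure_sphere_measure_eq[OF A] E_def)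
qed (simp add: sets_sphere_measure)

section \<open>Rotation invariance and integration along circles around an equatorial axis\<close>

lemma orthogonal_measurable_sphere:
  fixes T :: "real^3 \<Rightarrow> real^3"
  assumes "orthogonal_transformation T"
  shows "T \<in> measurable (restrict_space borel (sphere 0 1)) (restrict_space borel (sphere 0 1))"
proof (rule measurable_restrict_space2)
  have "linear T" using assms by (rule orthogonal_transformation_linear)
  then have "continuous_on UNIV T" by (rule linear_continuous_on[OF linear_linear[THEN iffD2]])
  then show "T \<in> measurable (restrict_space borel (sphere 0 1)) borel"
    by (intro measurable_restrict_space1 borel_measurable_continuous_onI)
qed (use assms in \<open>auto simp: space_restrict_space orthogonal_transformation\<close>)

text \<open>An orthogonal map carries the cone over the preimage of a set onto the cone over the
  set, and it preserves volume.\<close>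

lemma distr_sphere_measure_orthogonal:
  fixes T :: "real^3 \<Rightarrow> real^3"
  assumes T: "orthogonal_transformation T"
  shows "distr sphere_measure (restrict_space borel (sphere 0 1)) T = sphere_measure"
proof (rule measure_eqI)
  fix A :: "(real^3) set" assume "A \<in> sets (distr sphere_measure (restrict_space borel (sphere 0 1)) T)"
  then have A: "A \<in> sets sphere_measure" by (simp add: sets_sphere_measure)
  note A' = sets_sphere_measureD[OF A]
  have meas: "T \<in> measurable sphere_measure (restrict_space borel (sphere 0 1))"
    using orthogonal_measurable_sphere[OF T] by (simp add: measurable_cong_sets[OF sets_sphere_measure])
  define B where "B = T -` A \<inter> sphere 0 1"
  have B: "B \<in> sets sphere_measure"
    using measurable_sets[OF meas, of A] A by (simp add: B_def sets_sphere_measure)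
  have lin: "linear T" and nrm: "norm (T x) = norm x" for x
    using T by (auto simp: orthogonal_transformation)
  define C where "C = (\<lambda>A. {x :: real^3. norm x < 1 \<and> x \<noteq> 0 \<and> sgn x \<in> A})"
  have C_meas: "C A \<in> sets borel" if [measurable]: "A \<in> sets borel" for A
  proof -
    have "(\<lambda>x::real^3. inverse (norm x) *\<^sub>R x) \<in> borel_measurable borel" by measurable
    then have [measurable]: "(sgn :: real^3 \<Rightarrow> _) \<in> borel_measurable borel"
      by (simp add: sgn_div_norm[abs_def])
    show ?thesis unfolding C_def by measurable
  qed
  have sgnT: "sgn (T x) = T (sgn x)" for x
    using lin by (simp add: sgn_div_norm nrm linear_scale)
  have T0: "T x = 0 \<longleftrightarrow> x = 0" for x
    using nrm[of x] by (metis norm_eq_zero)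
  have CB: "T ` C B = C A"
  proof (intro equalityI subsetI)
    fix y assume "y \<in> C A"
    moreover obtain x where "y = T x"
      using orthogonal_transformation_surj[OF T] by (metis surjD)
    ultimately show "y \<in> T ` C B"
      by (auto simp: C_def B_def nrm sgnT T0 norm_sgn)
  qed (auto simp: C_def B_def nrm sgnT T0 norm_sgn)
  have lm: "C B \<in> lmeasurable"
  proof (rule bounded_set_imp_lmeasurable)
    show "bounded (C B)" by (rule bounded_subset[OF bounded_ball[of 0 1]]) (auto simp: C_def)
    show "C B \<in> sets lebesgue" using C_meas[OF sets_sphere_measureD(1)[OF B]] by simp
  qed
  have "emeasure lborel (C A) = emeasure lebesgue (T ` C B)"
    using C_meas[OF A'(1)] by (simp add: CB)
  also have "\<dots> = emeasure lebesgue (C B)"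
    using measurable_orthogonal_image[OF T lm] measure_orthogonal_image[OF T lm] lm
    by (simp add: emeasure_eq_measure2)
  also have "\<dots> = emeasure lborel (C B)"
    using C_meas[OF sets_sphere_measureD(1)[OF B]] by simp
  finally have "emeasure sphere_measure A = emeasure sphere_measure B"
    using A B by (simp add: emeasure_sphere_measure_eq C_def)
  then show "emeasure (distr sphere_measure (restrict_space borel (sphere 0 1)) T) A = emeasure sphere_measure A"
    using A by (subst emeasure_distr[OF meas]) (auto simp: B_def sets_sphere_measure)
qed (simp add: sets_sphere_measure)

lemma circle_point_measurable_cylinder:
  "(\<lambda>(t, \<alpha>). circle_point (vector [cos \<theta>, sin \<theta>, 0]) t \<alpha>)
     \<in> measurable cylinder (restrict_space borel (sphere 0 1))"
  and sphere_measure_circle_point: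
  "sphere_measure = distr cylinder (restrict_space borel (sphere 0 1))
     (\<lambda>(t, \<alpha>). circle_point (vector [cos \<theta>, sin \<theta>, 0]) t \<alpha>)"
proof -
  \<comment> \<open>The rotation that sends the third axis to \<zeta> = (cos \<theta>, sin \<theta>,
    0), the first to the tangent (-sin \<theta>, cos \<theta>, 0) and the second to the third axis.
    It turns \<open>axis_point\<close> into \<open>circle_point\<close>.\<close>
  define T where "T = (\<lambda>x::real^3. vector [x$3 * cos \<theta> - x$1 * sin \<theta>,
    x$3 * sin \<theta> + x$1 * cos \<theta>, x$2] :: real^3)"
  have "linear T"
    by (rule linearI) (simp_all add: T_def vec_eq_iff forall_3 algebra_simps)
  moreover have "norm (T x) = norm x" for x
  proof -
    have "(x$3 * cos \<theta> - x$1 * sin \<theta>)\<^sup>2 + (x$3 * sin \<theta> + x$1 * cos \<theta>)\<^sup>2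
        = ((x$1)\<^sup>2 + (x$3)\<^sup>2) * ((sin \<theta>)\<^sup>2 + (cos \<theta>)\<^sup>2)"
      by algebra
    then show ?thesis by (simp add: norm_vec3 T_def)
  qed
  ultimately have T: "orthogonal_transformation T"
    by (simp add: orthogonal_transformation)
  have eq: "(\<lambda>(t, \<alpha>). circle_point (vector [cos \<theta>, sin \<theta>, 0]) t \<alpha>) = T \<circ> (\<lambda>(t, \<alpha>). axis_point t \<alpha>)"
    by (auto simp: fun_eq_iff circle_point_def T_def vec_eq_iff forall_3)
  show "(\<lambda>(t, \<alpha>). circle_point (vector [cos \<theta>, sin \<theta>, 0]) t \<alpha>)
     \<in> measurable cylinder (restrict_space borel (sphere 0 1))"
    unfolding eq
    by (rule measurable_comp[OF axis_point_measurable_cylinder orthogonal_measurable_sphere[OF T]])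
  have "sphere_measure = distr (distr cylinder (restrict_space borel (sphere 0 1)) (\<lambda>(t, \<alpha>). axis_point t \<alpha>))
      (restrict_space borel (sphere 0 1)) T"
    unfolding sphere_measure_axis_point[symmetric] by (rule distr_sphere_measure_orthogonal[OF T, symmetric])
  also have "\<dots> = distr cylinder (restrict_space borel (sphere 0 1)) (T \<circ> (\<lambda>(t, \<alpha>). axis_point t \<alpha>))"
    by (rule distr_distr[OF orthogonal_measurable_sphere[OF T] axis_point_measurable_cylinder])
  finally show "sphere_measure = distr cylinder (restrict_space borel (sphere 0 1))
     (\<lambda>(t, \<alpha>). circle_point (vector [cos \<theta>, sin \<theta>, 0]) t \<alpha>)"
    unfolding eq .
qed

lemma integral_cylinder:
  fixes G :: "real \<times> real \<Rightarrow> real"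
  assumes "integrable cylinder G"
  shows "(LINT p|cylinder. G p) = (LBINT t:{-1..1}. LBINT \<alpha>:{0..2 * pi}. G (t, \<alpha>))"
proof -
  have s: "({-1..1} \<times> {0..2 * pi}) \<inter> space lborel \<in> sets (lborel :: (real \<times> real) measure)"
    by (auto intro!: borel_closed closed_Times)
  let ?H = "\<lambda>p. indicator ({-1..1} \<times> {0..2 * pi}) p *\<^sub>R G p"
  have int: "integrable (lborel \<Otimes>\<^sub>M lborel) ?H"
    using assms unfolding cylinder_def integrable_restrict_space[OF s] lborel_prod .
  have "(LINT p|cylinder. G p) = (LINT p|(lborel \<Otimes>\<^sub>M lborel). ?H p)"
    unfolding cylinder_def integral_restrict_space[OF s] lborel_prod ..
  also have "\<dots> = (LBINT t. LBINT \<alpha>. ?H (t, \<alpha>))"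
    by (rule lborel_pair.integral_fst'[OF int, symmetric])
  also have "\<dots> = (LBINT t:{-1..1}. LBINT \<alpha>:{0..2 * pi}. G (t, \<alpha>))"
    unfolding set_lebesgue_integral_def
    by (intro Bochner_Integration.integral_cong refl) (auto simp: indicator_def split: if_splits)
  finally show ?thesis .
qed

lemma integral_sphere_axis_point:
  fixes F :: "real^3 \<Rightarrow> real"
  assumes "integrable sphere_measure F"
  shows "(LINT x|sphere_measure. F x) = (LBINT t:{-1..1}. LBINT \<alpha>:{0..2 * pi}. F (axis_point t \<alpha>))"
proof -
  have F: "F \<in> borel_measurable (restrict_space borel (sphere 0 1))"
    using borel_measurable_integrable[OF assms] by (simp add: measurable_cong_sets[OF sets_sphere_measure])
  have int: "integrable cylinder (\<lambda>p. F ((\<lambda>(t, \<alpha>). axis_point t \<alpha>) p))"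
    using assms unfolding sphere_measure_axis_point integrable_distr_eq[OF axis_point_measurable_cylinder F] .
  show ?thesis
    unfolding sphere_measure_axis_point integral_distr[OF axis_point_measurable_cylinder F]
    by (subst integral_cylinder[OF int]) simp
qed

lemma integral_sphere_circle_point:
  fixes F :: "real^3 \<Rightarrow> real"
  assumes "integrable sphere_measure F"
  shows "(LINT x|sphere_measure. F x) =
    (LBINT t:{-1..1}. LBINT \<alpha>:{0..2 * pi}. F (circle_point (vector [cos \<theta>, sin \<theta>, 0]) t \<alpha>))"
proof -
  note m = circle_point_measurable_cylinder[of \<theta>]
  have F: "F \<in> borel_measurable (restrict_space borel (sphere 0 1))"
    using borel_measurable_integrable[OF assms] by (simp add: measurable_cong_sets[OF sets_sphere_measure])
  have int: "integrable cylinder (\<lambda>p. F ((\<lambda>(t, \<alpha>). circle_point (vector [cos \<theta>, sin \<theta>, 0]) t \<alpha>) p))"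
    using assms unfolding sphere_measure_circle_point[of \<theta>] integrable_distr_eq[OF m F] .
  show ?thesis
    unfolding sphere_measure_circle_point[of \<theta>] integral_distr[OF m F]
    by (subst integral_cylinder[OF int]) simp
qed

section \<open>Jacobi and Gegenbauer polynomials\<close>

definition jacobi_int :: "real \<Rightarrow> real \<Rightarrow> real poly \<Rightarrow> real" where
  "jacobi_int \<alpha> \<beta> p = (LBINT t:{-1..1}. poly p t * jacobi_weight \<alpha> \<beta> t)"

text \<open>The inner product of p and q depends only on their product, so orthogonality and norms
  become statements about one linear functional on polynomials.\<close>

definition jacobi_mean :: "real \<Rightarrow> real \<Rightarrow> real poly \<Rightarrow> real" where
  "jacobi_mean \<alpha> \<beta> p = jacobi_int \<alpha> \<beta> p / jacobi_int \<alpha> \<beta> 1"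

lemma jacobi_inner_eq_mean: "jacobi_inner \<alpha> \<beta> p q = jacobi_mean \<alpha> \<beta> (p * q)"
  by (simp add: jacobi_inner_def jacobi_mean_def jacobi_int_def)

lemma jacobi_weight_measurable [measurable]: "jacobi_weight \<alpha> \<beta> \<in> borel_measurable borel"
  unfolding jacobi_weight_def[abs_def] by measurable

lemma jacobi_weight_nonneg: "jacobi_weight \<alpha> \<beta> t \<ge> 0"
  by (simp add: jacobi_weight_def)

text \<open>The substitution u = (1 + t) / 2 turns this into the Beta integral.\<close>

lemma jacobi_weight_has_integral:
  assumes "\<alpha> > -1" "\<beta> > -1"
  shows "(jacobi_weight \<alpha> \<beta> has_integral 2 powr (\<alpha> + \<beta> + 1) * Beta (\<alpha> + 1) (\<beta> + 1)) {-1..1}"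
proof -
  define f where "f = (\<lambda>u::real. u powr \<beta> * (1 - u) powr \<alpha>)"
  have "(f has_integral Beta (\<beta> + 1) (\<alpha> + 1)) (cbox 0 1)"
    using has_integral_Beta_real[of "\<beta> + 1" "\<alpha> + 1"] assms by (simp add: f_def)
  from has_integral_affinity[OF this, of "1/2" "1/2"]
  have 1: "((\<lambda>t. f (1/2 * t + 1/2)) has_integral 2 * Beta (\<beta> + 1) (\<alpha> + 1)) ((\<lambda>x. 2 * x - 1) ` {0..1})"
    by simp
  have im: "(\<lambda>x. 2 * x - 1) ` {0..1} = {-1..1::real}"
  proof -
    have "(\<lambda>x. 2 * x + (-1)) ` {0..1} = {-1..1::real}"
      by (subst image_affinity_atLeastAtMost) auto
    then show ?thesis by simp
  qed
  have "((\<lambda>t. 2 powr (\<alpha> + \<beta>) * f (1/2 * t + 1/2)) has_integral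
      2 powr (\<alpha> + \<beta>) * (2 * Beta (\<beta> + 1) (\<alpha> + 1))) {-1..1}"
    using has_integral_mult_right[OF 1] im by simp
  moreover have "2 powr (\<alpha> + \<beta>) * f (1/2 * t + 1/2) = jacobi_weight \<alpha> \<beta> t" if "t \<in> {-1..1}" for t
  proof -
    have e: "1/2 * t + 1/2 = (1 + t) / 2" "1 - (1 + t) / 2 = (1 - t) / 2" by (simp_all add: field_simps)
    then have "f (1/2 * t + 1/2) = ((1 + t) / 2) powr \<beta> * ((1 - t) / 2) powr \<alpha>"
      by (simp only: f_def e)
    then show ?thesis using that
      by (simp add: jacobi_weight_def powr_add powr_divide)
  qed
  ultimately have "(jacobi_weight \<alpha> \<beta> has_integral 2 powr (\<alpha> + \<beta>) * (2 * Beta (\<beta> + 1) (\<alpha> + 1))) {-1..1}"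
    by (subst has_integral_cong[symmetric]) auto
  then show ?thesis by (simp add: powr_add mult_ac Beta_commute)
qed

lemma jacobi_weight_set_integrable:
  assumes "\<alpha> > -1" "\<beta> > -1"
  shows "set_integrable lborel {-1..1} (jacobi_weight \<alpha> \<beta>)"
proof -
  have "jacobi_weight \<alpha> \<beta> absolutely_integrable_on {-1..1}"
    using jacobi_weight_has_integral[OF assms] jacobi_weight_nonneg
    by (intro nonnegative_absolutely_integrable_1) (auto simp: has_integral_integrable)
  then show ?thesis
    unfolding set_integrable_def by (subst (asm) integrable_completion) auto
qed

lemma jacobi_weight_integral:
  assumes "\<alpha> > -1" "\<beta> > -1"
  shows "(LBINT t:{-1..1}. jacobi_weight \<alpha> \<beta> t) = 2 powr (\<alpha> + \<beta> + 1) * Beta (\<alpha> + 1) (\<beta> + 1)"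
  using set_borel_integral_eq_integral(2)[OF jacobi_weight_set_integrable[OF assms]]
    jacobi_weight_has_integral[OF assms] by (simp add: integral_unique)

lemma jacobi_poly_set_integrable:
  assumes "\<alpha> > -1" "\<beta> > -1"
  shows "set_integrable lborel {-1..1} (\<lambda>t. poly p t * jacobi_weight \<alpha> \<beta> t)"
proof -
  have "compact (poly p ` {-1..1})"
    by (intro compact_continuous_image continuous_intros) auto
  then obtain C where C: "\<And>t. t \<in> {-1..1} \<Longrightarrow> \<bar>poly p t\<bar> \<le> C"
    using compact_imp_bounded bounded_iff by (metis image_eqI real_norm_def)
  show ?thesis
    unfolding set_integrable_def
  proof (rule Bochner_Integration.integrable_bound)
    show "integrable lborel (\<lambda>t. C * (indicator {-1..1} t *\<^sub>R jacobi_weight \<alpha> \<beta> t))"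
      using jacobi_weight_set_integrable[OF assms] by (simp add: set_integrable_def)
    show "AE t in lborel. norm (indicator {-1..1} t *\<^sub>R (poly p t * jacobi_weight \<alpha> \<beta> t)) \<le>
        norm (C * (indicator {-1..1} t *\<^sub>R jacobi_weight \<alpha> \<beta> t))"
    proof (intro always_eventually allI)
      fix t :: real
      show "norm (indicator {-1..1} t *\<^sub>R (poly p t * jacobi_weight \<alpha> \<beta> t)) \<le>
        norm (C * (indicator {-1..1} t *\<^sub>R jacobi_weight \<alpha> \<beta> t))"
        using C[of t] by (auto simp: indicator_def abs_mult intro!: mult_right_mono)
    qed
    have "poly p \<in> borel_measurable borel"
      by (intro borel_measurable_continuous_onI continuous_intros)
    then show "(\<lambda>t. indicator {-1..1} t *\<^sub>R (poly p t * jacobi_weight \<alpha> \<beta> t)) \<in> borel_measurable lborel"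
      by measurable
  qed
qed

context
  fixes \<alpha> \<beta> :: real
  assumes \<alpha>: "\<alpha> > -1" and \<beta>: "\<beta> > -1"
begin

lemma jacobi_int_1: "jacobi_int \<alpha> \<beta> 1 = 2 powr (\<alpha> + \<beta> + 1) * Beta (\<alpha> + 1) (\<beta> + 1)"
  using jacobi_weight_integral[OF \<alpha> \<beta>] by (simp add: jacobi_int_def)

lemma jacobi_int_1_pos: "jacobi_int \<alpha> \<beta> 1 > 0"
  unfolding jacobi_int_1 Beta_def using \<alpha> \<beta>
  by (intro mult_pos_pos divide_pos_pos Gamma_real_pos) auto

lemma jacobi_mean_add: "jacobi_mean \<alpha> \<beta> (p + q) = jacobi_mean \<alpha> \<beta> p + jacobi_mean \<alpha> \<beta> q"
proof -
  have "jacobi_int \<alpha> \<beta> (p + q) = jacobi_int \<alpha> \<beta> p + jacobi_int \<alpha> \<beta> q"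
    unfolding jacobi_int_def poly_add distrib_right
    by (rule set_integral_add(2)) (rule jacobi_poly_set_integrable[OF \<alpha> \<beta>])+
  then show ?thesis by (simp add: jacobi_mean_def add_divide_distrib)
qed

lemma jacobi_mean_smult: "jacobi_mean \<alpha> \<beta> (smult c p) = c * jacobi_mean \<alpha> \<beta> p"
  by (simp add: jacobi_mean_def jacobi_int_def mult.assoc)

lemma jacobi_mean_0: "jacobi_mean \<alpha> \<beta> 0 = 0"
  using jacobi_mean_smult[of 0 0] by simp

lemma jacobi_mean_sum: "jacobi_mean \<alpha> \<beta> (\<Sum>i\<in>A. p i) = (\<Sum>i\<in>A. jacobi_mean \<alpha> \<beta> (p i))"
  by (induction A rule: infinite_finite_induct) (simp_all add: jacobi_mean_add jacobi_mean_0)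

text \<open>Multiplying by powers of 1 - t and 1 + t only shifts the exponents of the weight, so the
  mean is a quotient of two Beta values.\<close>

lemma jacobi_mean_moment:
  "jacobi_mean \<alpha> \<beta> ([:1/2, -1/2:] ^ i * [:1/2, 1/2:] ^ m) =
     pochhammer (\<alpha> + 1) i * pochhammer (\<beta> + 1) m / pochhammer (\<alpha> + \<beta> + 2) (i + m)"
proof -
  have "poly ([:1/2, -1/2:] ^ i * [:1/2, 1/2:] ^ m) t * jacobi_weight \<alpha> \<beta> t
      = (1/2) ^ (i + m) * jacobi_weight (\<alpha> + i) (\<beta> + m) t" if t: "t \<in> {-1..1}" for t :: real
  \<comment> \<open>At the end points both weights are 0, since \<open>0 powr a = 0\<close> for
    every exponent.\<close>
  proof (cases "t = 1 \<or> t = -1")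
    case False
    then have pos: "1 - t > 0" "1 + t > 0" using t by auto
    have "poly ([:1/2, -1/2:] ^ i * [:1/2, 1/2:] ^ m) t = ((1/2) * (1 - t)) ^ i * ((1/2) * (1 + t)) ^ m"
      by (simp add: field_simps)
    also have "\<dots> = (1/2) ^ (i + m) * ((1 - t) ^ i * (1 + t) ^ m)"
      by (simp add: power_mult_distrib power_add power_divide)
    finally show ?thesis
      using pos by (simp add: jacobi_weight_def powr_add powr_realpow)
  qed (auto simp: jacobi_weight_def)
  then have "jacobi_int \<alpha> \<beta> ([:1/2, -1/2:] ^ i * [:1/2, 1/2:] ^ m) =
      (LBINT t:{-1..1}. (1/2) ^ (i + m) * jacobi_weight (\<alpha> + i) (\<beta> + m) t)"
    unfolding jacobi_int_def by (intro set_lebesgue_integral_cong) auto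
  also have "\<dots> = (1/2) ^ (i + m) * (2 powr (\<alpha> + \<beta> + 1 + (i + m)) * Beta (\<alpha> + 1 + i) (\<beta> + 1 + m))"
    using jacobi_weight_integral[of "\<alpha> + i" "\<beta> + m"] \<alpha> \<beta> by (simp add: add_ac)
  also have "\<dots> = 2 powr (\<alpha> + \<beta> + 1) * Beta (\<alpha> + 1 + i) (\<beta> + 1 + m)"
    by (simp add: powr_add powr_realpow power_divide power_add flip: of_nat_add)
  finally have "jacobi_mean \<alpha> \<beta> ([:1/2, -1/2:] ^ i * [:1/2, 1/2:] ^ m) =
      Beta (\<alpha> + 1 + i) (\<beta> + 1 + m) / Beta (\<alpha> + 1) (\<beta> + 1)"
    by (simp add: jacobi_mean_def jacobi_int_1)
  also have "\<dots> = (Gamma (\<alpha> + 1 + i) / Gamma (\<alpha> + 1)) * (Gamma (\<beta> + 1 + m) / Gamma (\<beta> + 1)) /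
      (Gamma (\<alpha> + \<beta> + 2 + (i + m)) / Gamma (\<alpha> + \<beta> + 2))"
    by (simp add: Beta_def add_ac)
  also have "\<dots> = pochhammer (\<alpha> + 1) i * pochhammer (\<beta> + 1) m / pochhammer (\<alpha> + \<beta> + 2) (i + m)"
  proof -
    have "z \<notin> \<int>\<^sub>\<le>\<^sub>0" if "z > 0" for z :: real
      using that nonpos_Ints_nonpos by force
    then show ?thesis
      using \<alpha> \<beta> by (simp add: pochhammer_Gamma flip: of_nat_add)
  qed
  finally show ?thesis .
qed

end

text \<open>Taylor expansions at -1 and at 1, in the powers whose moments are given by
  \<open>jacobi_mean_moment\<close>.\<close>

lemma poly_expand_affine:
  fixes q :: "real poly"
  shows "q = (\<Sum>i\<le>degree q. smult (coeff (pcompose q [:-1, 2:]) i) ([:1/2, 1/2:] ^ i))"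
    and "q = (\<Sum>i\<le>degree q. smult (coeff (pcompose q [:1, -2:]) i) ([:1/2, -1/2:] ^ i))"
proof -
  have d: "degree (pcompose q [:-1, 2:]) = degree q" "degree (pcompose q [:1, -2:]) = degree q"
    by (simp_all add: degree_pcompose)
  have e: "-1 + (1/2 + x * (1/2)) * 2 = (x::real)" "1 + (1/2 + x * (-1/2)) * (-2) = x" for x
    by (simp_all add: field_simps)
  have "poly q x = poly (pcompose q [:-1, 2:]) (1/2 + x * (1/2))"
    "poly q x = poly (pcompose q [:1, -2:]) (1/2 + x * (-1/2))" for x
    by (simp_all only: poly_pcompose poly_pCons poly_0 mult_zero_right add_0_right e)
  then show "q = (\<Sum>i\<le>degree q. smult (coeff (pcompose q [:-1, 2:]) i) ([:1/2, 1/2:] ^ i))"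
    "q = (\<Sum>i\<le>degree q. smult (coeff (pcompose q [:1, -2:]) i) ([:1/2, -1/2:] ^ i))"
    unfolding poly_eq_poly_eq_iff[symmetric] fun_eq_iff
    by (simp_all add: poly_sum d poly_altdef[of "pcompose q _"])
qed

text \<open>The hypergeometric polynomial 2F1(-l, l + \<alpha> + \<beta> + 1; \<alpha> + 1; (1 - t)
  / 2), that is the Jacobi polynomial scaled to the value 1 at t = 1.\<close>

definition jacobi_base :: "real \<Rightarrow> real \<Rightarrow> nat \<Rightarrow> real poly" where
  "jacobi_base \<alpha> \<beta> l =
     (\<Sum>i\<le>l. smult (pochhammer (- real l) i * pochhammer (real l + \<alpha> + \<beta> + 1) i /
                    (pochhammer (\<alpha> + 1) i * fact i)) ([:1/2, -1/2:] ^ i))"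

lemma poly_jacobi_base_1: "poly (jacobi_base \<alpha> \<beta> l) 1 = 1"
proof -
  have "poly (jacobi_base \<alpha> \<beta> l) 1 =
      (\<Sum>i\<le>l. pochhammer (- real l) i * pochhammer (real l + \<alpha> + \<beta> + 1) i /
                    (pochhammer (\<alpha> + 1) i * fact i) * 0 ^ i)"
    by (simp add: jacobi_base_def poly_sum)
  also have "\<dots> = (\<Sum>i\<in>{0}. pochhammer (- real l) i * pochhammer (real l + \<alpha> + \<beta> + 1) i /
                    (pochhammer (\<alpha> + 1) i * fact i) * 0 ^ i)"
    by (rule sum.mono_neutral_right) auto
  finally show ?thesis by simp
qed

lemma coeff_jacobi_base:
  "coeff (jacobi_base \<alpha> \<beta> l) l =
     pochhammer (real l + \<alpha> + \<beta> + 1) l / (2 ^ l * pochhammer (\<alpha> + 1) l)"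
proof -
  have deg: "degree ([:1/2, -1/2:] ^ i :: real poly) = i" for i
    by (simp add: degree_power_eq)
  have "coeff (jacobi_base \<alpha> \<beta> l) l =
      (\<Sum>i\<le>l. pochhammer (- real l) i * pochhammer (real l + \<alpha> + \<beta> + 1) i /
                    (pochhammer (\<alpha> + 1) i * fact i) * coeff ([:1/2, -1/2:] ^ i) l)"
    by (simp add: jacobi_base_def coeff_sum)
  also have "\<dots> = (\<Sum>i\<in>{l}. pochhammer (- real l) i * pochhammer (real l + \<alpha> + \<beta> + 1) i /
                    (pochhammer (\<alpha> + 1) i * fact i) * coeff ([:1/2, -1/2:] ^ i) l)"
  proof (rule sum.mono_neutral_right, simp, simp, rule ballI)
    fix i assume "i \<in> {..l} - {l}"
    then have "coeff ([:1/2, -1/2:] ^ i :: real poly) l = 0"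
      using deg[of i] by (intro coeff_eq_0) simp
    then show "pochhammer (- real l) i * pochhammer (real l + \<alpha> + \<beta> + 1) i /
       (pochhammer (\<alpha> + 1) i * fact i) * coeff ([:1/2, -1/2:] ^ i) l = 0" by simp
  qed
  also have "\<dots> = pochhammer (- real l) l * pochhammer (real l + \<alpha> + \<beta> + 1) l /
                    (pochhammer (\<alpha> + 1) l * fact l) * coeff ([:1/2, -1/2:] ^ l) l"
    by simp
  also have "coeff ([:1/2, -1/2:] ^ l :: real poly) l = (-1/2) ^ l"
    using lead_coeff_power[of "[:1/2, -1/2:] :: real poly" l] deg[of l] by simp
  also have "pochhammer (- real l) l = (-1) ^ l * fact l"
    by (simp add: pochhammer_same)
  also have "(-1) ^ l * fact l * pochhammer (real l + \<alpha> + \<beta> + 1) l / (pochhammer (\<alpha> + 1) l * fact l) * (-1/2) ^ l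
      = ((-1) ^ l * (-1/2) ^ l) * (pochhammer (real l + \<alpha> + \<beta> + 1) l / pochhammer (\<alpha> + 1) l)"
    by simp
  also have "(-1) ^ l * (-1/2) ^ l = (1/2 :: real) ^ l"
    by (simp flip: power_mult_distrib)
  finally show ?thesis
    by (simp add: power_divide)
qed

context
  fixes \<alpha> \<beta> :: real
  assumes \<alpha>: "\<alpha> > -1" and \<beta>: "\<beta> > -1" and \<alpha>\<beta>: "\<alpha> + \<beta> > -1"
begin

lemma lead_coeff_jacobi_base_pos: "coeff (jacobi_base \<alpha> \<beta> l) l > 0"
  unfolding coeff_jacobi_base using \<alpha> \<beta> \<alpha>\<beta>
  by (intro divide_pos_pos mult_pos_pos pochhammer_pos) auto

lemma degree_jacobi_base: "degree (jacobi_base \<alpha> \<beta> l) = l"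
proof (rule antisym)
  have "degree ([:1/2, -1/2:] ^ i :: real poly) = i" for i
    by (simp add: degree_power_eq)
  then show "degree (jacobi_base \<alpha> \<beta> l) \<le> l"
    unfolding jacobi_base_def
    by (intro degree_sum_le) (auto intro: order_trans[OF degree_smult_le])
  show "l \<le> degree (jacobi_base \<alpha> \<beta> l)"
    using lead_coeff_jacobi_base_pos[of l] by (intro le_degree) simp
qed

text \<open>The factors \<open>pochhammer (\<alpha> + 1) i\<close> of coefficient and moment cancel.
  What remains is a terminating 2F1 at argument 1, which the Chu-Vandermonde identity sums.\<close>

lemma jacobi_mean_base_moment:
  "jacobi_mean \<alpha> \<beta> (jacobi_base \<alpha> \<beta> l * [:1/2, 1/2:] ^ m) =
     pochhammer (\<beta> + 1) m / pochhammer (\<alpha> + \<beta> + 2) m *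
     (pochhammer (real m + 1 - real l) l / pochhammer (\<alpha> + \<beta> + 2 + m) l)"
proof -
  let ?c = "\<lambda>i. pochhammer (- real l) i * pochhammer (real l + \<alpha> + \<beta> + 1) i /
                    (pochhammer (\<alpha> + 1) i * fact i)"
  have nz: "pochhammer (\<alpha> + 1) i \<noteq> 0" for i
    using pochhammer_pos[of "\<alpha> + 1" i] \<alpha> by simp
  have "jacobi_mean \<alpha> \<beta> (jacobi_base \<alpha> \<beta> l * [:1/2, 1/2:] ^ m) =
      (\<Sum>i\<le>l. ?c i * jacobi_mean \<alpha> \<beta> ([:1/2, -1/2:] ^ i * [:1/2, 1/2:] ^ m))"
    by (simp only: jacobi_base_def sum_distrib_right mult_smult_left jacobi_mean_sum[OF \<alpha> \<beta>]
        jacobi_mean_smult[OF \<alpha> \<beta>])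
  also have "\<dots> = (\<Sum>i\<le>l. ?c i * (pochhammer (\<alpha> + 1) i * pochhammer (\<beta> + 1) m /
      (pochhammer (\<alpha> + \<beta> + 2) m * pochhammer (\<alpha> + \<beta> + 2 + m) i)))"
    by (simp only: jacobi_mean_moment[OF \<alpha> \<beta>] pochhammer_product'[symmetric] add.commute[of m])
  also have "\<dots> = (\<Sum>i\<le>l. pochhammer (\<beta> + 1) m / pochhammer (\<alpha> + \<beta> + 2) m *
      (pochhammer (real l + \<alpha> + \<beta> + 1) i * pochhammer (- real l) i /
        (fact i * pochhammer (\<alpha> + \<beta> + 2 + m) i)))"
    using nz by (intro sum.cong refl) (simp add: field_simps)
  also have "\<dots> = pochhammer (\<beta> + 1) m / pochhammer (\<alpha> + \<beta> + 2) m *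
      (\<Sum>i=0..l. pochhammer (real l + \<alpha> + \<beta> + 1) i * pochhammer (- real l) i /
        (of_nat (fact i) * pochhammer (\<alpha> + \<beta> + 2 + m) i))"
    by (simp add: sum_distrib_left atMost_atLeast0)
  also have "\<dots> = pochhammer (\<beta> + 1) m / pochhammer (\<alpha> + \<beta> + 2) m *
      (pochhammer (\<alpha> + \<beta> + 2 + m - (real l + \<alpha> + \<beta> + 1)) l / pochhammer (\<alpha> + \<beta> + 2 + m) l)"
    using \<alpha> \<beta> by (subst Vandermonde_pochhammer) auto
  also have "\<alpha> + \<beta> + 2 + m - (real l + \<alpha> + \<beta> + 1) = real m + 1 - real l"
    by simp
  finally show ?thesis .
qed

text \<open>For \<open>m < l\<close> the product \<open>pochhammer (real m + 1 - real l) l\<close>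
  contains the factor 0, at index l - m - 1, and the powers of (1 + t) / 2 with m < l span the lower
  degrees.\<close>

lemma jacobi_mean_base_lower:
  assumes "degree q < l"
  shows "jacobi_mean \<alpha> \<beta> (jacobi_base \<alpha> \<beta> l * q) = 0"
proof -
  have z: "jacobi_mean \<alpha> \<beta> (jacobi_base \<alpha> \<beta> l * [:1/2, 1/2:] ^ m) = 0" if "m < l" for m
  proof -
    have "pochhammer (real m + 1 - real l) l = 0"
      unfolding pochhammer_eq_0_iff using that
      by (intro exI[of _ "l - m - 1"]) (auto simp: of_nat_diff)
    then show ?thesis by (simp add: jacobi_mean_base_moment)
  qed
  have "jacobi_mean \<alpha> \<beta> (jacobi_base \<alpha> \<beta> l * q) =
      jacobi_mean \<alpha> \<beta> (jacobi_base \<alpha> \<beta> l *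
        (\<Sum>i\<le>degree q. smult (coeff (pcompose q [:-1, 2:]) i) ([:1/2, 1/2:] ^ i)))"
    using poly_expand_affine(1)[of q] by simp
  also have "\<dots> = (\<Sum>i\<le>degree q. coeff (pcompose q [:-1, 2:]) i *
      jacobi_mean \<alpha> \<beta> (jacobi_base \<alpha> \<beta> l * [:1/2, 1/2:] ^ i))"
    by (simp only: sum_distrib_left mult_smult_right jacobi_mean_sum[OF \<alpha> \<beta>]
        jacobi_mean_smult[OF \<alpha> \<beta>])
  also have "\<dots> = 0"
    using assms by (intro sum.neutral) (simp add: z)
  finally show ?thesis .
qed

definition jacobi_base_norm :: "nat \<Rightarrow> real" where
  "jacobi_base_norm l = pochhammer (real l + \<alpha> + \<beta> + 1) l * pochhammer (\<beta> + 1) l * fact l /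
     (pochhammer (\<alpha> + 1) l * pochhammer (\<alpha> + \<beta> + 2) l * pochhammer (\<alpha> + \<beta> + 2 + l) l)"

text \<open>Expand one factor in powers of (1 + t) / 2. By orthogonality only the top power
  survives, and its coefficient is 2^l times the leading coefficient.\<close>

lemma jacobi_mean_base_square:
  "jacobi_mean \<alpha> \<beta> (jacobi_base \<alpha> \<beta> l * jacobi_base \<alpha> \<beta> l) = jacobi_base_norm l"
proof -
  let ?P = "jacobi_base \<alpha> \<beta> l" and ?c = "\<lambda>i. coeff (pcompose (jacobi_base \<alpha> \<beta> l) [:-1, 2:]) i"
  have "jacobi_mean \<alpha> \<beta> (?P * ?P) =
      jacobi_mean \<alpha> \<beta> (?P * (\<Sum>i\<le>l. smult (?c i) ([:1/2, 1/2:] ^ i)))"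
    using poly_expand_affine(1)[of ?P] by (simp add: degree_jacobi_base)
  also have "\<dots> = (\<Sum>i\<le>l. ?c i * jacobi_mean \<alpha> \<beta> (?P * [:1/2, 1/2:] ^ i))"
    by (simp only: sum_distrib_left mult_smult_right jacobi_mean_sum[OF \<alpha> \<beta>]
        jacobi_mean_smult[OF \<alpha> \<beta>])
  also have "\<dots> = (\<Sum>i\<in>{l}. ?c i * jacobi_mean \<alpha> \<beta> (?P * [:1/2, 1/2:] ^ i))"
  proof (rule sum.mono_neutral_right, simp, simp, rule ballI)
    fix i assume "i \<in> {..l} - {l}"
    then have "degree ([:1/2, 1/2:] ^ i :: real poly) < l"
      by (simp add: degree_power_eq)
    then show "?c i * jacobi_mean \<alpha> \<beta> (?P * [:1/2, 1/2:] ^ i) = 0"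
      by (simp add: jacobi_mean_base_lower)
  qed
  also have "\<dots> = ?c l * jacobi_mean \<alpha> \<beta> (?P * [:1/2, 1/2:] ^ l)"
    by simp
  also have "?c l = coeff ?P l * 2 ^ l"
    using lead_coeff_comp[of "[:-1, 2:] :: real poly" ?P]
    by (simp add: degree_pcompose degree_jacobi_base)
  finally show ?thesis
    by (simp add: jacobi_mean_base_moment coeff_jacobi_base jacobi_base_norm_def pochhammer_fact[symmetric])
qed

lemma jacobi_base_norm_pos: "jacobi_base_norm l > 0"
  unfolding jacobi_base_norm_def using \<alpha> \<beta> \<alpha>\<beta>
  by (cases l) (auto intro!: divide_pos_pos mult_pos_pos pochhammer_pos)

text \<open>Subtracting a multiple of \<open>jacobi_base\<close> removes the coefficient of degree l
  and leaves an orthogonal \<open>r\<close> of degree d < l. Testing \<open>r\<close> against the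
  base polynomial of degree d shows that its leading coefficient is 0. Definiteness of the integral
  is not invoked, only the positive explicit norm of that base polynomial.\<close>

lemma jacobi_orthogonal_unique:
  assumes "degree p \<le> l" "\<And>q. degree q < l \<Longrightarrow> jacobi_mean \<alpha> \<beta> (p * q) = 0"
  shows "p = smult (poly p 1) (jacobi_base \<alpha> \<beta> l)"
proof -
  define c where "c = coeff p l / coeff (jacobi_base \<alpha> \<beta> l) l"
  define r where "r = p - smult c (jacobi_base \<alpha> \<beta> l)"
  have rl: "coeff r l = 0"
    using lead_coeff_jacobi_base_pos[of l] by (simp add: r_def c_def)
  have rdeg: "degree r \<le> l"
    unfolding r_def using assms(1)
    by (intro degree_diff_le order_trans[OF degree_smult_le]) (auto simp: degree_jacobi_base)
  have r_orth: "jacobi_mean \<alpha> \<beta> (r * q) = 0" if "degree q < l" for q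
  proof -
    have "r * q = p * q + smult (- c) (jacobi_base \<alpha> \<beta> l * q)"
      by (simp add: r_def algebra_simps)
    then show ?thesis
      using assms(2)[OF that] jacobi_mean_base_lower[OF that]
      by (simp only: jacobi_mean_add[OF \<alpha> \<beta>] jacobi_mean_smult[OF \<alpha> \<beta>])
  qed
  have "r = 0"
  proof (rule ccontr)
    assume r0: "r \<noteq> 0"
    define d where "d = degree r"
    have d: "d < l"
      using rdeg rl r0 unfolding d_def by (metis leading_coeff_0_iff le_neq_implies_less)
    let ?P = "jacobi_base \<alpha> \<beta> d"
    define e where "e = coeff r d / coeff ?P d"
    define s where "s = r - smult e ?P"
    have sd: "coeff s d = 0"
      using lead_coeff_jacobi_base_pos[of d] by (simp add: s_def e_def)
    have sdeg: "degree s \<le> d"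
      unfolding s_def d_def[symmetric]
      by (intro degree_diff_le order_trans[OF degree_smult_le]) (auto simp: degree_jacobi_base d_def)
    have s0: "s = 0 \<or> degree s < d"
      using sdeg sd by (metis leading_coeff_0_iff le_neq_implies_less)
    have Ps: "jacobi_mean \<alpha> \<beta> (?P * s) = 0"
      using s0 jacobi_mean_base_lower[of s d] by (auto simp: jacobi_mean_0[OF \<alpha> \<beta>])
    have "r * ?P = smult e (?P * ?P) + ?P * s"
      by (simp add: s_def algebra_simps)
    then have "jacobi_mean \<alpha> \<beta> (r * ?P) = e * jacobi_base_norm d"
      using Ps by (simp only: jacobi_mean_add[OF \<alpha> \<beta>] jacobi_mean_smult[OF \<alpha> \<beta>] jacobi_mean_base_square)
    moreover have "jacobi_mean \<alpha> \<beta> (r * ?P) = 0"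
      using d by (intro r_orth) (simp add: degree_jacobi_base)
    ultimately have "e = 0" using jacobi_base_norm_pos[of d] by simp
    then show False
      using r0 lead_coeff_jacobi_base_pos[of d] by (simp add: e_def d_def)
  qed
  then have "p = smult c (jacobi_base \<alpha> \<beta> l)" by (simp add: r_def)
  moreover from arg_cong[OF this, of "\<lambda>q. poly q 1"] have "poly p 1 = c"
    by (simp add: poly_jacobi_base_1)
  ultimately show ?thesis by metis
qed

text \<open>Orthogonality leaves one scalar free. The norm fixes its square and the positive leading
  coefficient its sign.\<close>

lemma jacobi_orthonormal_eq:
  "jacobi_orthonormal \<alpha> \<beta> l = smult (1 / sqrt (jacobi_base_norm l)) (jacobi_base \<alpha> \<beta> l)"
  unfolding jacobi_orthonormal_def jacobi_inner_eq_mean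
proof (rule the_equality)
  let ?N = "jacobi_base_norm l" and ?P = "jacobi_base \<alpha> \<beta> l"
  note N = jacobi_base_norm_pos[of l]
  have sq: "jacobi_mean \<alpha> \<beta> (smult c ?P * smult c ?P) = c\<^sup>2 * ?N" for c
    by (simp add: jacobi_mean_smult[OF \<alpha> \<beta>] jacobi_mean_base_square power2_eq_square)
  show "degree (smult (1 / sqrt ?N) ?P) = l \<and> lead_coeff (smult (1 / sqrt ?N) ?P) > 0 \<and>
      jacobi_mean \<alpha> \<beta> (smult (1 / sqrt ?N) ?P * smult (1 / sqrt ?N) ?P) = 1 \<and>
      (\<forall>q. degree q < l \<longrightarrow> jacobi_mean \<alpha> \<beta> (smult (1 / sqrt ?N) ?P * q) = 0)"
    using N lead_coeff_jacobi_base_pos[of l]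
    by (auto simp: degree_jacobi_base sq power_divide jacobi_mean_smult[OF \<alpha> \<beta>] jacobi_mean_base_lower
        simp del: mult_smult_left mult_smult_right) 
      (simp add: jacobi_mean_smult[OF \<alpha> \<beta>] jacobi_mean_base_lower)
  fix p assume p: "degree p = l \<and> lead_coeff p > 0 \<and> jacobi_mean \<alpha> \<beta> (p * p) = 1 \<and>
      (\<forall>q. degree q < l \<longrightarrow> jacobi_mean \<alpha> \<beta> (p * q) = 0)"
  define c where "c = poly p 1"
  have pc: "p = smult c ?P"
    unfolding c_def using p by (intro jacobi_orthogonal_unique) auto
  have "c\<^sup>2 * ?N = 1" using p sq[of c] pc by simp
  then have "c\<^sup>2 = 1 / ?N" using N by (simp add: field_simps)
  moreover have "c > 0"
  proof -
    have "coeff p l > 0" using p by auto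
    then have "c * coeff ?P l > 0" by (subst (asm) pc) simp
    then show ?thesis using lead_coeff_jacobi_base_pos[of l] by (simp add: zero_less_mult_iff)
  qed
  ultimately have "c = sqrt (1 / ?N)" by (metis real_sqrt_unique less_imp_le)
  then show "p = smult (1 / sqrt ?N) ?P" by (simp add: pc real_sqrt_divide)
qed

end

section \<open>Gegenbauer polynomials as the symmetric Jacobi case\<close>

lemma gegenbauer_weight:
  "s \<in> {-1..1} \<Longrightarrow> (1 - s\<^sup>2) powr \<mu> = jacobi_weight \<mu> \<mu> s"
proof -
  assume "s \<in> {-1..1}"
  moreover have "1 - s\<^sup>2 = (1 - s) * (1 + s)" by (simp add: power2_eq_square algebra_simps)
  ultimately show ?thesis by (simp add: jacobi_weight_def powr_mult)
qed

context
  fixes a :: real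
  assumes a: "a > 0"
begin

lemma gegenbauer_orth_iff:
  "(LBINT s:{-1..1}. poly p s * poly q s * (1 - s\<^sup>2) powr (a - 1/2)) = 0 \<longleftrightarrow>
     jacobi_mean (a - 1/2) (a - 1/2) (p * q) = 0"
proof -
  have "(LBINT s:{-1..1}. poly p s * poly q s * (1 - s\<^sup>2) powr (a - 1/2)) =
      jacobi_int (a - 1/2) (a - 1/2) (p * q)"
    unfolding jacobi_int_def
    by (intro set_lebesgue_integral_cong) (auto simp: gegenbauer_weight)
  then show ?thesis
    using jacobi_int_1_pos[of "a - 1/2" "a - 1/2"] a by (simp add: jacobi_mean_def)
qed

text \<open>The weight is the Jacobi weight with both exponents a - 1/2, so uniqueness up to a
  scalar applies and the prescribed value at 1 determines the scalar.\<close>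

lemma gegenbauer_eq:
  "gegenbauer a k = smult (pochhammer (2 * a) k / fact k) (jacobi_base (a - 1/2) (a - 1/2) k)"
  unfolding gegenbauer_def gegenbauer_orth_iff
proof (rule the_equality)
  let ?\<mu> = "a - 1/2"
  let ?c = "pochhammer (2 * a) k / fact k" and ?P = "jacobi_base ?\<mu> ?\<mu> k"
  have m: "?\<mu> > -1" "?\<mu> + ?\<mu> > -1" using a by auto
  have c: "?c > 0" using a by (intro divide_pos_pos pochhammer_pos) auto
  show "degree (smult ?c ?P) = k \<and> (\<forall>q. degree q < k \<longrightarrow> jacobi_mean ?\<mu> ?\<mu> (smult ?c ?P * q) = 0) \<and>
      poly (smult ?c ?P) 1 = ?c"
    using c by (auto simp: poly_jacobi_base_1 degree_jacobi_base[OF m(1) m(1) m(2)]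
        jacobi_mean_smult[OF m(1) m(1)] jacobi_mean_base_lower[OF m(1) m(1) m(2)])
  fix p assume p: "degree p = k \<and> (\<forall>q. degree q < k \<longrightarrow> jacobi_mean ?\<mu> ?\<mu> (p * q) = 0) \<and> poly p 1 = ?c"
  then show "p = smult ?c ?P"
    using jacobi_orthogonal_unique[OF m(1) m(1) m(2), of p k] by auto
qed

lemma degree_gegenbauer: "degree (gegenbauer a k) = k"
proof -
  have "pochhammer (2 * a) k > 0" using a by (intro pochhammer_pos) auto
  then show ?thesis using a by (simp add: gegenbauer_eq degree_jacobi_base)
qed

lemma gegenbauer_at_1_pos: "poly (gegenbauer a k) 1 > 0"
  using a by (auto simp: gegenbauer_eq poly_jacobi_base_1 intro!: divide_pos_pos pochhammer_pos)

lemma gegenbauer_orth: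
  "degree q < k \<Longrightarrow> jacobi_mean (a - 1/2) (a - 1/2) (gegenbauer a k * q) = 0"
  using a by (simp add: gegenbauer_eq jacobi_mean_smult jacobi_mean_base_lower)

lemma gegenbauer_unique:
  assumes "degree p \<le> k" "\<And>q. degree q < k \<Longrightarrow> jacobi_mean (a - 1/2) (a - 1/2) (p * q) = 0"
  shows "p = smult (poly p 1 / poly (gegenbauer a k) 1) (gegenbauer a k)"
proof -
  have "pochhammer (2 * a) k > 0" using a by (intro pochhammer_pos) auto
  then show ?thesis
    using jacobi_orthogonal_unique[of "a - 1/2" "a - 1/2" p k] assms a
    by (simp add: gegenbauer_eq poly_jacobi_base_1)
qed

text \<open>The identity behind the factor (k + \<mu> + 1/2) / (\<mu> + 1/2) of the kernel: with it
  the ridge function reproduces with constant 1. Once the explicit norm is inserted, it follows by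
  splitting off either the first or the last factor of
  \<open>pochhammer (2 * a) (2 * k + 1)\<close>.\<close>

lemma gegenbauer_norm:
  "(real k + a) / a * jacobi_mean (a - 1/2) (a - 1/2) (gegenbauer a k * gegenbauer a k) =
     poly (gegenbauer a k) 1"
proof -
  let ?\<mu> = "a - 1/2" and ?c = "pochhammer (2 * a) k / fact k"
  have pos: "pochhammer (2 * a + 1) k > 0" "pochhammer (2 * a + 1 + k) k > 0" "pochhammer (a + 1/2) k > 0"
    using a by (auto intro!: pochhammer_pos)
  have "pochhammer (2 * a) k * pochhammer (2 * a + k) k * (2 * a + 2 * real k) = pochhammer (2 * a) (Suc (k + k))"
    by (simp only: pochhammer_product'[symmetric] pochhammer_rec') (simp add: algebra_simps)
  also have "\<dots> = 2 * a * (pochhammer (2 * a + 1) k * pochhammer (2 * a + 1 + k) k)"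
    by (simp only: pochhammer_product'[symmetric] pochhammer_rec)
  finally have "(real k + a) / a * (pochhammer (2 * a) k * pochhammer (2 * a + k) k) =
      pochhammer (2 * a + 1) k * pochhammer (2 * a + 1 + k) k"
    using a by (simp add: field_simps)
  moreover have "jacobi_base_norm ?\<mu> ?\<mu> k = pochhammer (2 * a + k) k * pochhammer (a + 1/2) k * fact k /
      (pochhammer (a + 1/2) k * pochhammer (2 * a + 1) k * pochhammer (2 * a + 1 + k) k)"
  proof -
    have e: "real k + ?\<mu> + ?\<mu> + 1 = 2 * a + k" "?\<mu> + 1 = a + 1/2" "?\<mu> + ?\<mu> + 2 = 2 * a + 1" by simp_all
    have "?\<mu> > -1" "?\<mu> + ?\<mu> > -1" using a by auto
    then show ?thesis unfolding e[symmetric] by (simp only: jacobi_base_norm_def)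
  qed
  ultimately have "(real k + a) / a * ?c * jacobi_base_norm ?\<mu> ?\<mu> k = 1"
  proof -
    have "X * (Y / f) * N = 1"
      if "X * (Y * Z) = u * v" "N = Z * h * f / (h * u * v)" "u > 0" "v > 0" "h > 0" "f > 0"
      for X Y Z u v h f N :: real
    proof -
      have "X * (Y / f) * N = X * (Y * Z) / (u * v)" using that(2,5,6) by simp
      then show ?thesis using that by simp
    qed
    from this[OF \<open>_ * (_ * _) = _ * _\<close> \<open>jacobi_base_norm _ _ _ = _\<close> pos fact_gt_zero]
    show ?thesis .
  qed
  then have "?c * ((real k + a) / a * ?c * jacobi_base_norm ?\<mu> ?\<mu> k) = ?c"
    by (simp only: mult_1_right)
  moreover have "jacobi_mean ?\<mu> ?\<mu> (gegenbauer a k * gegenbauer a k) = ?c * (?c * jacobi_base_norm ?\<mu> ?\<mu> k)"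
    using a by (simp add: gegenbauer_eq jacobi_mean_smult jacobi_mean_base_square)
  moreover have "poly (gegenbauer a k) 1 = ?c"
    by (simp add: gegenbauer_eq poly_jacobi_base_1)
  ultimately show ?thesis by (simp only: mult_ac)
qed

text \<open>The weight is symmetric, so the reflected polynomial is orthogonal as well and hence a
  multiple of the original. Comparing leading coefficients gives the sign.\<close>

lemma poly_gegenbauer_minus: "poly (gegenbauer a k) (- t) = (-1) ^ k * poly (gegenbauer a k) t"
proof -
  let ?\<mu> = "a - 1/2" and ?C = "gegenbauer a k"
  define R where "R = (\<lambda>p::real poly. pcompose p [:0, -1:])"
  have R: "poly (R p) t = poly p (- t)" "degree (R p) = degree p" for p t
    by (simp_all add: R_def poly_pcompose degree_pcompose)
  have mean: "jacobi_mean ?\<mu> ?\<mu> (R p) = jacobi_mean ?\<mu> ?\<mu> p" for p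
  proof -
    have "jacobi_int ?\<mu> ?\<mu> (R p) = (LBINT t:{-1..1}. poly p t * jacobi_weight ?\<mu> ?\<mu> t)"
      unfolding jacobi_int_def set_lebesgue_integral_def
      by (subst lborel_integral_real_affine[where c = "-1" and t = 0])
         (auto simp: R jacobi_weight_def indicator_def mult_ac intro!: Bochner_Integration.integral_cong)
    then show ?thesis by (simp add: jacobi_mean_def jacobi_int_def)
  qed
  have "R ?C = smult (poly (R ?C) 1 / poly ?C 1) ?C"
  proof (rule gegenbauer_unique)
    fix q :: "real poly" assume "degree q < k"
    have "R ?C * q = R (?C * R q)"
      by (simp add: R_def pcompose_mult pcompose_assoc[symmetric] pcompose_pCons)
    then show "jacobi_mean ?\<mu> ?\<mu> (R ?C * q) = 0"
      using \<open>degree q < k\<close> by (simp add: mean gegenbauer_orth R)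
  qed (simp add: R degree_gegenbauer)
  then obtain c where c: "R ?C = smult c ?C" by blast
  have "coeff (R ?C) k = (-1) ^ k * coeff ?C k"
    using lead_coeff_comp[of "[:0, -1:] :: real poly" ?C] by (simp add: R_def degree_pcompose degree_gegenbauer)
  moreover have "coeff ?C k \<noteq> 0"
    using degree_gegenbauer[of k] gegenbauer_at_1_pos[of k] by (metis leading_coeff_0_iff poly_0 less_irrefl)
  ultimately have "c = (-1) ^ k" by (simp add: c)
  with c R(1)[of ?C t] show ?thesis by simp
qed

end

lemma poly_jacobi_orthonormal_1_pos:
  assumes "\<alpha> > -1" "\<beta> > -1" "\<alpha> + \<beta> > -1"
  shows "poly (jacobi_orthonormal \<alpha> \<beta> l) 1 > 0"
  using jacobi_base_norm_pos[OF assms] by (simp add: jacobi_orthonormal_eq[OF assms] poly_jacobi_base_1)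

text \<open>This identity explains the form of \<lambda>. On the boundary of the disk the l-th pair
  of basis functions contributes this number times cos ((k - 2 l) (\<phi> - \<xi>)), and 1 or 2 is
  the coefficient of that cosine in the Dirichlet kernel.\<close>

lemma kernel_coeff_normalization:
  assumes \<mu>: "\<mu> \<ge> 0" and l: "2 * l \<le> k"
  shows "kernel_coeff \<mu> l k * (disk_norm \<mu> l k)\<^sup>2 *
      (poly (jacobi_orthonormal (\<mu> - 1/2) (real (k - 2 * l)) l) 1)\<^sup>2 = (if 2 * l = k then 1 else 2)"
proof -
  define j where "j = k - 2 * l"
  have k: "k - l = j + l" "real k = real j + 2 * real l" using l by (auto simp: j_def)
  have ab: "\<mu> - 1/2 > -1" "real j > -1" "\<mu> - 1/2 + real j > -1" using \<mu> by auto
  define N where "N = jacobi_base_norm (\<mu> - 1/2) (real j) l"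
  \<comment> \<open>This is k - l + \<mu> + 1/2, and adding l gives k + \<mu> + 1/2: the two linear
    factors of \<open>kernel_coeff\<close>.\<close>
  define c where "c = real j + real l + \<mu> + 1/2"
  define d :: real where "d = (if 2 * l = k then 1 else 2)"
  have c: "c > 0" using \<mu> by (simp add: c_def)
  define A B C D E where "A = pochhammer (\<mu> + 1/2) l" and "B = pochhammer (\<mu> + 3/2) j"
    and "C = pochhammer (real j + \<mu> + 3/2) l" and "D = pochhammer (c + 1) l" and "E = pochhammer (real j + 1) l"
  define F where "F = pochhammer c l"
  have pos: "A > 0" "B > 0" "C > 0" "D > 0" "E > 0" "F > 0"
    using \<mu> c by (auto simp: A_def B_def C_def D_def E_def F_def intro!: pochhammer_pos)
  have N: "N = F * E * fact l / (A * C * D)"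
    unfolding N_def jacobi_base_norm_def[OF ab] A_def C_def D_def E_def F_def c_def
    by (simp add: algebra_simps)
  have p1: "(poly (jacobi_orthonormal (\<mu> - 1/2) (real j) l) 1)\<^sup>2 = 1 / N"
    using jacobi_base_norm_pos[OF ab, of l]
    by (simp add: jacobi_orthonormal_eq[OF ab] poly_jacobi_base_1 N_def power_divide)
  have "Gamma (real j + \<mu> + 3/2) / Gamma (\<mu> + 3/2) = B"
  proof -
    have "\<mu> + 3/2 \<notin> \<int>\<^sub>\<le>\<^sub>0" using \<mu> nonpos_Ints_nonpos by force
    then show ?thesis by (simp add: B_def pochhammer_Gamma add_ac)
  qed
  moreover have "Gamma (real j + 1) = fact j" by (simp add: Gamma_fact add.commute)
  ultimately have "Gamma (real j + \<mu> + 3/2) / (Gamma (\<mu> + 3/2) * Gamma (real j + 1)) = B / fact j"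
    by (simp flip: divide_divide_eq_left)
  then have dn: "(disk_norm \<mu> l k)\<^sup>2 = d * B / fact j"
    using pos by (simp add: disk_norm_def j_def[symmetric] d_def)
  have f: "fact (k - l) = fact j * E"
    by (simp only: k E_def pochhammer_fact pochhammer_product') (simp add: add.commute)
  have BC: "pochhammer (\<mu> + 3/2) (k - l) = B * C"
    by (simp only: k B_def C_def pochhammer_product') (simp add: add_ac)
  \<comment> \<open>Both sides are the rising factorial of c with l + 1 factors. So the quotient c /
    (c + l) in \<open>kernel_coeff\<close> equals F / D, which cancels against the norm
    \<open>N\<close>.\<close>
  have "F * (c + l) = c * D"
    unfolding F_def D_def pochhammer_rec[symmetric] pochhammer_rec' by simp
  then have cl: "c + l = c * D / F" using pos by (simp add: field_simps)
  have "kernel_coeff \<mu> l k = fact l * fact (k - l) * c / (A * (B * C) * (c + l))"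
    by (simp add: kernel_coeff_def BC A_def) (simp add: k c_def add_ac)
  then have "kernel_coeff \<mu> l k = fact l * (fact j * E) * F / (A * B * C * D)"
    using pos c by (simp add: cl f)
  then show ?thesis
    unfolding j_def[symmetric] p1 dn d_def[symmetric] N
    using pos by (simp add: field_simps)
qed

section \<open>Weighted harmonic polynomials on the sphere\<close>

lemma finite_sphere_measure: "finite_measure (sphere_measure :: (real^3) measure)"
  by (rule finite_measureI) (simp add: emeasure_sphere_measure)

lemma borel_measurable_sphere:
  assumes "f \<in> borel_measurable borel"
  shows "f \<in> borel_measurable (sphere_measure :: (real^3) measure)"
  using measurable_restrict_space1[OF assms] by (simp add: measurable_cong_sets[OF sets_sphere_measure])

lemma sphere_weight_measurable [measurable]: "sphere_weight \<mu> \<in> borel_measurable borel"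
proof -
  have "(\<lambda>x::real^3. x$3) \<in> borel_measurable borel"
    by (intro borel_measurable_continuous_onI continuous_intros)
  then show ?thesis unfolding sphere_weight_def[abs_def] by measurable
qed

lemma sphere_weight_nonneg: "sphere_weight \<mu> x \<ge> 0"
  by (simp add: sphere_weight_def)

lemma sphere_weight_le_1:
  assumes "\<mu> \<ge> 0" "x \<in> sphere 0 1"
  shows "sphere_weight \<mu> x \<le> 1"
proof -
  have "\<bar>x$3\<bar> \<le> 1" using component_le_norm_cart[of x 3] assms by simp
  then show ?thesis using assms by (auto simp: sphere_weight_def intro!: powr_le1)
qed

lemma continuous_on_sphere_bounded:
  fixes g :: "real^3 \<Rightarrow> real"
  assumes "continuous_on UNIV g"
  obtains B where "B \<ge> 0" "\<And>x. x \<in> sphere 0 1 \<Longrightarrow> \<bar>g x\<bar> \<le> B"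
proof -
  have "compact (g ` sphere 0 1)"
    by (intro compact_continuous_image continuous_on_subset[OF assms]) auto
  then obtain B where B: "\<And>x. x \<in> sphere 0 1 \<Longrightarrow> \<bar>g x\<bar> \<le> B"
    using compact_imp_bounded bounded_iff by (metis image_eqI real_norm_def)
  show ?thesis by (rule that[of "max B 0"]) (use B in \<open>auto intro: order_trans max.cobounded1\<close>)
qed

context
  fixes \<mu> :: real
  assumes \<mu>: "\<mu> \<ge> 0"
begin

lemma sphere_weight_integrable: "integrable sphere_measure (sphere_weight \<mu>)"
  by (rule finite_measure.integrable_const_bound[OF finite_sphere_measure, where B = 1])
     (auto simp: sphere_weight_nonneg sphere_weight_le_1[OF \<mu>] borel_measurable_sphere)

lemma sphere_L2_integrable:
  assumes f: "f \<in> sphere_L2 \<mu>" and g: "continuous_on UNIV g"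
  shows "integrable sphere_measure (\<lambda>x. f x * g x * sphere_weight \<mu> x)"
proof -
  obtain B where B: "B \<ge> 0" "\<And>x. x \<in> sphere 0 1 \<Longrightarrow> \<bar>g x\<bar> \<le> B"
    using continuous_on_sphere_bounded[OF g] by blast
  have [measurable]: "f \<in> borel_measurable sphere_measure"
    and int: "integrable sphere_measure (\<lambda>x. (f x)\<^sup>2 * sphere_weight \<mu> x)"
    using f by (auto simp: sphere_L2_def)
  have [measurable]: "g \<in> borel_measurable sphere_measure" "sphere_weight \<mu> \<in> borel_measurable sphere_measure"
    using g by (auto intro: borel_measurable_sphere borel_measurable_continuous_onI)
  show ?thesis
  proof (rule Bochner_Integration.integrable_bound)
    show "integrable sphere_measure (\<lambda>x. B * (sphere_weight \<mu> x + (f x)\<^sup>2 * sphere_weight \<mu> x))"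
      using int sphere_weight_integrable by auto
    show "AE x in sphere_measure. norm (f x * g x * sphere_weight \<mu> x) \<le>
        norm (B * (sphere_weight \<mu> x + (f x)\<^sup>2 * sphere_weight \<mu> x))"
    proof (rule AE_I2)
      fix x :: "real^3" assume x: "x \<in> space sphere_measure"
      \<comment> \<open>Takes the place of the Cauchy-Schwarz inequality; it suffices because the
        total weight is finite.\<close>
      have "\<bar>f x\<bar> \<le> 1 + (f x)\<^sup>2"
        using zero_le_power2[of "\<bar>f x\<bar> - 1"] by (simp add: power2_diff) 
      then have "\<bar>g x\<bar> * \<bar>f x\<bar> * sphere_weight \<mu> x \<le> B * (1 + (f x)\<^sup>2) * sphere_weight \<mu> x"
        using B x by (intro mult_right_mono mult_mono) (auto simp: sphere_weight_nonneg)
      then show "norm (f x * g x * sphere_weight \<mu> x) \<le>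
        norm (B * (sphere_weight \<mu> x + (f x)\<^sup>2 * sphere_weight \<mu> x))"
        using B by (simp add: abs_mult sphere_weight_nonneg algebra_simps abs_of_nonneg)
    qed
  qed measurable
qed

lemma continuous_in_sphere_L2:
  assumes g: "continuous_on UNIV g"
  shows "g \<in> sphere_L2 \<mu>"
proof -
  have [measurable]: "g \<in> borel_measurable sphere_measure" "sphere_weight \<mu> \<in> borel_measurable sphere_measure"
    using g by (auto intro: borel_measurable_sphere borel_measurable_continuous_onI)
  obtain B where B: "B \<ge> 0" "\<And>x. x \<in> sphere 0 1 \<Longrightarrow> \<bar>g x\<bar> \<le> B"
    using continuous_on_sphere_bounded[OF g] by blast
  have "integrable sphere_measure (\<lambda>x. (g x)\<^sup>2 * sphere_weight \<mu> x)"
  proof (rule finite_measure.integrable_const_bound[OF finite_sphere_measure, where B = "B\<^sup>2 * 1"])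
    show "AE x in sphere_measure. norm ((g x)\<^sup>2 * sphere_weight \<mu> x) \<le> B\<^sup>2 * 1"
    proof (rule AE_I2)
      fix x :: "real^3" assume x: "x \<in> space sphere_measure"
      then have "(g x)\<^sup>2 \<le> B\<^sup>2" using B by (intro abs_le_square_iff[THEN iffD1]) auto
      then have "(g x)\<^sup>2 * sphere_weight \<mu> x \<le> B\<^sup>2 * 1"
        using x by (intro mult_mono sphere_weight_le_1[OF \<mu>]) (auto simp: sphere_weight_nonneg)
      then show "norm ((g x)\<^sup>2 * sphere_weight \<mu> x) \<le> B\<^sup>2 * 1" by (simp add: sphere_weight_nonneg)
    qed
  qed measurable
  then show ?thesis by (simp add: sphere_L2_def)
qed

lemma sphere_inner_add_right:
  assumes "f \<in> sphere_L2 \<mu>" "continuous_on UNIV g" "continuous_on UNIV h"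
  shows "sphere_inner \<mu> f (\<lambda>x. g x + h x) = sphere_inner \<mu> f g + sphere_inner \<mu> f h"
proof -
  have "sphere_inner \<mu> f (\<lambda>x. g x + h x) =
      (LINT x|sphere_measure. f x * g x * sphere_weight \<mu> x + f x * h x * sphere_weight \<mu> x)"
    unfolding sphere_inner_def by (simp add: algebra_simps)
  also have "\<dots> = sphere_inner \<mu> f g + sphere_inner \<mu> f h"
    unfolding sphere_inner_def
    by (intro Bochner_Integration.integral_add sphere_L2_integrable assms)
  finally show ?thesis .
qed

lemma sphere_inner_sum_right:
  assumes "f \<in> sphere_L2 \<mu>" "\<And>i. i \<in> A \<Longrightarrow> continuous_on UNIV (g i)"
  shows "sphere_inner \<mu> f (\<lambda>x. \<Sum>i\<in>A. g i x) = (\<Sum>i\<in>A. sphere_inner \<mu> f (g i))"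
proof -
  have "sphere_inner \<mu> f (\<lambda>x. \<Sum>i\<in>A. g i x) =
      (LINT x|sphere_measure. (\<Sum>i\<in>A. f x * g i x * sphere_weight \<mu> x))"
    unfolding sphere_inner_def by (simp add: sum_distrib_left sum_distrib_right)
  also have "\<dots> = (\<Sum>i\<in>A. sphere_inner \<mu> f (g i))"
    unfolding sphere_inner_def
    by (intro Bochner_Integration.integral_sum sphere_L2_integrable assms)
  finally show ?thesis .
qed

lemma sphere_inner_diff_left:
  assumes "f \<in> sphere_L2 \<mu>" "continuous_on UNIV p" "continuous_on UNIV q"
  shows "sphere_inner \<mu> (\<lambda>x. f x - p x) q = sphere_inner \<mu> f q - sphere_inner \<mu> p q"
proof -
  have "sphere_inner \<mu> (\<lambda>x. f x - p x) q =
      (LINT x|sphere_measure. f x * q x * sphere_weight \<mu> x - p x * q x * sphere_weight \<mu> x)"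
    unfolding sphere_inner_def by (simp add: algebra_simps)
  also have "\<dots> = sphere_inner \<mu> f q - sphere_inner \<mu> p q"
    unfolding sphere_inner_def
    by (intro Bochner_Integration.integral_diff sphere_L2_integrable continuous_in_sphere_L2 assms)
  finally show ?thesis .
qed

end

lemma sphere_inner_commute: "sphere_inner \<mu> f g = sphere_inner \<mu> g f"
  by (simp add: sphere_inner_def mult.commute)

lemma sphere_inner_scale_right: "sphere_inner \<mu> f (\<lambda>x. c * g x) = c * sphere_inner \<mu> f g"
  by (simp add: sphere_inner_def mult_ac)

lemma sphere_inner_cong:
  assumes "\<And>x. x \<in> sphere 0 1 \<Longrightarrow> f x = f' x" "\<And>x. x \<in> sphere 0 1 \<Longrightarrow> g x = g' x"
  shows "sphere_inner \<mu> f g = sphere_inner \<mu> f' g'"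
  unfolding sphere_inner_def using assms by (intro Bochner_Integration.integral_cong) auto

section \<open>Homogeneous and harmonic polynomials in three variables\<close>

definition monomial3 :: "nat \<Rightarrow> nat \<Rightarrow> nat \<Rightarrow> real^3 \<Rightarrow> real" where
  "monomial3 i j m x = (x$1)^i * (x$2)^j * (x$3)^m"

lemma continuous_monomial3 [continuous_intros]: "continuous_on A (monomial3 i j m)"
  unfolding monomial3_def[abs_def] by (intro continuous_intros)

lemma monomial3_mult: "monomial3 i j m x * monomial3 i' j' m' x = monomial3 (i + i') (j + j') (m + m') x"
  by (simp add: monomial3_def power_add mult_ac)

lemma finite_exponents:
  "finite {(i, j, m). i + j + m = (k::nat)}" "finite {(i, j, m). i + j + m < (k::nat)}"
  by (rule finite_subset[of _ "{..k} \<times> {..k} \<times> {..k}"]; auto)+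

lemma poly3_eq: "poly3 E c = (\<lambda>x. \<Sum>e\<in>E. c e * monomial3 (fst e) (fst (snd e)) (snd (snd e)) x)"
  by (auto simp: poly3_def monomial3_def fun_eq_iff case_prod_unfold mult.assoc intro!: sum.cong)

lemma poly3_sum: "(\<lambda>x. \<Sum>i\<in>A. poly3 E (c i) x) = poly3 E (\<lambda>e. \<Sum>i\<in>A. c i e)"
proof
  fix x
  show "(\<Sum>i\<in>A. poly3 E (c i) x) = poly3 E (\<lambda>e. \<Sum>i\<in>A. c i e) x"
    unfolding poly3_eq sum_distrib_right by (rule sum.swap)
qed

lemma poly3_single:
  assumes "finite E" "(i, j, m) \<in> E"
  shows "(\<lambda>x. c * monomial3 i j m x) = poly3 E (\<lambda>e. if e = (i, j, m) then c else 0)"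
  using assms by (auto simp: poly3_eq fun_eq_iff if_distrib[where f = "\<lambda>a. a * _"] sum.delta cong: if_cong)

lemma homogeneous_monomial:
  "i + j + m = k \<Longrightarrow> (\<lambda>x. c * monomial3 i j m x) \<in> homogeneous_polys k"
  unfolding homogeneous_polys_def by (subst poly3_single[OF finite_exponents(1)]) auto

lemma homogeneous_sum:
  assumes "\<And>i. i \<in> A \<Longrightarrow> p i \<in> homogeneous_polys k"
  shows "(\<lambda>x. \<Sum>i\<in>A. p i x) \<in> homogeneous_polys k"
proof -
  have "\<forall>i\<in>A. \<exists>c. p i = poly3 {(i, j, m). i + j + m = k} c"
    using assms by (auto simp: homogeneous_polys_def)
  then obtain c where "\<forall>i\<in>A. p i = poly3 {(i, j, m). i + j + m = k} (c i)" by metis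
  then have "(\<lambda>x. \<Sum>i\<in>A. p i x) = (\<lambda>x. \<Sum>i\<in>A. poly3 {(i, j, m). i + j + m = k} (c i) x)"
    by (simp cong: sum.cong)
  then show ?thesis by (simp add: poly3_sum homogeneous_polys_def)
qed

lemma homogeneous_add:
  assumes "p \<in> homogeneous_polys k" "q \<in> homogeneous_polys k"
  shows "(\<lambda>x. p x + q x) \<in> homogeneous_polys k"
  using homogeneous_sum[of UNIV "\<lambda>b. if b then p else q" k] assms by (simp add: UNIV_bool add.commute)

lemma homogeneousE:
  assumes "p \<in> homogeneous_polys k"
  obtains c where "p = (\<lambda>x. \<Sum>e\<in>{(i, j, m). i + j + m = k}. c e * monomial3 (fst e) (fst (snd e)) (snd (snd e)) x)"
  using assms by (auto simp: homogeneous_polys_def poly3_eq)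

lemma homogeneous_mult:
  assumes "p \<in> homogeneous_polys k" "q \<in> homogeneous_polys l"
  shows "(\<lambda>x. p x * q x) \<in> homogeneous_polys (k + l)"
proof -
  obtain c where c: "p = (\<lambda>x. \<Sum>e\<in>{(i, j, m). i + j + m = k}. c e * monomial3 (fst e) (fst (snd e)) (snd (snd e)) x)"
    using homogeneousE[OF assms(1)] by blast
  obtain d where d: "q = (\<lambda>x. \<Sum>e\<in>{(i, j, m). i + j + m = l}. d e * monomial3 (fst e) (fst (snd e)) (snd (snd e)) x)"
    using homogeneousE[OF assms(2)] by blast
  have "(\<lambda>x. p x * q x) = (\<lambda>x. \<Sum>e\<in>{(i, j, m). i + j + m = k}. \<Sum>e'\<in>{(i, j, m). i + j + m = l}.
      (c e * d e') * monomial3 (fst e + fst e') (fst (snd e) + fst (snd e')) (snd (snd e) + snd (snd e')) x)"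
    by (simp add: c d sum_product fun_eq_iff mult_ac flip: monomial3_mult)
  also have "\<dots> \<in> homogeneous_polys (k + l)"
    by (intro homogeneous_sum homogeneous_monomial) auto
  finally show ?thesis .
qed

lemma homogeneous_const: "(\<lambda>x. c) \<in> homogeneous_polys 0"
  using homogeneous_monomial[of 0 0 0 0 c] by (simp add: monomial3_def)

lemma homogeneous_scale: "p \<in> homogeneous_polys k \<Longrightarrow> (\<lambda>x. c * p x) \<in> homogeneous_polys k"
  using homogeneous_mult[OF homogeneous_const] by simp

lemma homogeneous_power:
  "p \<in> homogeneous_polys k \<Longrightarrow> (\<lambda>x. p x ^ n) \<in> homogeneous_polys (n * k)"
proof (induction n)
  case (Suc n)
  then show ?case using homogeneous_mult[of p k "\<lambda>x. p x ^ n" "n * k"] by simp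
qed (simp add: homogeneous_const)

lemma homogeneous_coord: "(\<lambda>x. x$i) \<in> homogeneous_polys 1"
  using homogeneous_monomial[of 1 0 0 1 1] homogeneous_monomial[of 0 1 0 1 1]
    homogeneous_monomial[of 0 0 1 1 1] exhaust_3[of i]
  by (auto simp: monomial3_def)

lemma homogeneous_normsq: "(\<lambda>x. (x$1)\<^sup>2 + (x$2)\<^sup>2 + (x$3)\<^sup>2) \<in> homogeneous_polys 2"
proof -
  have "(\<lambda>x. (x$i)\<^sup>2) \<in> homogeneous_polys 2" for i
    using homogeneous_power[OF homogeneous_coord, of i 2] by simp
  then show ?thesis by (intro homogeneous_add)
qed

lemma continuous_homogeneous:
  assumes "p \<in> homogeneous_polys k"
  shows "continuous_on A p"
proof -
  obtain c where c: "p = (\<lambda>x. \<Sum>e\<in>{(i, j, m). i + j + m = k}. c e * monomial3 (fst e) (fst (snd e)) (snd (snd e)) x)"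
    using homogeneousE[OF assms] by blast
  show ?thesis unfolding c by (intro continuous_intros)
qed

lemma homogeneous_scaleR:
  assumes "p \<in> homogeneous_polys k"
  shows "p (c *\<^sub>R x) = c ^ k * p x"
proof -
  have m: "monomial3 i j m (c *\<^sub>R x) = c ^ (i + j + m) * monomial3 i j m x" for i j m
    by (simp add: monomial3_def power_mult_distrib power_add)
  obtain d where d: "p = (\<lambda>x. \<Sum>e\<in>{(i, j, m). i + j + m = k}. d e * monomial3 (fst e) (fst (snd e)) (snd (snd e)) x)"
    using homogeneousE[OF assms] by blast
  show ?thesis
    unfolding d sum_distrib_left by (intro sum.cong) (auto simp: m)
qed

lemma homogeneous_below:
  assumes "p \<in> homogeneous_polys d" "d < k"
  shows "p \<in> polys_below k"
proof -
  obtain c where c: "p = poly3 {(i, j, m). i + j + m = d} c"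
    using assms by (auto simp: homogeneous_polys_def)
  have "p = poly3 {(i, j, m). i + j + m < k} (\<lambda>(i, j, m). if i + j + m = d then c (i, j, m) else 0)"
    unfolding c poly3_def fun_eq_iff using assms(2)
    by (intro allI sum.mono_neutral_cong_left finite_exponents) (auto split: if_splits)
  then show ?thesis by (auto simp: polys_below_def)
qed

text \<open>The polynomial before its restriction to the sphere; homogeneity can be used only on the
  whole space.\<close>

definition harmonic_poly :: "real \<Rightarrow> nat \<Rightarrow> (real^3 \<Rightarrow> real) \<Rightarrow> bool" where
  "harmonic_poly \<mu> k p \<longleftrightarrow> p \<in> homogeneous_polys k \<and> (\<forall>q\<in>polys_below k. sphere_inner \<mu> p q = 0)"

lemma harmonic_polyI:
  assumes "\<mu> \<ge> 0" "p \<in> homogeneous_polys k"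
    "\<And>i j m. i + j + m < k \<Longrightarrow> sphere_inner \<mu> p (monomial3 i j m) = 0"
  shows "harmonic_poly \<mu> k p"
  unfolding harmonic_poly_def
proof (intro conjI ballI assms)
  fix q assume "q \<in> polys_below k"
  then obtain c where c: "q = poly3 {(i, j, m). i + j + m < k} c"
    by (auto simp: polys_below_def)
  show "sphere_inner \<mu> p q = 0"
    unfolding c poly3_eq using assms
    by (subst sphere_inner_sum_right)
       (auto intro!: continuous_intros continuous_in_sphere_L2 continuous_homogeneous[OF assms(2)] sum.neutral
             simp: sphere_inner_scale_right)
qed

lemma harmonic_poly_orth:
  "harmonic_poly \<mu> k p \<Longrightarrow> q \<in> homogeneous_polys d \<Longrightarrow> d < k \<Longrightarrow> sphere_inner \<mu> p q = 0"
  using homogeneous_below by (auto simp: harmonic_poly_def)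

lemma harmonic_poly_continuous: "harmonic_poly \<mu> k p \<Longrightarrow> continuous_on A p"
  by (auto simp: harmonic_poly_def continuous_homogeneous)

lemma harmonic_poly_sum:
  assumes "\<mu> \<ge> 0" "\<And>i. i \<in> A \<Longrightarrow> harmonic_poly \<mu> k (p i)"
  shows "harmonic_poly \<mu> k (\<lambda>x. \<Sum>i\<in>A. c i * p i x)"
  unfolding harmonic_poly_def
proof (intro conjI ballI)
  show "(\<lambda>x. \<Sum>i\<in>A. c i * p i x) \<in> homogeneous_polys k"
    using assms by (intro homogeneous_sum homogeneous_scale) (auto simp: harmonic_poly_def)
  fix q assume q: "q \<in> polys_below k"
  then have cq: "continuous_on UNIV q"
    by (auto simp: polys_below_def poly3_eq intro!: continuous_intros)
  then have "sphere_inner \<mu> q (\<lambda>x. \<Sum>i\<in>A. c i * p i x) = (\<Sum>i\<in>A. sphere_inner \<mu> q (\<lambda>x. c i * p i x))"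
    by (intro sphere_inner_sum_right[OF assms(1) continuous_in_sphere_L2[OF assms(1) cq]]
        continuous_intros harmonic_poly_continuous[OF assms(2)])
  also have "\<dots> = 0"
    using assms q by (intro sum.neutral) (auto simp: sphere_inner_scale_right sphere_inner_commute[of \<mu> q] harmonic_poly_def)
  finally show "sphere_inner \<mu> (\<lambda>x. \<Sum>i\<in>A. c i * p i x) q = 0" by (simp add: sphere_inner_commute)
qed

text \<open>The weight is positive off the plane x_3 = 0, so \<open>p\<close> vanishes almost
  everywhere on the sphere, and by homogeneity on almost all of the ball. The points of the ball
  where \<open>p\<close> is nonzero form an open null set, hence none exist. Scaling reaches all
  other points.\<close>

lemma sphere_inner_definite:
  assumes \<mu>: "\<mu> \<ge> 0" and p: "p \<in> homogeneous_polys k" and 0: "sphere_inner \<mu> p p = 0"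
  shows "p x = 0"
proof -
  have cont: "continuous_on UNIV p" by (rule continuous_homogeneous[OF p])
  have "integrable sphere_measure (\<lambda>x. p x * p x * sphere_weight \<mu> x)"
    by (intro sphere_L2_integrable continuous_in_sphere_L2 cont \<mu>)
  then have AE: "AE x in sphere_measure. p x * p x * sphere_weight \<mu> x = 0"
    using 0 by (subst integral_nonneg_eq_0_iff_AE[symmetric]) (auto simp: sphere_inner_def sphere_weight_nonneg)
  define N where "N = {x \<in> sphere 0 1. p x \<noteq> 0 \<and> x$3 \<noteq> 0}"
  have N_open: "open {x::real^3. p x \<noteq> 0 \<and> x$3 \<noteq> 0}"
    by (intro open_Collect_conj open_Collect_neq cont continuous_intros)
  have "N = sphere 0 1 \<inter> {x::real^3. p x \<noteq> 0 \<and> x$3 \<noteq> 0}" by (auto simp: N_def)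
  then have N: "N \<in> sets sphere_measure"
    using N_open by (auto simp: sets_sphere_measure sets_restrict_space intro!: image_eqI)
  have "AE x in sphere_measure. x \<notin> N"
    using AE by eventually_elim (auto simp: N_def sphere_weight_def split: if_splits)
  then have "emeasure sphere_measure N = 0"
    using N AE_iff_measurable[of N sphere_measure "\<lambda>x. x \<notin> N"] by (auto simp: N_def)
  then have null: "emeasure lborel {x. norm x < 1 \<and> x \<noteq> 0 \<and> sgn x \<in> N} = 0"
    by (simp add: emeasure_sphere_measure_eq[OF N])
  have "p (sgn x) \<noteq> 0 \<longleftrightarrow> p x \<noteq> 0" if "x \<noteq> 0" for x
    using that by (simp add: sgn_div_norm homogeneous_scaleR[OF p])
  moreover have "sgn x $ 3 \<noteq> 0 \<longleftrightarrow> x$3 \<noteq> 0" if "x \<noteq> 0" for x :: "real^3"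
    using that by (simp add: sgn_div_norm)
  ultimately have "{x. norm x < 1 \<and> x \<noteq> 0 \<and> sgn x \<in> N} = ball 0 1 \<inter> {x. p x \<noteq> 0 \<and> x$3 \<noteq> 0}"
    by (auto simp: N_def norm_sgn)
  with null N_open have "ball 0 1 \<inter> {x. p x \<noteq> 0 \<and> x$3 \<noteq> 0} \<in> null_sets lborel"
    by (auto simp: null_sets_def)
  then have "negligible (ball 0 1 \<inter> {x. p x \<noteq> 0 \<and> x$3 \<noteq> 0})"
    by (simp add: negligible_iff_null_sets null_sets_completionI)
  moreover have "negligible {x::real^3. x$3 = 0}" by (rule negligible_standard_hyperplane_cart)
  ultimately have "negligible (ball 0 1 \<inter> {x. p x \<noteq> 0 \<and> x$3 \<noteq> 0} \<union> {x. x$3 = 0})"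
    by (rule negligible_Un)
  then have "negligible (ball 0 1 \<inter> {x. p x \<noteq> 0})"
    by (rule negligible_subset) auto
  moreover have "open (ball 0 1 \<inter> {x. p x \<noteq> 0})"
    by (intro open_Int open_ball open_Collect_neq cont continuous_intros)
  ultimately have emp: "ball 0 1 \<inter> {x. p x \<noteq> 0} = {}"
    using open_not_negligible by blast
  \<comment> \<open>A positive factor that moves \<open>x\<close> into the open unit ball.\<close>
  define c where "c = 1 / (norm x + 1)"
  have c: "c > 0" by (simp add: c_def add_nonneg_pos)
  have "c *\<^sub>R x \<in> ball 0 1" by (simp add: c_def add_nonneg_pos)
  with emp have "p (c *\<^sub>R x) = 0" by blast
  with c show ?thesis by (simp add: homogeneous_scaleR[OF p])
qed

text \<open>The definite description has a unique solution: the difference of two candidates is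
  again harmonic and is orthogonal to itself.\<close>

lemma proj_harmonics_eqI:
  assumes \<mu>: "\<mu> \<ge> 0" and f: "f \<in> sphere_L2 \<mu>" and g: "harmonic_poly \<mu> k g"
    and orth: "\<And>q. harmonic_poly \<mu> k q \<Longrightarrow> sphere_inner \<mu> f q = sphere_inner \<mu> g q"
    and x: "x \<in> sphere 0 1"
  shows "proj_harmonics \<mu> k f x = g x"
proof -
  have SH: "sphere_harmonics \<mu> k = {restrict p (sphere 0 1) | p. harmonic_poly \<mu> k p}"
    by (auto simp: sphere_harmonics_def harmonic_poly_def)
  have inner: "sphere_inner \<mu> (\<lambda>x. f x - restrict p (sphere 0 1) x) (restrict q (sphere 0 1)) =
      sphere_inner \<mu> f q - sphere_inner \<mu> p q" if "harmonic_poly \<mu> k p" "harmonic_poly \<mu> k q" for p q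
  proof -
    have "sphere_inner \<mu> (\<lambda>x. f x - restrict p (sphere 0 1) x) (restrict q (sphere 0 1)) =
      sphere_inner \<mu> (\<lambda>x. f x - p x) q" by (rule sphere_inner_cong) auto
    also have "\<dots> = sphere_inner \<mu> f q - sphere_inner \<mu> p q"
      using that by (intro sphere_inner_diff_left \<mu> f harmonic_poly_continuous)
    finally show ?thesis .
  qed
  have "proj_harmonics \<mu> k f = restrict g (sphere 0 1)"
    unfolding proj_harmonics_def
  proof (rule the_equality)
    have "sphere_inner \<mu> (\<lambda>x. f x - restrict g (sphere 0 1) x) q = 0" if q: "q \<in> sphere_harmonics \<mu> k" for q
    proof -
      obtain q' where q': "q = restrict q' (sphere 0 1)" "harmonic_poly \<mu> k q'"
        using q unfolding SH by blast
      show ?thesis unfolding q'(1) inner[OF g q'(2)] using orth[OF q'(2)] by simp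
    qed
    then show "restrict g (sphere 0 1) \<in> sphere_harmonics \<mu> k \<and>
      (\<forall>q\<in>sphere_harmonics \<mu> k. sphere_inner \<mu> (\<lambda>x. f x - restrict g (sphere 0 1) x) q = 0)"
      using g by (auto simp: SH)
    fix p' assume p': "p' \<in> sphere_harmonics \<mu> k \<and>
      (\<forall>q\<in>sphere_harmonics \<mu> k. sphere_inner \<mu> (\<lambda>x. f x - p' x) q = 0)"
    then obtain p where p: "p' = restrict p (sphere 0 1)" "harmonic_poly \<mu> k p" by (auto simp: SH)
    define d where "d = (\<lambda>x. p x - g x)"
    \<comment> \<open>The difference as a sum over the two booleans, so that
      \<open>harmonic_poly_sum\<close> applies.\<close>
    have d_eq: "d = (\<lambda>x. \<Sum>b\<in>UNIV. (if b then 1 else -1) * (if b then p else g) x)"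
      by (simp add: d_def UNIV_bool fun_eq_iff)
    have d: "harmonic_poly \<mu> k d"
      unfolding d_eq using p g by (intro harmonic_poly_sum \<mu>) auto
    have "sphere_inner \<mu> f d = sphere_inner \<mu> p d"
    proof -
      have "restrict d (sphere 0 1) \<in> sphere_harmonics \<mu> k" using d by (auto simp: SH)
      then have "sphere_inner \<mu> (\<lambda>x. f x - p' x) (restrict d (sphere 0 1)) = 0" using p' by blast
      then show ?thesis unfolding p(1) inner[OF p(2) d] by simp
    qed
    moreover have "sphere_inner \<mu> f d = sphere_inner \<mu> g d" by (rule orth[OF d])
    moreover have "sphere_inner \<mu> d d = sphere_inner \<mu> p d - sphere_inner \<mu> g d"
      using p g d unfolding d_def[abs_def] d_def
      by (intro sphere_inner_diff_left \<mu> continuous_in_sphere_L2 harmonic_poly_continuous) (auto simp: d_def)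
    ultimately have "sphere_inner \<mu> d d = 0" by simp
    then have "d y = 0" for y
      using d by (intro sphere_inner_definite[OF \<mu>, of d k]) (auto simp: harmonic_poly_def)
    then show "p' = restrict g (sphere 0 1)" by (auto simp: p d_def)
  qed
  then show ?thesis using x by simp
qed

section \<open>Sampling on the equator\<close>

text \<open>Trigonometric polynomials with the frequencies N, N - 2, ..., -N only, encoded as one
  ordinary polynomial in z = e^(-2 i \<phi>).\<close>

definition circle_form :: "nat \<Rightarrow> (real \<Rightarrow> real) \<Rightarrow> bool" where
  "circle_form N g \<longleftrightarrow> (\<exists>P :: complex poly. degree P \<le> N \<and>
     (\<forall>\<phi>. complex_of_real (g \<phi>) = cis (real N * \<phi>) * poly P (cis (- 2 * \<phi>))))"

text \<open>Each factor supplies one e^(i \<phi>) and one linear polynomial in z = e^(-2 i \<phi>):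
  the cosine gives (1 + z) / 2 and the sine gives (-i + i z) / 2.\<close>

lemma circle_form_cos_sin:
  assumes "a + b = N"
  shows "circle_form N (\<lambda>\<phi>. c * (cos \<phi> ^ a * sin \<phi> ^ b))"
  unfolding circle_form_def
proof (intro exI conjI allI)
  let ?P = "smult (of_real c) ([:1/2, 1/2:] ^ a * [:- \<i>/2, \<i>/2:] ^ b) :: complex poly"
  have "degree ?P \<le> degree ([:1/2, 1/2:] ^ a :: complex poly) + degree ([:- \<i>/2, \<i>/2:] ^ b)"
    by (rule order_trans[OF degree_smult_le degree_mult_le])
  also have "\<dots> \<le> 1 * a + 1 * b"
    by (intro add_mono order_trans[OF degree_power_le] mult_right_mono) auto
  finally show "degree ?P \<le> N" using assms by simp
  fix \<phi> :: real
  have 2: "cis \<phi> * cis (- 2 * \<phi>) = cis (- \<phi>)" by (simp add: cis_mult)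
  have c: "complex_of_real (cos \<phi>) = cis \<phi> * (1/2 + cis (- 2 * \<phi>) * (1/2))"
    unfolding distrib_left mult.assoc[symmetric] 2 by (simp add: complex_eq_iff)
  have s: "complex_of_real (sin \<phi>) = cis \<phi> * (- \<i>/2 + cis (- 2 * \<phi>) * (\<i>/2))"
    unfolding distrib_left mult.assoc[symmetric] 2 by (simp add: complex_eq_iff)
  have "complex_of_real (c * (cos \<phi> ^ a * sin \<phi> ^ b)) =
      of_real c * (complex_of_real (cos \<phi>) ^ a * complex_of_real (sin \<phi>) ^ b)" by simp
  also have "\<dots> = cis \<phi> ^ (a + b) * poly ?P (cis (- 2 * \<phi>))"
    unfolding c s by (simp add: power_mult_distrib power_add mult_ac)
  also have "cis \<phi> ^ (a + b) = cis (real N * \<phi>)"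
    using assms by (simp add: Complex.DeMoivre)
  finally show "complex_of_real (c * (cos \<phi> ^ a * sin \<phi> ^ b)) = cis (real N * \<phi>) * poly ?P (cis (- 2 * \<phi>))" .
qed

lemma circle_form_sum:
  assumes "finite A" "\<And>i. i \<in> A \<Longrightarrow> circle_form N (g i)"
  shows "circle_form N (\<lambda>\<phi>. \<Sum>i\<in>A. g i \<phi>)"
proof -
  obtain P where P: "\<And>i. i \<in> A \<Longrightarrow> degree (P i :: complex poly) \<le> N"
    "\<And>i \<phi>. i \<in> A \<Longrightarrow> complex_of_real (g i \<phi>) = cis (real N * \<phi>) * poly (P i) (cis (- 2 * \<phi>))"
    using assms unfolding circle_form_def by metis
  show ?thesis
    unfolding circle_form_def
    by (rule exI[of _ "\<Sum>i\<in>A. P i"])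
       (auto simp: poly_sum sum_distrib_left P intro!: degree_sum_le assms(1))
qed

lemma circle_form_equator:
  assumes "p \<in> homogeneous_polys k"
  shows "circle_form k (\<lambda>\<phi>. p (vector [cos \<phi>, sin \<phi>, 0]))"
proof -
  obtain c where c: "p = (\<lambda>x. \<Sum>e\<in>{(i, j, m). i + j + m = k}. c e * monomial3 (fst e) (fst (snd e)) (snd (snd e)) x)"
    using homogeneousE[OF assms] by blast
  have "circle_form k (\<lambda>\<phi>. c (i, j, m) * monomial3 i j m (vector [cos \<phi>, sin \<phi>, 0]))" if "i + j + m = k" for i j m
  proof (cases m)
    case 0
    then show ?thesis using circle_form_cos_sin[of i j k] that by (simp add: monomial3_def)
  next
    case (Suc m')
    \<comment> \<open>A positive power of x_3 vanishes on the equator; the zero function is the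
      instance with coefficient 0.\<close>
    then show ?thesis using circle_form_cos_sin[of k 0 k 0] by (simp add: monomial3_def)
  qed
  then show ?thesis unfolding c by (intro circle_form_sum finite_exponents) auto
qed

lemma circle_form_expand:
  assumes "circle_form N g"
  obtains A where "\<And>\<phi>. complex_of_real (g \<phi>) = (\<Sum>i\<le>N. A i * cis ((real N - 2 * real i) * \<phi>))"
proof -
  obtain P :: "complex poly" where P: "degree P \<le> N"
    "\<And>\<phi>. complex_of_real (g \<phi>) = cis (real N * \<phi>) * poly P (cis (- 2 * \<phi>))"
    using assms unfolding circle_form_def by metis
  have "complex_of_real (g \<phi>) = (\<Sum>i\<le>N. coeff P i * cis ((real N - 2 * real i) * \<phi>))" for \<phi>
  proof -
    have "poly P z = (\<Sum>i\<le>N. coeff P i * z ^ i)" for z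
      unfolding poly_altdef using P(1) by (intro sum.mono_neutral_left) (auto intro!: coeff_eq_0)
    moreover have "cis (real N * \<phi>) * (c * cis (- 2 * \<phi>) ^ i) = c * cis ((real N - 2 * real i) * \<phi>)" for c i
    proof -
      have "real N * \<phi> + real i * (- 2 * \<phi>) = (real N - 2 * real i) * \<phi>" by (simp add: algebra_simps)
      then have "cis (real N * \<phi>) * cis (- 2 * \<phi>) ^ i = cis ((real N - 2 * real i) * \<phi>)"
        by (simp only: Complex.DeMoivre cis_mult)
      then show ?thesis by (metis mult.left_commute)
    qed
    ultimately show ?thesis
      by (simp only: P(2) sum_distrib_left)
  qed
  then show ?thesis by (rule that)
qed

text \<open>The nodes fill only a half circle, but the factor 2 turns them into (n + 1)-th roots of
  unity. For 0 < |d| \<le> n the ratio of the geometric sum is not 1, while its (n + 1)-th power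
  is.\<close>

lemma sum_roots_of_unity:
  fixes d :: int
  assumes "\<bar>d\<bar> \<le> int n"
  shows "(\<Sum>\<nu>=0..n. cis (2 * of_int d * (real \<nu> * pi / (real n + 1)))) = (if d = 0 then of_nat (n + 1) else 0)"
proof (cases "d = 0")
  case False
  define w where "w = cis (2 * of_int d * pi / (real n + 1))"
  have w1: "w \<noteq> 1"
  proof
    assume "w = 1"
    then obtain e :: int where "2 * of_int d * pi / (real n + 1) = of_int e * (2 * pi)"
      unfolding w_def cis_eq_1_iff by auto
    then have "of_int d * (2 * pi) = (of_int e * (real n + 1)) * (2 * pi)"
      by (simp add: field_simps)
    then have "real_of_int d = real_of_int (e * (int n + 1))"
      unfolding mult_cancel_right by simp
    then have de: "d = e * (int n + 1)" by (simp only: of_int_eq_iff)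
    with False have "1 \<le> \<bar>e\<bar>" by auto
    then have "1 * (int n + 1) \<le> \<bar>e\<bar> * (int n + 1)" by (intro mult_right_mono) auto
    moreover have "\<bar>d\<bar> = \<bar>e\<bar> * (int n + 1)" by (simp add: de abs_mult)
    ultimately have "int n + 1 \<le> \<bar>d\<bar>" by simp
    then show False using assms by simp
  qed
  have "w ^ Suc n = cis (2 * pi * of_int d)"
    unfolding w_def Complex.DeMoivre by (rule arg_cong[where f = cis]) (simp add: field_simps)
  then have wn: "w ^ Suc n = 1" using cis_eq_1_iff[of "2 * pi * of_int d"] by (auto simp: mult_ac)
  have "(\<Sum>\<nu>=0..n. cis (2 * of_int d * (real \<nu> * pi / (real n + 1)))) = (\<Sum>\<nu><Suc n. w ^ \<nu>)"
    unfolding w_def Complex.DeMoivre by (intro sum.cong) (auto simp: field_simps)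
  also have "\<dots> = 0" unfolding geometric_sum[OF w1] wn by simp
  finally show ?thesis using False by simp
qed simp

text \<open>A trigonometric form of degree \<open>k\<close> only has the frequencies \<open>k - 2 i\<close>; the sampling nodes
  separate them as soon as \<open>k \<le> n\<close>.\<close>

lemma circle_form_sampling:
  assumes "circle_form k g" "k \<le> n"
  shows "(\<Sum>\<nu>=0..n. g (real \<nu> * pi / (real n + 1)) *
      Re (\<Sum>m\<le>k. cis ((real k - 2 * real m) * (\<phi> - real \<nu> * pi / (real n + 1))))) = (real n + 1) * g \<phi>"
proof -
  obtain A where A: "\<And>\<phi>. complex_of_real (g \<phi>) = (\<Sum>i\<le>k. A i * cis ((real k - 2 * real i) * \<phi>))"
    using circle_form_expand[OF assms(1)] by blast
  let ?x = "\<lambda>\<nu>. real \<nu> * pi / (real n + 1)"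
  have "(\<Sum>\<nu>=0..n. complex_of_real (g (?x \<nu>)) * (\<Sum>m\<le>k. cis ((real k - 2 * real m) * (\<phi> - ?x \<nu>)))) =
      (\<Sum>\<nu>=0..n. \<Sum>i\<le>k. \<Sum>m\<le>k. A i * cis ((real k - 2 * real m) * \<phi>) * cis (2 * of_int (int m - int i) * ?x \<nu>))"
    unfolding A sum_product
  proof (intro sum.cong refl)
    fix \<nu> i m
    \<comment> \<open>In the node variable the frequencies k - 2 i and -(k - 2 m) add up to 2 (m -
      i), where |m - i| \<le> k \<le> n.\<close>
    have e: "(real k - 2 * real i) * y + (real k - 2 * real m) * (\<phi> - y) =
        (real k - 2 * real m) * \<phi> + 2 * of_int (int m - int i) * y" for y
      by (simp add: algebra_simps)
    show "A i * cis ((real k - 2 * real i) * ?x \<nu>) * cis ((real k - 2 * real m) * (\<phi> - ?x \<nu>)) =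
        A i * cis ((real k - 2 * real m) * \<phi>) * cis (2 * of_int (int m - int i) * ?x \<nu>)"
      by (simp only: mult.assoc cis_mult e)
  qed
  also have "\<dots> = (\<Sum>i\<le>k. \<Sum>m\<le>k. A i * cis ((real k - 2 * real m) * \<phi>) *
      (\<Sum>\<nu>=0..n. cis (2 * of_int (int m - int i) * ?x \<nu>)))"
    unfolding sum_distrib_left
    by (rule trans[OF sum.swap], rule sum.cong[OF refl], rule sum.swap)
  also have "\<dots> = (\<Sum>i\<le>k. \<Sum>m\<le>k. A i * cis ((real k - 2 * real m) * \<phi>) *
      (if int m - int i = 0 then of_nat (n + 1) else 0))"
    using assms(2) by (intro sum.cong refl arg_cong2[where f = times] sum_roots_of_unity) auto
  also have "\<dots> = (\<Sum>i\<le>k. \<Sum>m\<le>k. if m = i then A i * cis ((real k - 2 * real i) * \<phi>) * of_nat (n + 1) else 0)"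
    by (intro sum.cong refl) auto
  also have "\<dots> = of_nat (n + 1) * complex_of_real (g \<phi>)"
    by (simp add: A sum_distrib_left mult_ac sum.delta)
  finally have "Re (\<Sum>\<nu>=0..n. complex_of_real (g (?x \<nu>)) * (\<Sum>m\<le>k. cis ((real k - 2 * real m) * (\<phi> - ?x \<nu>)))) =
      Re (of_nat (n + 1) * complex_of_real (g \<phi>))" by (rule arg_cong)
  then show ?thesis by (simp del: Re_sum add: Re_sum[of _ "{0..n}"])
qed

text \<open>Opposite frequencies combine into cosines, and frequency 0 occurs once if k is even. The
  induction goes in steps of two because k + 2 adds just the outermost pair.\<close>

lemma cis_sum_pairing:
  "(\<Sum>m\<le>k. cis ((real k - 2 * real m) * \<theta>)) =
   of_real (\<Sum>l\<le>k div 2. (if 2 * l = k then 1 else 2) * cos (real (k - 2 * l) * \<theta>))"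
proof (induction k rule: induct_nat_012)
  case 0 then show ?case by simp
next
  case 1 then show ?case by (simp add: complex_eq_iff)
next
  case (ge2 k)
  have "(\<Sum>m\<le>Suc (Suc k). cis ((real (Suc (Suc k)) - 2 * real m) * \<theta>)) =
      cis (real (k + 2) * \<theta>) + (\<Sum>m\<le>Suc k. cis ((real (Suc (Suc k)) - 2 * real (Suc m)) * \<theta>))"
    by (subst sum.atMost_Suc_shift) simp
  also have "(\<Sum>m\<le>Suc k. cis ((real (Suc (Suc k)) - 2 * real (Suc m)) * \<theta>)) =
      (\<Sum>m\<le>k. cis ((real k - 2 * real m) * \<theta>)) + cis (- (real (k + 2) * \<theta>))"
    by (simp add: algebra_simps)
  also have "cis (real (k + 2) * \<theta>) + ((\<Sum>m\<le>k. cis ((real k - 2 * real m) * \<theta>)) + cis (- (real (k + 2) * \<theta>))) =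
      of_real (2 * cos (real (k + 2) * \<theta>)) + (\<Sum>m\<le>k. cis ((real k - 2 * real m) * \<theta>))"
    by (simp add: complex_eq_iff)
  also have "\<dots> = of_real (2 * cos (real (k + 2) * \<theta>) +
      (\<Sum>l\<le>k div 2. (if 2 * l = k then 1 else 2) * cos (real (k - 2 * l) * \<theta>)))"
    by (simp only: ge2.IH(1) of_real_add)
  also have "2 * cos (real (k + 2) * \<theta>) +
      (\<Sum>l\<le>k div 2. (if 2 * l = k then 1 else 2) * cos (real (k - 2 * l) * \<theta>)) =
      (\<Sum>l\<le>Suc (k div 2). (if 2 * l = k + 2 then 1 else 2) * cos (real (k + 2 - 2 * l) * \<theta>))"
    by (subst sum.atMost_Suc_shift) simp
  finally show ?case by simp
qed

section \<open>The angular kernel\<close>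

text \<open>De Moivre removes the polar coordinates: r^j cos (j \<phi>) and r^j sin (j \<phi>) are
  the real and imaginary part of (x + i y)^j, so the basis functions are polynomials.\<close>

lemma disk_basis_eq:
  "disk_basis \<mu> k l \<epsilon> x y = disk_norm \<mu> l k *
     poly (jacobi_orthonormal (\<mu> - 1/2) (real (k - 2 * l)) l) (2 * (x\<^sup>2 + y\<^sup>2) - 1) *
     (if \<epsilon> = 0 then Re (Complex x y ^ (k - 2 * l)) else Im (Complex x y ^ (k - 2 * l)))"
proof -
  define z j where "z = Complex x y" and "j = k - 2 * l"
  have "z ^ j = rcis (cmod z ^ j) (real j * Arg z)"
    by (metis DeMoivre2 rcis_cmod_Arg)
  then have "Re (z ^ j) = cmod z ^ j * cos (real j * Arg z)" "Im (z ^ j) = cmod z ^ j * sin (real j * Arg z)"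
    by simp_all
  moreover have "(cmod z)\<^sup>2 = x\<^sup>2 + y\<^sup>2" by (simp add: z_def cmod_def)
  ultimately show ?thesis
    by (simp add: disk_basis_def Let_def ang_def z_def j_def)
qed

text \<open>Cosine and sine terms combine by the addition theorem into one real part, and
  \<open>kernel_coeff_normalization\<close> absorbs all constants except one value of the Jacobi
  polynomial at 1.\<close>

lemma angular_kernel_eq:
  assumes "\<mu> \<ge> 0"
  shows "angular_kernel \<mu> k \<xi> x y = (\<Sum>l\<le>k div 2. (if 2 * l = k then 1 else 2) /
      poly (jacobi_orthonormal (\<mu> - 1/2) (real (k - 2 * l)) l) 1 *
      (poly (jacobi_orthonormal (\<mu> - 1/2) (real (k - 2 * l)) l) (2 * (x\<^sup>2 + y\<^sup>2) - 1) *
       Re (cis (- (real (k - 2 * l) * \<xi>)) * Complex x y ^ (k - 2 * l))))"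
proof -
  define f where "f = (\<lambda>l \<epsilon>. kernel_coeff \<mu> l k * disk_basis \<mu> k l \<epsilon> (cos \<xi>) (sin \<xi>) * disk_basis \<mu> k l \<epsilon> x y)"
  have idx: "disk_index k = Sigma {..k div 2} (\<lambda>l. if 2 * l = k then {0} else {0, 1})"
    by (auto simp: disk_index_def split: if_splits)
  have "angular_kernel \<mu> k \<xi> x y = (\<Sum>l\<le>k div 2. \<Sum>\<epsilon>\<in>(if 2 * l = k then {0} else {0, 1}). f l \<epsilon>)"
    unfolding angular_kernel_def idx by (subst sum.Sigma) (auto simp: f_def)
  also have "\<dots> = (\<Sum>l\<le>k div 2. (if 2 * l = k then 1 else 2) /
      poly (jacobi_orthonormal (\<mu> - 1/2) (real (k - 2 * l)) l) 1 *
      (poly (jacobi_orthonormal (\<mu> - 1/2) (real (k - 2 * l)) l) (2 * (x\<^sup>2 + y\<^sup>2) - 1) *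
       Re (cis (- (real (k - 2 * l) * \<xi>)) * Complex x y ^ (k - 2 * l))))"
  proof (rule sum.cong[OF refl])
    fix l assume "l \<in> {..k div 2}"
    then have l: "2 * l \<le> k" by auto
    let ?p = "jacobi_orthonormal (\<mu> - 1/2) (real (k - 2 * l)) l" and ?j = "k - 2 * l"
    have p1: "poly ?p 1 > 0" using assms by (intro poly_jacobi_orthonormal_1_pos) auto
    have cs: "Complex (cos \<xi>) (sin \<xi>) ^ ?j = cis (real ?j * \<xi>)"
      by (simp add: cis.code[symmetric] Complex.DeMoivre)
    have b: "2 * ((cos \<xi>)\<^sup>2 + (sin \<xi>)\<^sup>2) - 1 = 1" by simp
    \<comment> \<open>For \<open>2 * l = k\<close> the missing sine term is 0, so it may be
      added.\<close>
    have "(\<Sum>\<epsilon>\<in>(if 2 * l = k then {0} else {0, 1}). f l \<epsilon>) = f l 0 + f l 1"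
      by (auto simp: f_def disk_basis_eq)
    also have "\<dots> = kernel_coeff \<mu> l k * (disk_norm \<mu> l k)\<^sup>2 * poly ?p 1 *
        (poly ?p (2 * (x\<^sup>2 + y\<^sup>2) - 1) * Re (cis (- (real ?j * \<xi>)) * Complex x y ^ ?j))"
      unfolding f_def disk_basis_eq b cs by (simp add: power2_eq_square algebra_simps)
    also have "kernel_coeff \<mu> l k * (disk_norm \<mu> l k)\<^sup>2 * poly ?p 1 = (if 2 * l = k then 1 else 2) / poly ?p 1"
      using kernel_coeff_normalization[OF assms l] p1 by (simp add: field_simps power2_eq_square)
    finally show "(\<Sum>\<epsilon>\<in>(if 2 * l = k then {0} else {0, 1}). f l \<epsilon>) = (if 2 * l = k then 1 else 2) / poly ?p 1 *
        (poly ?p (2 * (x\<^sup>2 + y\<^sup>2) - 1) * Re (cis (- (real ?j * \<xi>)) * Complex x y ^ ?j))" .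
  qed
  finally show ?thesis .
qed

text \<open>On the unit circle 2 r^2 - 1 = 1, so the Jacobi factors cancel and the Dirichlet kernel
  is left.\<close>

lemma angular_kernel_boundary:
  assumes "\<mu> \<ge> 0"
  shows "angular_kernel \<mu> k \<xi> (cos \<phi>) (sin \<phi>) =
    (\<Sum>l\<le>k div 2. (if 2 * l = k then 1 else 2) * cos (real (k - 2 * l) * (\<phi> - \<xi>)))"
  unfolding angular_kernel_eq[OF assms]
proof (rule sum.cong[OF refl])
  fix l
  let ?p = "jacobi_orthonormal (\<mu> - 1/2) (real (k - 2 * l)) l" and ?j = "k - 2 * l"
  have p1: "poly ?p 1 > 0" using assms by (intro poly_jacobi_orthonormal_1_pos) auto
  have b: "2 * ((cos \<phi>)\<^sup>2 + (sin \<phi>)\<^sup>2) - 1 = 1" by simp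
  have "cis (- (real ?j * \<xi>)) * Complex (cos \<phi>) (sin \<phi>) ^ ?j = cis (real ?j * (\<phi> - \<xi>))"
    by (simp add: cis.code[symmetric] Complex.DeMoivre cis_mult algebra_simps)
  then show "(if 2 * l = k then 1 else 2) / poly ?p 1 *
        (poly ?p (2 * ((cos \<phi>)\<^sup>2 + (sin \<phi>)\<^sup>2) - 1) * Re (cis (- (real ?j * \<xi>)) * Complex (cos \<phi>) (sin \<phi>) ^ ?j))
      = (if 2 * l = k then 1 else 2) * cos (real ?j * (\<phi> - \<xi>))"
    unfolding b using p1 by simp
qed

text \<open>The homogeneous extension of a disk function: on the sphere 2 (x_1^2 + x_2^2) - 1 equals
  x_1^2 + x_2^2 - x_3^2, and powers of the squared norm, which is 1 there, fill up the
  degree.\<close>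

definition disk_solid :: "real \<Rightarrow> nat \<Rightarrow> nat \<Rightarrow> real \<Rightarrow> real^3 \<Rightarrow> real" where
  "disk_solid \<mu> l j \<xi> x =
     (\<Sum>i\<le>l. coeff (jacobi_orthonormal (\<mu> - 1/2) (real j) l) i *
        ((x$1)\<^sup>2 + (x$2)\<^sup>2 - (x$3)\<^sup>2) ^ i * ((x$1)\<^sup>2 + (x$2)\<^sup>2 + (x$3)\<^sup>2) ^ (l - i)) *
     Re (cis (- (real j * \<xi>)) * Complex (x$1) (x$2) ^ j)"

lemma homogeneous_Re_Im_power:
  "(\<lambda>x. Re (Complex (x$1) (x$2) ^ j)) \<in> homogeneous_polys j \<and>
   (\<lambda>x. Im (Complex (x$1) (x$2) ^ j)) \<in> homogeneous_polys j"
proof (induction j)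
  case (Suc j)
  have c: "(\<lambda>x. x$i) \<in> homogeneous_polys 1" for i by (rule homogeneous_coord)
  have m: "(\<lambda>x. x$i * p x) \<in> homogeneous_polys (Suc j)" if "p \<in> homogeneous_polys j" for p i
    using homogeneous_mult[OF c that] by simp
  have s: "(\<lambda>x. p x - q x) \<in> homogeneous_polys (Suc j)"
    if "p \<in> homogeneous_polys (Suc j)" "q \<in> homogeneous_polys (Suc j)" for p q
    using homogeneous_add[OF that(1) homogeneous_scale[OF that(2), of "-1"]] by simp
  show ?case using Suc by (auto intro!: m s homogeneous_add)
qed (use homogeneous_const in auto)

lemma disk_solid_homogeneous: "disk_solid \<mu> l j \<xi> \<in> homogeneous_polys (j + 2 * l)"
proof -
  have sq: "(\<lambda>x. (x$i)\<^sup>2) \<in> homogeneous_polys 2" for i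
    using homogeneous_power[OF homogeneous_coord, of i 2] by simp
  have d: "(\<lambda>x. (x$1)\<^sup>2 + (x$2)\<^sup>2 - (x$3)\<^sup>2) \<in> homogeneous_polys 2"
    using homogeneous_add[OF homogeneous_add[OF sq sq] homogeneous_scale[OF sq, of "-1"]] by simp
  have "(\<lambda>x. c * ((x$1)\<^sup>2 + (x$2)\<^sup>2 - (x$3)\<^sup>2) ^ i * ((x$1)\<^sup>2 + (x$2)\<^sup>2 + (x$3)\<^sup>2) ^ (l - i))
      \<in> homogeneous_polys (2 * l)" if "i \<le> l" for c i
  proof -
    have "i * 2 + (l - i) * 2 = 2 * l" using that by simp
    then show ?thesis
      using homogeneous_scale[OF homogeneous_mult[OF homogeneous_power[OF d, of i]
          homogeneous_power[OF homogeneous_normsq, of "l - i"]], of c] by (simp add: mult.assoc)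
  qed
  then have 1: "(\<lambda>x. \<Sum>i\<le>l. coeff (jacobi_orthonormal (\<mu> - 1/2) (real j) l) i *
        ((x$1)\<^sup>2 + (x$2)\<^sup>2 - (x$3)\<^sup>2) ^ i * ((x$1)\<^sup>2 + (x$2)\<^sup>2 + (x$3)\<^sup>2) ^ (l - i)) \<in> homogeneous_polys (2 * l)"
    by (intro homogeneous_sum) auto
  have "(\<lambda>x. cos (real j * \<xi>) * Re (Complex (x$1) (x$2) ^ j) + sin (real j * \<xi>) * Im (Complex (x$1) (x$2) ^ j))
      \<in> homogeneous_polys j"
    using homogeneous_Re_Im_power[of j] by (intro homogeneous_add homogeneous_scale) auto
  then have 2: "(\<lambda>x. Re (cis (- (real j * \<xi>)) * Complex (x$1) (x$2) ^ j)) \<in> homogeneous_polys j"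
    by simp
  show ?thesis
    using homogeneous_mult[OF 1 2] by (simp add: disk_solid_def[abs_def] add.commute)
qed

lemma disk_solid_on_sphere:
  assumes \<mu>: "\<mu> \<ge> 0" and x: "x \<in> sphere 0 1"
  shows "disk_solid \<mu> l j \<xi> x =
     poly (jacobi_orthonormal (\<mu> - 1/2) (real j) l) (2 * ((x$1)\<^sup>2 + (x$2)\<^sup>2) - 1) *
     Re (cis (- (real j * \<xi>)) * Complex (x$1) (x$2) ^ j)"
proof -
  have ab: "\<mu> - 1/2 > -1" "real j > -1" "\<mu> - 1/2 + real j > -1" using \<mu> by auto
  have "degree (jacobi_orthonormal (\<mu> - 1/2) (real j) l) \<le> l"
    unfolding jacobi_orthonormal_eq[OF ab]
    by (rule order_trans[OF degree_smult_le]) (simp add: degree_jacobi_base[OF ab])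
  then have p: "poly (jacobi_orthonormal (\<mu> - 1/2) (real j) l) u =
      (\<Sum>i\<le>l. coeff (jacobi_orthonormal (\<mu> - 1/2) (real j) l) i * u ^ i)" for u
    unfolding poly_altdef by (intro sum.mono_neutral_left) (auto intro!: coeff_eq_0)
  have n: "(x$1)\<^sup>2 + (x$2)\<^sup>2 + (x$3)\<^sup>2 = 1"
    using x by (simp add: norm_vec3)
  then have e: "(x$1)\<^sup>2 + (x$2)\<^sup>2 - (x$3)\<^sup>2 = 2 * ((x$1)\<^sup>2 + (x$2)\<^sup>2) - 1" by simp
  show ?thesis unfolding disk_solid_def n e p by simp
qed

section \<open>Harmonicity of the homogeneous extensions\<close>

lemma set_integrable_bounded_Icc:
  fixes f :: "real \<Rightarrow> real"
  assumes [measurable]: "f \<in> borel_measurable borel" and "\<And>t. t \<in> {a..b} \<Longrightarrow> \<bar>f t\<bar> \<le> B"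
  shows "set_integrable lborel {a..b} f"
  unfolding set_integrable_def
proof (rule Bochner_Integration.integrable_bound)
  show "integrable lborel (\<lambda>t. B * indicator {a..b} t)"
    by (intro integrable_mult_right integrable_real_indicator) (auto simp: emeasure_lborel_Icc_eq)
  show "AE t in lborel. norm (indicator {a..b} t *\<^sub>R f t) \<le> norm (B * indicator {a..b} t)"
    using assms(2) by (intro always_eventually allI) (force simp: indicator_def)
qed measurable

text \<open>The profile of \<open>sphere_weight\<close> as a function of one real variable. It is
  evaluated at the height t and later also at sin \<alpha>.\<close>

definition axis_weight :: "real \<Rightarrow> real \<Rightarrow> real" where
  "axis_weight \<mu> t = (if \<mu> = 0 then 1 else \<bar>t\<bar> powr (2 * \<mu>))"

lemma axis_weight_measurable [measurable]: "axis_weight \<mu> \<in> borel_measurable borel"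
  unfolding axis_weight_def[abs_def] by measurable

lemma axis_weight_minus [simp]: "axis_weight \<mu> (- t) = axis_weight \<mu> t"
  by (auto simp: axis_weight_def)

lemma axis_weight_bounds:
  assumes "\<mu> \<ge> 0" "t \<in> {-1..1}"
  shows "0 \<le> axis_weight \<mu> t" "axis_weight \<mu> t \<le> 1"
  using assms by (auto simp: axis_weight_def intro!: powr_le1)

lemma axis_weight_moment:
  assumes \<mu>: "\<mu> \<ge> 0"
  shows "set_integrable lborel {-1..1} (\<lambda>t. t ^ (2 * i) * axis_weight \<mu> t)"
    and "(LBINT t:{-1..1}. t ^ (2 * i) * axis_weight \<mu> t) = 1 / (\<mu> + real i + 1/2)"
proof -
  let ?f = "\<lambda>t. t ^ (2 * i) * axis_weight \<mu> t"
  show int: "set_integrable lborel {-1..1} ?f"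
  proof (rule set_integrable_bounded_Icc)
    fix t :: real assume t: "t \<in> {-1..1}"
    then have "\<bar>t ^ (2 * i)\<bar> \<le> 1" by (auto simp: power_abs intro!: power_le_one)
    then have "\<bar>t ^ (2 * i)\<bar> * \<bar>axis_weight \<mu> t\<bar> \<le> 1 * 1"
      using axis_weight_bounds[OF \<mu> t] by (intro mult_mono) auto
    then show "\<bar>?f t\<bar> \<le> 1" by (simp add: abs_mult)
  qed measurable
  have "((\<lambda>t. t powr (2 * \<mu> + 2 * real i)) has_integral (1 powr (2 * \<mu> + 2 * real i + 1) / (2 * \<mu> + 2 * real i + 1))) {0..1}"
    using \<mu> by (intro has_integral_powr_from_0) auto
  then have "((\<lambda>t. t powr (2 * \<mu> + 2 * real i)) has_integral (1 / (2 * \<mu> + 2 * real i + 1))) {0..1}"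
    by simp
  then have p: "(?f has_integral (1 / (2 * \<mu> + 2 * real i + 1))) {0..1}"
  \<comment> \<open>The integrands may differ at t = 0, since \<open>0 powr 0 = 0\<close>.\<close>
  proof (rule has_integral_spike[rotated 2, where S = "{0}"])
    fix t :: real assume "t \<in> {0..1} - {0}"
    then have t: "t > 0" by auto
    then have "t powr (2 * real i) = t ^ (2 * i)" by (simp flip: powr_realpow)
    then show "?f t = t powr (2 * \<mu> + 2 * real i)"
      using t by (simp add: axis_weight_def powr_add)
  qed auto
  then have "((\<lambda>t. ?f (- t)) has_integral (1 / (2 * \<mu> + 2 * real i + 1))) {-1..-0}"
    by (subst has_integral_reflect_real)
  then have "(?f has_integral (1 / (2 * \<mu> + 2 * real i + 1))) {-1..0}"
    by simp
  then have "(?f has_integral (1 / (2 * \<mu> + 2 * real i + 1) + 1 / (2 * \<mu> + 2 * real i + 1))) {-1..1}"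
    using p by (rule has_integral_combine[rotated 2]) auto
  moreover have "1 / (2 * \<mu> + 2 * real i + 1) + 1 / (2 * \<mu> + 2 * real i + 1) = 1 / (\<mu> + real i + 1/2)"
    using \<mu> by (simp add: field_simps)
  ultimately have "(?f has_integral (1 / (\<mu> + real i + 1/2))) {-1..1}" by simp
  then show "(LBINT t:{-1..1}. ?f t) = 1 / (\<mu> + real i + 1/2)"
    using set_borel_integral_eq_integral(2)[OF int] by (simp add: integral_unique)
qed

text \<open>The substitution \<open>u = 1 - 2 t\<^sup>2\<close>, which turns \<open>t\<^sup>2\<close> into \<open>(1 - u) / 2\<close>.\<close>

lemma axis_weight_integral:
  assumes \<mu>: "\<mu> \<ge> 0"
  shows "(LBINT t:{-1..1}. poly Q (1 - 2 * t\<^sup>2) * axis_weight \<mu> t) =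
    jacobi_mean (\<mu> - 1/2) 0 Q / (\<mu> + 1/2)"
proof -
  let ?c = "\<lambda>i. coeff (pcompose Q [:1, -2:]) i"
  have ab: "\<mu> - 1/2 > -1" "(0::real) > -1" using \<mu> by auto
  have Q: "Q = (\<Sum>i\<le>degree Q. smult (?c i) ([:1/2, -1/2:] ^ i))"
    by (rule poly_expand_affine(2))
  \<comment> \<open>No change of variables is carried out. Both functionals are compared on the
    powers ((1 - u) / 2)^i, that is on t^(2 i), where the quotient of rising factorials
    telescopes.\<close>
  have m: "jacobi_mean (\<mu> - 1/2) 0 ([:1/2, -1/2:] ^ i) = (\<mu> + 1/2) / (\<mu> + real i + 1/2)" for i
  proof -
    have 1: "jacobi_mean (\<mu> - 1/2) 0 ([:1/2, -1/2:] ^ i) = pochhammer (\<mu> + 1/2) i / pochhammer (\<mu> + 1/2 + 1) i"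
      using jacobi_mean_moment[OF ab, of i 0] by (simp add: add_ac)
    have 2: "pochhammer (\<mu> + 1/2) i * (\<mu> + 1/2 + real i) = (\<mu> + 1/2) * pochhammer (\<mu> + 1/2 + 1) i"
      by (metis pochhammer_rec pochhammer_rec' mult.commute)
    have 3: "pochhammer (\<mu> + 1/2 + 1) i \<noteq> 0" "\<mu> + 1/2 + real i \<noteq> 0"
      using pochhammer_pos[of "\<mu> + 1/2 + 1" i] \<mu> by auto
    have "pochhammer (\<mu> + 1/2) i / pochhammer (\<mu> + 1/2 + 1) i = (\<mu> + 1/2) / (\<mu> + 1/2 + real i)"
      unfolding frac_eq_eq[OF 3] by (rule 2)
    moreover have "\<mu> + 1/2 + real i = \<mu> + real i + 1/2" by simp
    ultimately show ?thesis using 1 by (simp only:)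
  qed
  have "poly Q (1 - 2 * t\<^sup>2) = (\<Sum>i\<le>degree Q. ?c i * t ^ (2 * i))" for t
    by (subst Q) (simp add: poly_sum algebra_simps flip: power_mult)
  then have "(LBINT t:{-1..1}. poly Q (1 - 2 * t\<^sup>2) * axis_weight \<mu> t) =
      (LBINT t:{-1..1}. (\<Sum>i\<le>degree Q. ?c i * (t ^ (2 * i) * axis_weight \<mu> t)))"
    by (simp add: sum_distrib_right mult.assoc)
  also have "\<dots> = (\<Sum>i\<le>degree Q. LBINT t:{-1..1}. ?c i * (t ^ (2 * i) * axis_weight \<mu> t))"
    unfolding set_lebesgue_integral_def scaleR_sum_right
    by (rule Bochner_Integration.integral_sum)
       (use axis_weight_moment(1)[OF \<mu>] in \<open>auto simp: set_integrable_def mult.left_commute[of _ "?c _"]\<close>)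
  also have "\<dots> = (\<Sum>i\<le>degree Q. ?c i * (1 / (\<mu> + real i + 1/2)))"
    by (simp only: set_integral_mult_right axis_weight_moment(2)[OF \<mu>])
  also have "\<dots> = (\<Sum>i\<le>degree Q. ?c i * jacobi_mean (\<mu> - 1/2) 0 ([:1/2, -1/2:] ^ i)) / (\<mu> + 1/2)"
    unfolding m sum_divide_distrib using \<mu> by (intro sum.cong) auto
  also have "\<dots> = jacobi_mean (\<mu> - 1/2) 0 Q / (\<mu> + 1/2)"
    by (subst (2) Q) (simp only: jacobi_mean_sum[OF ab] jacobi_mean_smult[OF ab])
  finally show ?thesis .
qed

text \<open>The factor (1 + t)^j can be counted either to the weight or to the polynomial.\<close>

lemma jacobi_mean_shift:
  assumes "\<alpha> > -1" "jacobi_mean \<alpha> (real j) q = 0"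
  shows "jacobi_mean \<alpha> 0 ([:1/2, 1/2:] ^ j * q) = 0"
proof -
  have "poly ([:1/2, 1/2:] ^ j * q) t * jacobi_weight \<alpha> 0 t = (1/2) ^ j * (poly q t * jacobi_weight \<alpha> (real j) t)"
    if t: "t \<in> {-1..1}" for t
  proof (cases "t = -1")
    case False
    then have pos: "1 + t > 0" using t by auto
    have "poly ([:1/2, 1/2:] ^ j) t = (1/2 * (1 + t)) ^ j" by (simp add: field_simps)
    then show ?thesis
      using pos by (simp only: poly_mult power_mult_distrib) (simp add: jacobi_weight_def powr_realpow)
  qed (auto simp: jacobi_weight_def)
  then have "jacobi_int \<alpha> 0 ([:1/2, 1/2:] ^ j * q) = (LBINT t:{-1..1}. (1/2) ^ j * (poly q t * jacobi_weight \<alpha> (real j) t))"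
    unfolding jacobi_int_def by (intro set_lebesgue_integral_cong) auto
  also have "\<dots> = (1/2) ^ j * jacobi_int \<alpha> (real j) q"
    by (simp add: jacobi_int_def)
  also have "jacobi_int \<alpha> (real j) q = 0"
    using assms jacobi_int_1_pos[of \<alpha> "real j"] by (simp add: jacobi_mean_def)
  finally show ?thesis by (simp add: jacobi_mean_def)
qed

lemma integral_cis_0:
  fixes d :: int
  assumes "d \<noteq> 0"
  shows "((\<lambda>\<alpha>. Re (c * cis (of_int d * \<alpha>))) has_integral 0) {0..2 * pi}"
proof -
  let ?F = "\<lambda>\<alpha>. (Re c * sin (of_int d * \<alpha>) + Im c * cos (of_int d * \<alpha>)) / of_int d"
  have "((\<lambda>\<alpha>. Re (c * cis (of_int d * \<alpha>))) has_integral (?F (2 * pi) - ?F 0)) {0..2 * pi}"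
  proof (rule fundamental_theorem_of_calculus)
    fix \<alpha> :: real
    have "(?F has_real_derivative Re (c * cis (of_int d * \<alpha>))) (at \<alpha> within {0..2 * pi})"
      using assms by (auto intro!: derivative_eq_intros simp: field_simps)
    then show "(?F has_vector_derivative Re (c * cis (of_int d * \<alpha>))) (at \<alpha> within {0..2 * pi})"
      by (simp add: has_real_derivative_iff_has_vector_derivative)
  qed simp
  moreover have "of_int d * (2 * pi) = 2 * pi * of_int d" by simp
  then have "sin (of_int d * (2 * pi)) = 0" "cos (of_int d * (2 * pi)) = 1"
    by (simp_all only: sin_int_2pin cos_int_2pin)
  ultimately show ?thesis by simp
qed

text \<open>The product of powers of cosine and sine has only the frequencies a + b - 2 i with i
  \<le> a + b. None of them cancels j if j is too large or of the other parity, so every term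
  integrates to zero.\<close>

lemma angular_moment_0:
  assumes "a + b < j \<or> odd (a + b + j)"
  shows "(LBINT \<alpha>:{0..2 * pi}. Re (z * cis (real j * \<alpha>)) * (cos \<alpha> ^ a * sin \<alpha> ^ b)) = 0"
proof -
  define N where "N = a + b"
  obtain A where A: "\<And>\<phi>. complex_of_real (1 * (cos \<phi> ^ a * sin \<phi> ^ b)) = (\<Sum>i\<le>N. A i * cis ((real N - 2 * real i) * \<phi>))"
    using circle_form_expand[OF circle_form_cos_sin[of a b N 1]] N_def by blast
  let ?d = "\<lambda>i. int j + int N - 2 * int i"
  have "Re (z * cis (real j * \<alpha>)) * (cos \<alpha> ^ a * sin \<alpha> ^ b) =
      (\<Sum>i\<le>N. Re (z * A i * cis (of_int (?d i) * \<alpha>)))" for \<alpha>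
  proof -
    have "z * cis (real j * \<alpha>) * (\<Sum>i\<le>N. A i * cis ((real N - 2 * real i) * \<alpha>)) =
        (\<Sum>i\<le>N. z * A i * cis (of_int (?d i) * \<alpha>))"
      unfolding sum_distrib_left
    proof (rule sum.cong[OF refl])
      fix i
      have "real j * \<alpha> + (real N - 2 * real i) * \<alpha> = of_int (?d i) * \<alpha>" by (simp add: algebra_simps)
      then have "cis (real j * \<alpha>) * cis ((real N - 2 * real i) * \<alpha>) = cis (of_int (?d i) * \<alpha>)"
        by (simp only: cis_mult)
      then show "z * cis (real j * \<alpha>) * (A i * cis ((real N - 2 * real i) * \<alpha>)) = z * A i * cis (of_int (?d i) * \<alpha>)"
        by (metis mult.assoc mult.left_commute)
    qed
    moreover have re: "Re (w * complex_of_real r) = Re w * r" for w r by simp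
    have "Re (w * complex_of_real (1 * (cos \<alpha> ^ a * sin \<alpha> ^ b))) = Re w * (cos \<alpha> ^ a * sin \<alpha> ^ b)" for w
      by (simp only: mult_1_left re)
    ultimately show ?thesis by (metis A Re_sum)
  qed
  moreover have "?d i \<noteq> 0" if "i \<le> N" for i
  proof
    assume "?d i = 0"
    then have "j + N = 2 * i" by linarith
    with that assms show False by (auto simp: N_def add_ac dest: arg_cong[of _ _ even])
  qed
  then have "((\<lambda>\<alpha>. \<Sum>i\<le>N. Re (z * A i * cis (of_int (?d i) * \<alpha>))) has_integral (\<Sum>i\<le>N. 0)) {0..2 * pi}"
    by (intro has_integral_sum integral_cis_0) auto
  ultimately have hi: "((\<lambda>\<alpha>. Re (z * cis (real j * \<alpha>)) * (cos \<alpha> ^ a * sin \<alpha> ^ b)) has_integral 0) {0..2 * pi}"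
    by simp
  have "set_integrable lborel {0..2 * pi} (\<lambda>\<alpha>. Re (z * cis (real j * \<alpha>)) * (cos \<alpha> ^ a * sin \<alpha> ^ b))"
    by (rule borel_integrable_atLeastAtMost') (auto intro!: continuous_intros)
  from set_borel_integral_eq_integral(2)[OF this] hi show ?thesis
    by (simp add: integral_unique)
qed

lemma odd_integral_0:
  fixes f :: "real \<Rightarrow> real"
  assumes "\<And>t. f (- t) = - f t"
  shows "(LBINT t:{-c..c}. f t) = 0"
proof -
  have "(LBINT t:{-c..c}. f t) = (LBINT t:{-c..c}. f (- t))"
    unfolding set_lebesgue_integral_def
    by (subst lborel_integral_real_affine[where c = "-1" and t = 0])
       (auto simp: indicator_def intro!: Bochner_Integration.integral_cong)
  then show ?thesis unfolding set_lebesgue_integral_def by (simp add: assms)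
qed

text \<open>Around the third axis the inner product with a monomial is a product of two integrals.
  The angular one is zero unless a + b = j + 2 s, and the one over the height is zero by symmetry
  for odd m. In the remaining case m = 2 m', and the degree bound says s + m' < l, which is the
  range of Jacobi orthogonality.\<close>

lemma harmonic_disk_solid:
  assumes \<mu>: "\<mu> \<ge> 0" and k: "k = j + 2 * l"
  shows "harmonic_poly \<mu> k (disk_solid \<mu> l j \<xi>)"
proof (rule harmonic_polyI[OF \<mu>])
  show "disk_solid \<mu> l j \<xi> \<in> homogeneous_polys k"
    using disk_solid_homogeneous k by simp
  fix a b m assume abm: "a + b + m < k"
  let ?p = "jacobi_orthonormal (\<mu> - 1/2) (real j) l"
  define z where "z = cis (- (real j * \<xi>))"
  define F where "F = (\<lambda>t. poly ?p (1 - 2 * t\<^sup>2) * sqrt (1 - t\<^sup>2) ^ (j + a + b) * t ^ m * axis_weight \<mu> t)"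
  define G where "G = (\<lambda>\<alpha>. Re (z * cis (real j * \<alpha>)) * (cos \<alpha> ^ a * sin \<alpha> ^ b))"
  have "disk_solid \<mu> l j \<xi> (axis_point t \<alpha>) * monomial3 a b m (axis_point t \<alpha>) * sphere_weight \<mu> (axis_point t \<alpha>)
      = F t * G \<alpha>" if t: "t \<in> {-1..1}" for t \<alpha>
  proof -
    define w where "w = sqrt (1 - t\<^sup>2)"
    have S: "axis_point t \<alpha> \<in> sphere 0 1" using norm_axis_point[of t \<alpha>] t by (auto simp: abs_le_iff)
    have "t\<^sup>2 \<le> 1" using t by (simp add: abs_square_le_1 abs_le_iff)
    then have "w\<^sup>2 = 1 - t\<^sup>2" by (simp add: w_def)
    moreover have "(w * cos \<alpha>)\<^sup>2 + (w * sin \<alpha>)\<^sup>2 = w\<^sup>2 * ((sin \<alpha>)\<^sup>2 + (cos \<alpha>)\<^sup>2)"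
      by (simp only: power_mult_distrib distrib_left add.commute)
    ultimately have 1: "2 * ((w * cos \<alpha>)\<^sup>2 + (w * sin \<alpha>)\<^sup>2) - 1 = 1 - 2 * t\<^sup>2" by simp
    have "Complex (w * cos \<alpha>) (w * sin \<alpha>) = of_real w * cis \<alpha>" by (simp add: complex_eq_iff)
    then have 2: "Complex (w * cos \<alpha>) (w * sin \<alpha>) ^ j = of_real (w ^ j) * cis (real j * \<alpha>)"
      by (simp add: power_mult_distrib Complex.DeMoivre)
    have "Re (z * (of_real (w ^ j) * cis (real j * \<alpha>))) = w ^ j * Re (z * cis (real j * \<alpha>))"
      by (simp add: algebra_simps)
    then show ?thesis
      unfolding disk_solid_on_sphere[OF \<mu> S] axis_point_nth w_def[symmetric] 1 2 z_def[symmetric]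
      by (simp add: F_def G_def monomial3_def w_def[symmetric] axis_weight_def sphere_weight_def
          power_add power_mult_distrib mult_ac)
  qed
  note FG = this
  have "sphere_inner \<mu> (disk_solid \<mu> l j \<xi>) (monomial3 a b m) =
      (LBINT t:{-1..1}. LBINT \<alpha>:{0..2 * pi}. disk_solid \<mu> l j \<xi> (axis_point t \<alpha>) *
         monomial3 a b m (axis_point t \<alpha>) * sphere_weight \<mu> (axis_point t \<alpha>))"
    unfolding sphere_inner_def
    by (intro integral_sphere_axis_point sphere_L2_integrable continuous_in_sphere_L2 \<mu>
        continuous_intros continuous_homogeneous[OF disk_solid_homogeneous])
  also have "\<dots> = (LBINT t:{-1..1}. LBINT \<alpha>:{0..2 * pi}. F t * G \<alpha>)"
    by (intro set_lebesgue_integral_cong) (auto simp: FG)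
  also have "\<dots> = (LBINT t:{-1..1}. F t) * (LBINT \<alpha>:{0..2 * pi}. G \<alpha>)"
    by simp
  also have "\<dots> = 0"
  proof (cases "a + b < j \<or> odd (a + b + j)")
    case True
    then show ?thesis using angular_moment_0[OF True] by (simp add: G_def)
  next
    case False
    then obtain s where s: "a + b = j + 2 * s"
      by (metis add.commute dvd_def even_add le_Suc_ex linorder_not_le odd_even_add)
    show ?thesis
    proof (cases "even m")
      case False
      then have "(LBINT t:{-1..1}. F t) = 0"
        by (intro odd_integral_0) (simp add: F_def)
      then show ?thesis by simp
    next
      case True
      then obtain m' where m': "m = 2 * m'" by (auto elim: evenE)
      \<comment> \<open>At u = 1 - 2 t^2 the two linear factors are 1 - t^2 and t^2, so
        \<open>q\<close> together with the shift by j reproduces the powers of sqrt (1 - t^2) and of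
        t in \<open>F\<close>.\<close>
      define q :: "real poly" where "q = [:1/2, 1/2:] ^ s * [:1/2, -1/2:] ^ m'"
      have "degree q \<le> degree ([:1/2, 1/2:] ^ s :: real poly) + degree ([:1/2, -1/2:] ^ m' :: real poly)"
        unfolding q_def by (rule degree_mult_le)
      also have "\<dots> = s + m'" by (simp add: degree_power_eq)
      also have "\<dots> < l" using abm s m' k by simp
      finally have "degree q < l" .
      moreover have ab: "\<mu> - 1/2 > -1" "real j > -1" "\<mu> - 1/2 + real j > -1" using \<mu> by auto
      ultimately have "jacobi_mean (\<mu> - 1/2) (real j) (?p * q) = 0"
        by (simp add: jacobi_orthonormal_eq[OF ab] jacobi_mean_smult[OF ab(1,2)] jacobi_mean_base_lower[OF ab])
      then have "jacobi_mean (\<mu> - 1/2) 0 ([:1/2, 1/2:] ^ j * (?p * q)) = 0"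
        using ab by (intro jacobi_mean_shift) auto
      then have "(LBINT t:{-1..1}. poly ([:1/2, 1/2:] ^ j * (?p * q)) (1 - 2 * t\<^sup>2) * axis_weight \<mu> t) = 0"
        by (simp add: axis_weight_integral[OF \<mu>] del: poly_mult)
      moreover have "poly ([:1/2, 1/2:] ^ j * (?p * q)) (1 - 2 * t\<^sup>2) * axis_weight \<mu> t = F t" if t: "t \<in> {-1..1}" for t
      proof -
        have "1/2 + (1 - 2 * t\<^sup>2) * (1/2) = 1 - t\<^sup>2" "1/2 + (1 - 2 * t\<^sup>2) * (-1/2) = t\<^sup>2"
          by (simp_all add: field_simps)
        then have e: "poly [:1/2, 1/2:] (1 - 2 * t\<^sup>2) = 1 - t\<^sup>2" "poly [:1/2, -1/2:] (1 - 2 * t\<^sup>2) = t\<^sup>2"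
          by simp_all
        have "t\<^sup>2 \<le> 1" using t by (simp add: abs_square_le_1 abs_le_iff)
        then have sq: "(sqrt (1 - t\<^sup>2))\<^sup>2 = 1 - t\<^sup>2" by simp
        have "sqrt (1 - t\<^sup>2) ^ (j + a + b) = ((sqrt (1 - t\<^sup>2))\<^sup>2) ^ (j + s)"
          unfolding power_mult[symmetric] using s by (intro arg_cong[where f = "power _"]) simp
        then show ?thesis
          unfolding F_def sq q_def poly_mult poly_power e m' power_mult by (simp add: power_add)
      qed
      ultimately have "(LBINT t:{-1..1}. F t) = 0"
        by (subst (asm) set_lebesgue_integral_cong[where g = F]) auto
      then show ?thesis by simp
    qed
  qed
  finally show "sphere_inner \<mu> (disk_solid \<mu> l j \<xi>) (monomial3 a b m) = 0" .
qed

definition kernel_poly :: "real \<Rightarrow> nat \<Rightarrow> real \<Rightarrow> real^3 \<Rightarrow> real" where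
  "kernel_poly \<mu> k \<xi> x = (\<Sum>l\<le>k div 2. (if 2 * l = k then 1 else 2) /
      poly (jacobi_orthonormal (\<mu> - 1/2) (real (k - 2 * l)) l) 1 * disk_solid \<mu> l (k - 2 * l) \<xi> x)"

lemma harmonic_kernel_poly:
  assumes \<mu>: "\<mu> \<ge> 0"
  shows "harmonic_poly \<mu> k (kernel_poly \<mu> k \<xi>)"
  unfolding kernel_poly_def[abs_def] by (intro harmonic_poly_sum harmonic_disk_solid \<mu>) auto

lemma kernel_poly_on_sphere:
  assumes "\<mu> \<ge> 0" "x \<in> sphere 0 1"
  shows "kernel_poly \<mu> k \<xi> x = angular_kernel \<mu> k \<xi> (x$1) (x$2)"
  by (simp add: kernel_poly_def disk_solid_on_sphere[OF assms] angular_kernel_eq[OF assms(1)])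

lemma kernel_poly_even: "kernel_poly \<mu> k \<xi> (vector [x$1, x$2, - x$3]) = kernel_poly \<mu> k \<xi> x"
  by (simp add: kernel_poly_def disk_solid_def)

lemma kernel_poly_boundary:
  assumes "\<mu> \<ge> 0"
  shows "kernel_poly \<mu> k \<xi> (vector [cos \<phi>, sin \<phi>, 0]) =
    Re (\<Sum>m\<le>k. cis ((real k - 2 * real m) * (\<phi> - \<xi>)))"
proof -
  have "(vector [cos \<phi>, sin \<phi>, 0] :: real^3) \<in> sphere 0 1"
    by (simp add: norm_vec3)
  then show ?thesis
    by (simp only: kernel_poly_on_sphere[OF assms] angular_kernel_boundary[OF assms] cis_sum_pairing
        Re_complex_of_real vector_3)
qed

section \<open>Ridge polynomials and the Funk-Hecke formula\<close>

abbreviation (input) equator :: "real \<Rightarrow> real^3" where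
  "equator \<theta> \<equiv> vector [cos \<theta>, sin \<theta>, 0]"

lemma homogeneous_linear_subst:
  assumes "p \<in> homogeneous_polys k" "a \<in> homogeneous_polys 1" "b \<in> homogeneous_polys 1" "c \<in> homogeneous_polys 1"
  shows "(\<lambda>x. p (vector [a x, b x, c x])) \<in> homogeneous_polys k"
proof -
  obtain d where d: "p = (\<lambda>x. \<Sum>e\<in>{(i, j, m). i + j + m = k}. d e * monomial3 (fst e) (fst (snd e)) (snd (snd e)) x)"
    using homogeneousE[OF assms(1)] by blast
  show ?thesis unfolding d
  proof (rule homogeneous_sum)
    fix e assume e: "e \<in> {(i, j, m). i + j + m = k}"
    have "(\<lambda>x. a x ^ fst e * b x ^ fst (snd e) * c x ^ snd (snd e))
        \<in> homogeneous_polys (fst e * 1 + fst (snd e) * 1 + snd (snd e) * 1)"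
      by (intro homogeneous_mult homogeneous_power assms)
    moreover have "fst e * 1 + fst (snd e) * 1 + snd (snd e) * 1 = k" using e by auto
    ultimately show "(\<lambda>x. d e * monomial3 (fst e) (fst (snd e)) (snd (snd e)) (vector [a x, b x, c x]))
        \<in> homogeneous_polys k"
      by (simp only: monomial3_def vector_3) (rule homogeneous_scale)
  qed
qed

lemma LBINT_cong_Ioo:
  fixes f g :: "real \<Rightarrow> real"
  assumes "\<And>t. a < t \<Longrightarrow> t < b \<Longrightarrow> f t = g t"
  shows "(LBINT t:{a..b}. f t) = (LBINT t:{a..b}. g t)"
  unfolding set_lebesgue_integral_def
  by (rule integral_discrete_difference[where X = "{a, b}"]) (auto simp: indicator_def assms)

lemma antiperiodic_integral_0:
  fixes h :: "real \<Rightarrow> real"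
  assumes [measurable]: "h \<in> borel_measurable borel" and B: "\<And>\<alpha>. \<bar>h \<alpha>\<bar> \<le> B"
    and anti: "\<And>\<alpha>. h (\<alpha> + pi) = - h \<alpha>"
  shows "(LBINT \<alpha>:{0..2 * pi}. h \<alpha>) = 0"
proof -
  have int: "integrable lborel (\<lambda>\<alpha>. indicator {a..b} \<alpha> *\<^sub>R h \<alpha>)" for a b
    using set_integrable_bounded_Icc[of h a b B] B by (simp add: set_integrable_def)
  have "(LBINT \<alpha>:{0..2 * pi}. h \<alpha>) =
      (LBINT \<alpha>. indicator {0..pi} \<alpha> *\<^sub>R h \<alpha> + indicator {pi..2 * pi} \<alpha> *\<^sub>R h \<alpha>)"
    unfolding set_lebesgue_integral_def
    by (rule integral_discrete_difference[where X = "{pi}"]) (auto simp: indicator_def)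
  also have "\<dots> = (LBINT \<alpha>:{0..pi}. h \<alpha>) + (LBINT \<alpha>:{pi..2 * pi}. h \<alpha>)"
    unfolding set_lebesgue_integral_def by (rule Bochner_Integration.integral_add[OF int int])
  also have "(LBINT \<alpha>:{pi..2 * pi}. h \<alpha>) = (LBINT \<alpha>:{0..pi}. h (\<alpha> + pi))"
    unfolding set_lebesgue_integral_def
    by (subst lborel_integral_real_affine[where c = 1 and t = pi])
       (auto simp: indicator_def add.commute intro!: Bochner_Integration.integral_cong)
  also have "\<dots> = - (LBINT \<alpha>:{0..pi}. h \<alpha>)"
    unfolding set_lebesgue_integral_def by (simp add: anti)
  finally show ?thesis by simp
qed

lemma circle_point_equator:
  "circle_point (equator \<theta>) t \<alpha> $ 1 = t * cos \<theta> - sqrt (1 - t\<^sup>2) * cos \<alpha> * sin \<theta>"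
  "circle_point (equator \<theta>) t \<alpha> $ 2 = t * sin \<theta> + sqrt (1 - t\<^sup>2) * cos \<alpha> * cos \<theta>"
  "circle_point (equator \<theta>) t \<alpha> $ 3 = sqrt (1 - t\<^sup>2) * sin \<alpha>"
  by (simp_all add: circle_point_def)

lemma circle_point_height:
  "circle_point (equator \<theta>) t \<alpha> $ 1 * cos \<theta> + circle_point (equator \<theta>) t \<alpha> $ 2 * sin \<theta> = t"
proof -
  have "circle_point (equator \<theta>) t \<alpha> $ 1 * cos \<theta> + circle_point (equator \<theta>) t \<alpha> $ 2 * sin \<theta>
      = t * ((sin \<theta>)\<^sup>2 + (cos \<theta>)\<^sup>2)"
    unfolding circle_point_equator by algebra
  then show ?thesis by simp
qed

context
  fixes \<mu> :: real
  assumes \<mu>: "\<mu> \<ge> 0"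
begin

lemma axis_weight_sin:
  "(\<lambda>\<alpha>. axis_weight \<mu> (sin \<alpha>)) \<in> borel_measurable borel"
  "0 \<le> axis_weight \<mu> (sin \<alpha>)" "axis_weight \<mu> (sin \<alpha>) \<le> 1"
proof -
  have [measurable]: "(sin :: real \<Rightarrow> real) \<in> borel_measurable borel"
    by (intro borel_measurable_continuous_onI continuous_intros)
  show "(\<lambda>\<alpha>. axis_weight \<mu> (sin \<alpha>)) \<in> borel_measurable borel" by measurable
qed (auto intro!: axis_weight_bounds \<mu>)

text \<open>The separation holds because x_3 = sqrt (1 - t^2) sin \<alpha>. At the end points it
  fails for \<mu> = 0, where \<open>jacobi_weight\<close> contains \<open>0 powr 0 = 0\<close>,
  hence \<open>LBINT_cong_Ioo\<close>.\<close>

lemma sphere_weight_circle_point: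
  assumes "-1 < t" "t < 1"
  shows "sphere_weight \<mu> (circle_point (equator \<theta>) t \<alpha>) = axis_weight \<mu> (sin \<alpha>) * jacobi_weight \<mu> \<mu> t"
proof -
  have pos: "1 - t\<^sup>2 > 0" using assms by (simp add: abs_square_less_1 abs_less_iff)
  have "1 - t\<^sup>2 = (1 - t) * (1 + t)" by (simp add: power2_eq_square algebra_simps)
  then have jw: "jacobi_weight \<mu> \<mu> t = (1 - t\<^sup>2) powr \<mu>"
    using assms by (simp add: jacobi_weight_def powr_mult)
  have "sqrt (1 - t\<^sup>2) powr (2 * \<mu>) = (1 - t\<^sup>2) powr \<mu>"
    using pos by (simp add: powr_half_sqrt[symmetric] powr_powr)
  then show ?thesis
    using pos by (simp add: sphere_weight_def axis_weight_def circle_point_equator jw abs_mult powr_mult)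
qed

text \<open>Writing \<open>p\<close> in the coordinates \<open>(t, w cos \<alpha>, w sin \<alpha>)\<close> with \<open>w\<^sup>2 = 1 - t\<^sup>2\<close>, the odd powers of
  \<open>w\<close> are antiperiodic in \<open>\<alpha>\<close> and integrate to zero.\<close>

lemma circle_integral_poly:
  assumes p: "p \<in> homogeneous_polys d"
  obtains P :: "real poly" where "degree P \<le> d"
    "\<And>t. t \<in> {-1..1} \<Longrightarrow>
      (LBINT \<alpha>:{0..2 * pi}. p (circle_point (equator \<theta>) t \<alpha>) * axis_weight \<mu> (sin \<alpha>)) = poly P t"
proof -
  \<comment> \<open>\<open>p\<close> in the orthonormal frame formed by \<zeta>, the tangent of the
    equator at \<zeta> and the third axis.\<close>
  define p' where "p' = (\<lambda>x::real^3. p (vector [x$1 * cos \<theta> - x$2 * sin \<theta>, x$1 * sin \<theta> + x$2 * cos \<theta>, x$3]))"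
  have lin: "(\<lambda>x. a * x$1 + b * x$2) \<in> homogeneous_polys 1" for a b
    by (intro homogeneous_add homogeneous_scale homogeneous_coord)
  have "(\<lambda>x. p (vector [cos \<theta> * x$1 + (- sin \<theta>) * x$2, sin \<theta> * x$1 + cos \<theta> * x$2, x$3])) \<in> homogeneous_polys d"
    by (rule homogeneous_linear_subst[OF p lin lin homogeneous_coord])
  then have "p' \<in> homogeneous_polys d" by (simp add: p'_def mult.commute)
  then obtain c where c: "p' = (\<lambda>x. \<Sum>e\<in>{(i, j, m). i + j + m = d}. c e * monomial3 (fst e) (fst (snd e)) (snd (snd e)) x)"
    using homogeneousE by blast
  define I where "I = (\<lambda>j m. LBINT \<alpha>:{0..2 * pi}. cos \<alpha> ^ j * sin \<alpha> ^ m * axis_weight \<mu> (sin \<alpha>))"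
  have meas: "(\<lambda>\<alpha>. cos \<alpha> ^ j * sin \<alpha> ^ m * axis_weight \<mu> (sin \<alpha>)) \<in> borel_measurable borel" for j m
    using axis_weight_sin(1)
    by (intro borel_measurable_times) (auto intro!: borel_measurable_continuous_onI continuous_intros)
  have bound: "\<bar>cos \<alpha> ^ j * sin \<alpha> ^ m * axis_weight \<mu> (sin \<alpha>)\<bar> \<le> 1 * 1 * 1" for j m \<alpha>
    unfolding abs_mult using axis_weight_sin(2,3)[of \<alpha>]
    by (intro mult_mono) (auto simp: power_abs intro!: power_le_one)
  have I0: "I j m = 0" if "odd (j + m)" for j m
    unfolding I_def
  proof (rule antiperiodic_integral_0[OF meas bound])
    fix \<alpha> :: real
    have "cos (\<alpha> + pi) ^ j * sin (\<alpha> + pi) ^ m = (-1) ^ (j + m) * (cos \<alpha> ^ j * sin \<alpha> ^ m)"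
      unfolding sin_periodic_pi cos_periodic_pi by (simp add: power_minus[of "cos \<alpha>"] power_minus[of "sin \<alpha>"] power_add)
    then show "cos (\<alpha> + pi) ^ j * sin (\<alpha> + pi) ^ m * axis_weight \<mu> (sin (\<alpha> + pi)) =
        - (cos \<alpha> ^ j * sin \<alpha> ^ m * axis_weight \<mu> (sin \<alpha>))"
      using that by simp
  qed
  \<comment> \<open>For even j + m the power w^(j + m) is a power of 1 - t^2. For odd j + m the
    factor \<open>I\<close> is 0, so the rounding in \<open>div 2\<close> does no harm.\<close>
  define P where "P = (\<Sum>e\<in>{(i, j, m). i + j + m = d}.
    smult (c e * I (fst (snd e)) (snd (snd e))) (monom 1 (fst e) * [:1, 0, -1:] ^ ((fst (snd e) + snd (snd e)) div 2)))"
  have "degree P \<le> d"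
    unfolding P_def
  proof (rule degree_sum_le[OF finite_exponents(1)])
    fix e assume e: "e \<in> {(i, j, m). i + j + m = d}"
    let ?h = "(fst (snd e) + snd (snd e)) div 2"
    have "degree (monom 1 (fst e) * [:1, 0, -1:] ^ ?h :: real poly) \<le> degree (monom 1 (fst e) :: real poly) + degree ([:1, 0, -1:] ^ ?h :: real poly)"
      by (rule degree_mult_le)
    also have "\<dots> \<le> fst e + 2 * ?h"
      using degree_power_le[of "[:1, 0, -1:] :: real poly" ?h] by (simp add: degree_monom_eq)
    also have "\<dots> \<le> d" using e by auto
    finally show "degree (smult (c e * I (fst (snd e)) (snd (snd e))) (monom 1 (fst e) * [:1, 0, -1:] ^ ?h)) \<le> d"
      using degree_smult_le order_trans by blast
  qed
  moreover have "(LBINT \<alpha>:{0..2 * pi}. p (circle_point (equator \<theta>) t \<alpha>) * axis_weight \<mu> (sin \<alpha>)) = poly P t"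
    if t: "t \<in> {-1..1}" for t
  proof -
    define w where "w = sqrt (1 - t\<^sup>2)"
    have "t\<^sup>2 \<le> 1" using t by (simp add: abs_square_le_1 abs_le_iff)
    then have w2: "w\<^sup>2 = 1 - t\<^sup>2" by (simp add: w_def)
    have pe: "p (circle_point (equator \<theta>) t \<alpha>) = p' (vector [t, w * cos \<alpha>, w * sin \<alpha>])" for \<alpha>
      by (simp add: p'_def w_def circle_point_def)
    have eq: "p (circle_point (equator \<theta>) t \<alpha>) * axis_weight \<mu> (sin \<alpha>) =
        (\<Sum>e\<in>{(i, j, m). i + j + m = d}. c e * (t ^ fst e * w ^ (fst (snd e) + snd (snd e))) *
          (cos \<alpha> ^ fst (snd e) * sin \<alpha> ^ snd (snd e) * axis_weight \<mu> (sin \<alpha>)))" for \<alpha>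
      unfolding pe unfolding c sum_distrib_right
      by (intro sum.cong) (auto simp: monomial3_def power_mult_distrib power_add)
    have "(LBINT \<alpha>:{0..2 * pi}. p (circle_point (equator \<theta>) t \<alpha>) * axis_weight \<mu> (sin \<alpha>)) =
        (\<Sum>e\<in>{(i, j, m). i + j + m = d}. LBINT \<alpha>:{0..2 * pi}. c e * (t ^ fst e * w ^ (fst (snd e) + snd (snd e))) *
          (cos \<alpha> ^ fst (snd e) * sin \<alpha> ^ snd (snd e) * axis_weight \<mu> (sin \<alpha>)))"
      unfolding eq set_lebesgue_integral_def scaleR_sum_right
    proof (rule Bochner_Integration.integral_sum)
      fix e :: "nat \<times> nat \<times> nat"
      have "set_integrable lborel {0..2 * pi} (\<lambda>\<alpha>. cos \<alpha> ^ fst (snd e) * sin \<alpha> ^ snd (snd e) * axis_weight \<mu> (sin \<alpha>))"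
        by (rule set_integrable_bounded_Icc[OF meas bound])
      then have "set_integrable lborel {0..2 * pi} (\<lambda>\<alpha>. c e * (t ^ fst e * w ^ (fst (snd e) + snd (snd e))) *
          (cos \<alpha> ^ fst (snd e) * sin \<alpha> ^ snd (snd e) * axis_weight \<mu> (sin \<alpha>)))"
        by (intro set_integrable_mult_right) auto
      then show "integrable lborel (\<lambda>\<alpha>. indicator {0..2 * pi} \<alpha> *\<^sub>R (c e * (t ^ fst e * w ^ (fst (snd e) + snd (snd e))) *
          (cos \<alpha> ^ fst (snd e) * sin \<alpha> ^ snd (snd e) * axis_weight \<mu> (sin \<alpha>))))"
        by (simp add: set_integrable_def)
    qed
    also have "\<dots> = (\<Sum>e\<in>{(i, j, m). i + j + m = d}. c e * (t ^ fst e * w ^ (fst (snd e) + snd (snd e))) *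
        I (fst (snd e)) (snd (snd e)))"
      by (simp only: set_integral_mult_right I_def)
    also have "\<dots> = poly P t"
      unfolding P_def poly_sum
    proof (rule sum.cong[OF refl])
      fix e :: "nat \<times> nat \<times> nat"
      let ?N = "fst (snd e) + snd (snd e)"
      show "c e * (t ^ fst e * w ^ ?N) * I (fst (snd e)) (snd (snd e)) =
        poly (smult (c e * I (fst (snd e)) (snd (snd e))) (monom 1 (fst e) * [:1, 0, -1:] ^ (?N div 2))) t"
      proof (cases "even ?N")
        case True
        then have "w ^ ?N = (1 - t\<^sup>2) ^ (?N div 2)"
          unfolding w2[symmetric] by (simp flip: power_mult)
        then show ?thesis by (simp add: poly_monom power2_eq_square)
      qed (simp add: I0)
    qed
    finally show ?thesis .
  qed
  ultimately show ?thesis by (rule that)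
qed

definition sin_weight_integral :: real where
  "sin_weight_integral = (LBINT \<alpha>:{0..2 * pi}. axis_weight \<mu> (sin \<alpha>))"

lemma continuous_ridge: "continuous_on A (\<lambda>x::real^3. poly r (x$1 * cos \<theta> + x$2 * sin \<theta>))"
  by (intro continuous_intros)

text \<open>A ridge function is constant on each circle, so only the circle means of
  \<open>p\<close> matter, and these form one polynomial \<open>P\<close> for all \<open>r\<close>.
  At t = 1 the circle shrinks to \<zeta>, which yields the value \<open>P\<close> takes
  there.\<close>

lemma sphere_inner_ridge:
  assumes p: "p \<in> homogeneous_polys d"
  shows "\<exists>P :: real poly. degree P \<le> d \<and> poly P 1 = sin_weight_integral * p (equator \<theta>) \<and>
    (\<forall>r. sphere_inner \<mu> (\<lambda>x. poly r (x$1 * cos \<theta> + x$2 * sin \<theta>)) p = jacobi_int \<mu> \<mu> (r * P))"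
proof -
  obtain P :: "real poly" where P: "degree P \<le> d"
    "\<And>t. t \<in> {-1..1} \<Longrightarrow>
      (LBINT \<alpha>:{0..2 * pi}. p (circle_point (equator \<theta>) t \<alpha>) * axis_weight \<mu> (sin \<alpha>)) = poly P t"
    using circle_integral_poly[OF p] by metis
  have "circle_point (equator \<theta>) 1 \<alpha> = equator \<theta>" for \<alpha>
    by (simp add: circle_point_def)
  then have P1: "poly P 1 = sin_weight_integral * p (equator \<theta>)"
    using P(2)[of 1] by (simp add: sin_weight_integral_def mult.commute)
  have "sphere_inner \<mu> (\<lambda>x. poly r (x$1 * cos \<theta> + x$2 * sin \<theta>)) p = jacobi_int \<mu> \<mu> (r * P)" for r
  proof -
    have "sphere_inner \<mu> (\<lambda>x. poly r (x$1 * cos \<theta> + x$2 * sin \<theta>)) p =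
        (LBINT t:{-1..1}. LBINT \<alpha>:{0..2 * pi}. poly r t * p (circle_point (equator \<theta>) t \<alpha>) *
           sphere_weight \<mu> (circle_point (equator \<theta>) t \<alpha>))"
    proof -
      have int: "integrable sphere_measure
          (\<lambda>x. poly r (x$1 * cos \<theta> + x$2 * sin \<theta>) * p x * sphere_weight \<mu> x)"
        by (intro sphere_L2_integrable[OF \<mu>] continuous_in_sphere_L2[OF \<mu>] continuous_ridge continuous_homogeneous[OF p])
      show ?thesis
        unfolding sphere_inner_def
        by (simp only: integral_sphere_circle_point[OF int, of \<theta>] circle_point_height)
    qed
    also have "\<dots> = (LBINT t:{-1..1}. poly (r * P) t * jacobi_weight \<mu> \<mu> t)"
    proof (rule LBINT_cong_Ioo)
      fix t :: real assume t: "-1 < t" "t < 1"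
      have "(LBINT \<alpha>:{0..2 * pi}. poly r t * p (circle_point (equator \<theta>) t \<alpha>) *
           sphere_weight \<mu> (circle_point (equator \<theta>) t \<alpha>)) =
         (LBINT \<alpha>:{0..2 * pi}. (poly r t * jacobi_weight \<mu> \<mu> t) *
           (p (circle_point (equator \<theta>) t \<alpha>) * axis_weight \<mu> (sin \<alpha>)))"
        unfolding sphere_weight_circle_point[OF t] by (simp only: mult_ac)
      also have "\<dots> = (poly r t * jacobi_weight \<mu> \<mu> t) * poly P t"
        using t by (simp only: set_integral_mult_right) (simp add: P(2))
      finally show "(LBINT \<alpha>:{0..2 * pi}. poly r t * p (circle_point (equator \<theta>) t \<alpha>) *
           sphere_weight \<mu> (circle_point (equator \<theta>) t \<alpha>)) = poly (r * P) t * jacobi_weight \<mu> \<mu> t"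
        by simp
    qed
    finally show ?thesis by (simp add: jacobi_int_def)
  qed
  with P(1) P1 show ?thesis by blast
qed

text \<open>The total weight of the sphere, computed around an equatorial direction and around the
  third axis. The second way gives 2 \<pi> / (\<mu> + 1/2), so neither factor has to be evaluated
  alone.\<close>

lemma sin_weight_normalization:
  "disk_const \<mu> / 2 * (sin_weight_integral * jacobi_int \<mu> \<mu> 1) = 1"
proof -
  have W: "sphere_inner \<mu> (\<lambda>x. 1) (\<lambda>x. 1) = (LINT x|sphere_measure. sphere_weight \<mu> x)"
    by (simp add: sphere_inner_def)
  also have "\<dots> = (LBINT t:{-1..1}. LBINT \<alpha>:{0..2 * pi}. sphere_weight \<mu> (circle_point (equator 0) t \<alpha>))"
    by (rule integral_sphere_circle_point[OF sphere_weight_integrable[OF \<mu>]])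
  also have "\<dots> = (LBINT t:{-1..1}. sin_weight_integral * (poly 1 t * jacobi_weight \<mu> \<mu> t))"
    by (rule LBINT_cong_Ioo)
       (simp only: sphere_weight_circle_point set_integral_mult_left sin_weight_integral_def poly_1 mult_1_left)
  also have "\<dots> = sin_weight_integral * jacobi_int \<mu> \<mu> 1"
    unfolding jacobi_int_def by (rule set_integral_mult_right)
  finally have 1: "sphere_inner \<mu> (\<lambda>x. 1) (\<lambda>x. 1) = sin_weight_integral * jacobi_int \<mu> \<mu> 1" .
  have "sphere_inner \<mu> (\<lambda>x. 1) (\<lambda>x. 1) = (LBINT t:{-1..1}. LBINT \<alpha>:{0..2 * pi}. axis_weight \<mu> t)"
  proof -
    have "sphere_weight \<mu> (axis_point t \<alpha>) = axis_weight \<mu> t" for t \<alpha>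
      by (auto simp: sphere_weight_def axis_weight_def)
    then show ?thesis
      by (simp only: W integral_sphere_axis_point[OF sphere_weight_integrable[OF \<mu>]])
  qed
  also have "\<dots> = (LBINT t:{-1..1}. 2 * pi * axis_weight \<mu> t)"
    by (simp add: set_lebesgue_integral_def)
  also have "\<dots> = 2 * pi * (1 / (\<mu> + 1/2))"
    using axis_weight_moment(2)[OF \<mu>, of 0] by simp
  finally show ?thesis using 1 \<mu> by (simp add: disk_const_def)
qed

text \<open>The Funk-Hecke formula: for harmonic \<open>q\<close> the polynomial of \<open>circle_integral_poly\<close> is a
  multiple of the Gegenbauer polynomial, because it is orthogonal to lower degrees.\<close>

lemma sphere_inner_gegenbauer:
  assumes q: "harmonic_poly \<mu> k q"
  shows "disk_const \<mu> / 2 * ((real k + \<mu> + 1/2) / (\<mu> + 1/2)) *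
    sphere_inner \<mu> (\<lambda>x. poly (gegenbauer (\<mu> + 1/2) k) (x$1 * cos \<theta> + x$2 * sin \<theta>)) q = q (equator \<theta>)"
proof -
  let ?a = "\<mu> + 1/2" and ?C = "gegenbauer (\<mu> + 1/2) k"
  have a: "?a > 0" "?a - 1/2 = \<mu>" and m: "\<mu> > -1" using \<mu> by auto
  have qh: "q \<in> homogeneous_polys k" using q by (simp add: harmonic_poly_def)
  obtain P :: "real poly" where P: "degree P \<le> k" "poly P 1 = sin_weight_integral * q (equator \<theta>)"
    "\<And>r. sphere_inner \<mu> (\<lambda>x. poly r (x$1 * cos \<theta> + x$2 * sin \<theta>)) q = jacobi_int \<mu> \<mu> (r * P)"
    using sphere_inner_ridge[OF qh, of \<theta>] by blast
  have "jacobi_mean \<mu> \<mu> (P * r) = 0" if "degree r < k" for r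
  proof -
    have lin: "(\<lambda>x. x$1 * cos \<theta> + x$2 * sin \<theta>) \<in> homogeneous_polys 1"
      using homogeneous_add[OF homogeneous_scale[OF homogeneous_coord, of "cos \<theta>" 1]
          homogeneous_scale[OF homogeneous_coord, of "sin \<theta>" 2]] by (simp add: mult.commute)
    have "sphere_inner \<mu> q (\<lambda>x. poly r (x$1 * cos \<theta> + x$2 * sin \<theta>)) =
        sphere_inner \<mu> q (\<lambda>x. \<Sum>i\<le>degree r. coeff r i * (x$1 * cos \<theta> + x$2 * sin \<theta>) ^ i)"
      by (simp add: poly_altdef)
    also have "\<dots> = (\<Sum>i\<le>degree r. sphere_inner \<mu> q (\<lambda>x. coeff r i * (x$1 * cos \<theta> + x$2 * sin \<theta>) ^ i))"
      by (intro sphere_inner_sum_right[OF \<mu> continuous_in_sphere_L2[OF \<mu> harmonic_poly_continuous[OF q]]] continuous_intros)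
    also have "\<dots> = 0"
    proof (rule sum.neutral, rule ballI)
      fix i assume "i \<in> {..degree r}"
      then have i: "i < k" using that by simp
      have "(\<lambda>x. (x$1 * cos \<theta> + x$2 * sin \<theta>) ^ i) \<in> homogeneous_polys i"
        using homogeneous_power[OF lin, of i] by simp
      from harmonic_poly_orth[OF q this i]
      show "sphere_inner \<mu> q (\<lambda>x. coeff r i * (x$1 * cos \<theta> + x$2 * sin \<theta>) ^ i) = 0"
        by (simp add: sphere_inner_scale_right)
    qed
    finally have "jacobi_int \<mu> \<mu> (r * P) = 0" using P(3)[of r] by (simp add: sphere_inner_commute)
    then show ?thesis by (simp add: jacobi_mean_def mult.commute)
  qed
  then have "P = smult (poly P 1 / poly ?C 1) ?C"
    using gegenbauer_unique[OF a(1) P(1)] a(2) by simp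
  then have CP: "?C * P = smult (poly P 1 / poly ?C 1) (?C * ?C)"
    by (metis mult_smult_right)
  have "sphere_inner \<mu> (\<lambda>x. poly ?C (x$1 * cos \<theta> + x$2 * sin \<theta>)) q = jacobi_int \<mu> \<mu> (?C * P)"
    by (rule P(3))
  also have "\<dots> = jacobi_mean \<mu> \<mu> (?C * P) * jacobi_int \<mu> \<mu> 1"
    using jacobi_int_1_pos[OF m m] by (simp add: jacobi_mean_def)
  also have "\<dots> = poly P 1 / poly ?C 1 * jacobi_mean \<mu> \<mu> (?C * ?C) * jacobi_int \<mu> \<mu> 1"
    unfolding CP jacobi_mean_smult[OF m m] ..
  \<comment> \<open>The constants regroup into two factors that equal 1, by
    \<open>sin_weight_normalization\<close> and by \<open>gegenbauer_norm\<close>.\<close>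
  finally have "disk_const \<mu> / 2 * ((real k + ?a) / ?a) *
      sphere_inner \<mu> (\<lambda>x. poly ?C (x$1 * cos \<theta> + x$2 * sin \<theta>)) q =
      (disk_const \<mu> / 2 * (sin_weight_integral * jacobi_int \<mu> \<mu> 1)) * q (equator \<theta>) *
      (((real k + ?a) / ?a * jacobi_mean \<mu> \<mu> (?C * ?C)) / poly ?C 1)"
    unfolding P(2) by (simp only: mult_ac times_divide_eq_right times_divide_eq_left)
  also have "\<dots> = q (equator \<theta>)"
    using gegenbauer_norm[OF a(1), of k] gegenbauer_at_1_pos[OF a(1), of k] sin_weight_normalization
    by (simp only: a(2)) simp
  finally show ?thesis by (simp add: add.assoc)
qed

text \<open>The function R of the overview as a homogeneous polynomial. Only exponents of the parity
  of k are kept, so the missing degree is even and powers of the squared norm can fill it.\<close>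

definition ridge_poly :: "nat \<Rightarrow> real \<Rightarrow> real^3 \<Rightarrow> real" where
  "ridge_poly k \<theta> x = disk_const \<mu> / 2 * ((real k + \<mu> + 1/2) / (\<mu> + 1/2)) *
     (\<Sum>i\<in>{i. i \<le> k \<and> even (k - i)}. coeff (gegenbauer (\<mu> + 1/2) k) i *
        ((x$1 * cos \<theta> + x$2 * sin \<theta>) ^ i * ((x$1)\<^sup>2 + (x$2)\<^sup>2 + (x$3)\<^sup>2) ^ ((k - i) div 2)))"

lemma ridge_poly_even: "ridge_poly k \<theta> (vector [x$1, x$2, - x$3]) = ridge_poly k \<theta> x"
  by (simp add: ridge_poly_def)

lemma ridge_poly_homogeneous: "ridge_poly k \<theta> \<in> homogeneous_polys k"
  unfolding ridge_poly_def[abs_def]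
proof (intro homogeneous_scale homogeneous_sum)
  fix i assume "i \<in> {i. i \<le> k \<and> even (k - i)}"
  then have i: "i * 1 + (k - i) div 2 * 2 = k" by auto
  have lin: "(\<lambda>x. x$1 * cos \<theta> + x$2 * sin \<theta>) \<in> homogeneous_polys 1"
    using homogeneous_add[OF homogeneous_scale[OF homogeneous_coord, of "cos \<theta>" 1]
        homogeneous_scale[OF homogeneous_coord, of "sin \<theta>" 2]] by (simp add: mult.commute)
  show "(\<lambda>x. (x$1 * cos \<theta> + x$2 * sin \<theta>) ^ i * ((x$1)\<^sup>2 + (x$2)\<^sup>2 + (x$3)\<^sup>2) ^ ((k - i) div 2)) \<in> homogeneous_polys k"
    using homogeneous_mult[OF homogeneous_power[OF lin, of i] homogeneous_power[OF homogeneous_normsq, of "(k - i) div 2"]]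
    by (simp only: i)
qed

lemma ridge_poly_on_sphere:
  assumes x: "x \<in> sphere 0 1"
  shows "ridge_poly k \<theta> x = disk_const \<mu> / 2 * ((real k + \<mu> + 1/2) / (\<mu> + 1/2)) *
     poly (gegenbauer (\<mu> + 1/2) k) (x$1 * cos \<theta> + x$2 * sin \<theta>)"
proof -
  let ?C = "gegenbauer (\<mu> + 1/2) k"
  have a: "\<mu> + 1/2 > 0" using \<mu> by simp
  have p: "poly ?C u = (\<Sum>i\<le>k. coeff ?C i * u ^ i)" for u
    by (simp add: poly_altdef degree_gegenbauer[OF a])
  \<comment> \<open>By parity the polynomial equals this average, in which the coefficients of the
    wrong parity cancel. So restricting the sum in \<open>ridge_poly\<close> loses nothing.\<close>
  have 1: "poly ?C u = (poly ?C u + (-1) ^ k * poly ?C (- u)) / 2" for u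
    unfolding poly_gegenbauer_minus[OF a] by (simp flip: mult.assoc power_add)
  have 2: "poly ?C u + (-1) ^ k * poly ?C (- u) =
      2 * (\<Sum>i\<in>{i. i \<le> k \<and> even (k - i)}. coeff ?C i * u ^ i)" for u
  proof -
    have "poly ?C u + (-1) ^ k * poly ?C (- u) = (\<Sum>i\<le>k. coeff ?C i * u ^ i * (1 + (-1) ^ (k + i)))"
      unfolding p sum_distrib_left sum.distrib[symmetric]
      by (intro sum.cong refl) (simp add: power_minus[of u] power_add algebra_simps)
    also have "\<dots> = (\<Sum>i\<in>{i. i \<le> k \<and> even (k - i)}. coeff ?C i * u ^ i * 2)"
      by (rule sum.mono_neutral_cong_right) auto
    finally show ?thesis by (simp add: sum_distrib_left mult_ac)
  qed
  have e: "poly ?C u = (\<Sum>i\<in>{i. i \<le> k \<and> even (k - i)}. coeff ?C i * u ^ i)" for u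
    by (rule trans[OF 1[of u]]) (simp only: 2 nonzero_mult_div_cancel_left[OF zero_neq_numeral[symmetric]])
  have "(x$1)\<^sup>2 + (x$2)\<^sup>2 + (x$3)\<^sup>2 = 1"
    using x by (simp add: norm_vec3)
  then show ?thesis by (simp add: ridge_poly_def e)
qed

lemma sphere_inner_ridge_poly:
  "sphere_inner \<mu> (ridge_poly k \<theta>) q = disk_const \<mu> / 2 * ((real k + \<mu> + 1/2) / (\<mu> + 1/2)) *
     sphere_inner \<mu> (\<lambda>x. poly (gegenbauer (\<mu> + 1/2) k) (x$1 * cos \<theta> + x$2 * sin \<theta>)) q"
proof -
  have "sphere_inner \<mu> q (ridge_poly k \<theta>) = sphere_inner \<mu> q (\<lambda>x. disk_const \<mu> / 2 * ((real k + \<mu> + 1/2) / (\<mu> + 1/2)) *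
     poly (gegenbauer (\<mu> + 1/2) k) (x$1 * cos \<theta> + x$2 * sin \<theta>))"
    by (rule sphere_inner_cong) (simp_all add: ridge_poly_on_sphere)
  then show ?thesis by (simp only: sphere_inner_scale_right sphere_inner_commute[of \<mu> _ q])
qed

lemma ridge_poly_reproducing:
  "harmonic_poly \<mu> k q \<Longrightarrow> sphere_inner \<mu> (ridge_poly k \<theta>) q = q (equator \<theta>)"
  unfolding sphere_inner_ridge_poly by (rule sphere_inner_gegenbauer)

text \<open>Integration along circles turns a monomial of lower degree into a polynomial in t of
  degree below k, to which the Gegenbauer polynomial is orthogonal.\<close>

lemma harmonic_ridge_poly: "harmonic_poly \<mu> k (ridge_poly k \<theta>)"
proof (rule harmonic_polyI[OF \<mu> ridge_poly_homogeneous])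
  fix i j m assume ijm: "i + j + m < k"
  have a: "\<mu> + 1/2 > 0" "\<mu> + 1/2 - 1/2 = \<mu>" using \<mu> by auto
  have mono: "monomial3 i j m \<in> homogeneous_polys (i + j + m)"
    using homogeneous_monomial[of i j m "i + j + m" 1] by simp
  obtain P :: "real poly" where P: "degree P \<le> i + j + m"
    "\<And>r. sphere_inner \<mu> (\<lambda>x. poly r (x$1 * cos \<theta> + x$2 * sin \<theta>)) (monomial3 i j m) = jacobi_int \<mu> \<mu> (r * P)"
    using sphere_inner_ridge[OF mono, of \<theta>] by blast
  have "jacobi_mean \<mu> \<mu> (gegenbauer (\<mu> + 1/2) k * P) = 0"
    using gegenbauer_orth[OF a(1), of P k] P(1) ijm a(2) by simp
  then have "jacobi_int \<mu> \<mu> (gegenbauer (\<mu> + 1/2) k * P) = 0"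
    using jacobi_int_1_pos[of \<mu> \<mu>] \<mu> by (simp add: jacobi_mean_def)
  then show "sphere_inner \<mu> (ridge_poly k \<theta>) (monomial3 i j m) = 0"
    by (simp add: sphere_inner_ridge_poly P(2))
qed

end

section \<open>Reconstruction from finitely many directions\<close>

definition reflect3 :: "real^3 \<Rightarrow> real^3" where
  "reflect3 x = vector [x$1, x$2, - x$3]"

lemma reflect3_nth [simp]: "reflect3 x $ 1 = x$1" "reflect3 x $ 2 = x$2" "reflect3 x $ 3 = - x$3"
  by (simp_all add: reflect3_def)

lemma reflect3_reflect3 [simp]: "reflect3 (reflect3 x) = x"
  by (simp add: vec_eq_iff forall_3)

lemma orthogonal_reflect3: "orthogonal_transformation reflect3"
  unfolding orthogonal_transformation
proof
  show "linear reflect3"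
    by (rule linearI) (simp_all add: vec_eq_iff forall_3)
qed (simp add: norm_vec3)

lemma sphere_weight_reflect3: "sphere_weight \<mu> (reflect3 x) = sphere_weight \<mu> x"
  by (auto simp: sphere_weight_def)

lemma reflect3_measurable: "reflect3 \<in> measurable sphere_measure (restrict_space borel (sphere 0 1))"
  using orthogonal_measurable_sphere[OF orthogonal_reflect3]
  by (simp add: measurable_cong_sets[OF sets_sphere_measure])

lemma sphere_inner_reflect3:
  assumes "f \<in> borel_measurable sphere_measure" "g \<in> borel_measurable sphere_measure"
  shows "sphere_inner \<mu> (\<lambda>x. f (reflect3 x)) (\<lambda>x. g (reflect3 x)) = sphere_inner \<mu> f g"
proof -
  let ?h = "\<lambda>x. f x * g x * sphere_weight \<mu> x"
  have "?h \<in> borel_measurable sphere_measure"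
    using assms borel_measurable_sphere[OF sphere_weight_measurable] by measurable
  then have h: "?h \<in> borel_measurable (restrict_space borel (sphere 0 1))"
    by (simp add: measurable_cong_sets[OF sets_sphere_measure])
  have "sphere_inner \<mu> f g = (LINT x|distr sphere_measure (restrict_space borel (sphere 0 1)) reflect3. ?h x)"
    by (simp add: distr_sphere_measure_orthogonal[OF orthogonal_reflect3] sphere_inner_def)
  also have "\<dots> = (LINT x|sphere_measure. ?h (reflect3 x))"
    by (rule integral_distr[OF reflect3_measurable h])
  finally show ?thesis by (simp add: sphere_inner_def sphere_weight_reflect3)
qed

lemma harmonic_poly_measurable:
  "harmonic_poly \<mu> k q \<Longrightarrow> q \<in> borel_measurable sphere_measure"
  by (intro borel_measurable_sphere borel_measurable_continuous_onI harmonic_poly_continuous)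

lemma homogeneous_reflect3:
  assumes "p \<in> homogeneous_polys k"
  shows "(\<lambda>x. p (reflect3 x)) \<in> homogeneous_polys k"
  using homogeneous_linear_subst[OF assms homogeneous_coord[of 1] homogeneous_coord[of 2]
      homogeneous_scale[OF homogeneous_coord[of 3], of "-1"]]
  by (simp add: reflect3_def)

lemma harmonic_reflect3:
  assumes \<mu>: "\<mu> \<ge> 0" and q: "harmonic_poly \<mu> k q"
  shows "harmonic_poly \<mu> k (\<lambda>x. q (reflect3 x))"
proof (rule harmonic_polyI[OF \<mu>])
  show "(\<lambda>x. q (reflect3 x)) \<in> homogeneous_polys k"
    using q by (auto simp: harmonic_poly_def intro: homogeneous_reflect3)
  fix i j m assume ijm: "i + j + m < k"
  have mono: "monomial3 i j m \<in> homogeneous_polys (i + j + m)"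
    using homogeneous_monomial[of i j m "i + j + m" 1] by simp
  have r: "(\<lambda>x. monomial3 i j m (reflect3 x)) \<in> homogeneous_polys (i + j + m)"
    by (rule homogeneous_reflect3[OF mono])
  have "sphere_inner \<mu> (\<lambda>x. q (reflect3 x)) (\<lambda>x. monomial3 i j m (reflect3 (reflect3 x))) =
      sphere_inner \<mu> q (\<lambda>x. monomial3 i j m (reflect3 x))"
    by (rule sphere_inner_reflect3)
       (intro harmonic_poly_measurable[OF q] borel_measurable_sphere borel_measurable_continuous_onI
          continuous_homogeneous[OF r])+
  also have "\<dots> = 0" by (rule harmonic_poly_orth[OF q r ijm])
  finally show "sphere_inner \<mu> (\<lambda>x. q (reflect3 x)) (monomial3 i j m) = 0" by simp
qed

text \<open>A homogeneous polynomial that is even in \<open>x\<^sub>3\<close> and vanishes on the equator is \<open>x\<^sub>3\<^sup>2 q\<close>;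
  if it is harmonic then it is orthogonal to \<open>q\<close>, which makes \<open>x\<^sub>3 q\<close> vanish.\<close>

lemma harmonic_equator_zero:
  assumes \<mu>: "\<mu> \<ge> 0" and v: "harmonic_poly \<mu> k v"
    and even: "\<And>x. v (reflect3 x) = v x" and eq: "\<And>\<phi>. v (equator \<phi>) = 0"
  shows "v x = 0"
proof -
  have vh: "v \<in> homogeneous_polys k" using v by (simp add: harmonic_poly_def)
  obtain c where c: "v = (\<lambda>x. \<Sum>e\<in>{(i, j, m). i + j + m = k}. c e * monomial3 (fst e) (fst (snd e)) (snd (snd e)) x)"
    using homogeneousE[OF vh] by blast
  let ?E = "{(i, j, m). i + j + m = k}"
  let ?t = "\<lambda>e x. c e * monomial3 (fst e) (fst (snd e)) (snd (snd e)) x"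
  define E2 where "E2 = {e \<in> ?E. even (snd (snd e)) \<and> snd (snd e) > 0}"
  define q where "q = (\<lambda>x. \<Sum>e\<in>E2. c e * monomial3 (fst e) (fst (snd e)) (snd (snd e) - 2) x)"
  have v0: "v (vector [a, b, 0]) = 0" for a b
  proof -
    \<comment> \<open>Homogeneity spreads the zeros from the unit circle over the whole plane x_3 =
      0.\<close>
    obtain r \<phi> where "a = r * cos \<phi>" "b = r * sin \<phi>"
      using rcis_Ex[of "Complex a b"] by (auto simp: complex_eq_iff)
    then have "vector [a, b, 0] = r *\<^sub>R equator \<phi>" by (simp add: vec_eq_iff forall_3)
    then show ?thesis by (simp add: homogeneous_scaleR[OF vh] eq)
  qed
  have vq: "v x = (x$3)\<^sup>2 * q x" for x
  proof -
    have t_refl: "?t e (reflect3 x) = (-1) ^ snd (snd e) * ?t e x" for e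
      by (simp add: monomial3_def power_minus[of "x$3"])
    have t_0: "?t e (vector [x$1, x$2, 0]) = (if snd (snd e) = 0 then ?t e x else 0)" for e
      by (simp add: monomial3_def)
    \<comment> \<open>Adding the reflected value cancels the odd powers of x_3. The terms free of
      x_3 sum to the value at (x_1, x_2, 0), which is 0 by \<open>v0\<close>.\<close>
    have "2 * v x = v x + v (reflect3 x)" by (simp add: even)
    also have "\<dots> = (\<Sum>e\<in>?E. ?t e x + (-1) ^ snd (snd e) * ?t e x)"
      unfolding c t_refl by (simp add: sum.distrib)
    also have "\<dots> = (\<Sum>e\<in>?E. 2 * ?t e (vector [x$1, x$2, 0]) + (if e \<in> E2 then 2 * ?t e x else 0))"
      unfolding t_0 by (intro sum.cong refl) (auto simp: E2_def)
    also have "\<dots> = 2 * v (vector [x$1, x$2, 0]) + (\<Sum>e\<in>?E. if e \<in> E2 then 2 * ?t e x else 0)"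
      unfolding c by (simp only: sum.distrib sum_distrib_left)
    also have "(\<Sum>e\<in>?E. if e \<in> E2 then 2 * ?t e x else 0) = (\<Sum>e\<in>E2. 2 * ?t e x)"
      by (rule sum.mono_neutral_cong_right) (auto simp: E2_def finite_exponents)
    also have "\<dots> = 2 * ((x$3)\<^sup>2 * q x)"
      unfolding q_def sum_distrib_left
    proof (rule sum.cong[OF refl])
      fix e assume "e \<in> E2"
      then have "even (snd (snd e))" "snd (snd e) > 0" by (auto simp: E2_def)
      then have "snd (snd e) = 2 + (snd (snd e) - 2)" by presburger
      then have "(x$3) ^ snd (snd e) = (x$3)\<^sup>2 * (x$3) ^ (snd (snd e) - 2)"
        by (metis power_add)
      then show "2 * ?t e x = 2 * ((x$3)\<^sup>2 * (c e * monomial3 (fst e) (fst (snd e)) (snd (snd e) - 2) x))"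
        by (simp add: monomial3_def)
    qed
    finally show ?thesis by (simp add: v0)
  qed
  show ?thesis
  proof (cases "k \<ge> 2")
    case False
    \<comment> \<open>A positive even exponent is at least 2, so below degree 2 no term is
      left.\<close>
    then have "E2 = {}" by (auto simp: E2_def elim!: evenE)
    then show ?thesis by (simp add: vq q_def)
  next
    case True
    have q: "q \<in> homogeneous_polys (k - 2)"
      unfolding q_def
    proof (rule homogeneous_sum)
      fix e assume "e \<in> E2"
      then have "even (snd (snd e))" "snd (snd e) > 0" "fst e + fst (snd e) + snd (snd e) = k"
        by (auto simp: E2_def)
      then have "fst e + fst (snd e) + (snd (snd e) - 2) = k - 2" by presburger
      then show "(\<lambda>x. c e * monomial3 (fst e) (fst (snd e)) (snd (snd e) - 2) x) \<in> homogeneous_polys (k - 2)"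
        by (rule homogeneous_monomial)
    qed
    let ?h = "\<lambda>x. x$3 * q x"
    have h: "?h \<in> homogeneous_polys (1 + (k - 2))"
      by (rule homogeneous_mult[OF homogeneous_coord q])
    have "sphere_inner \<mu> ?h ?h = sphere_inner \<mu> v q"
      unfolding sphere_inner_def by (simp add: vq power2_eq_square mult_ac)
    also have "\<dots> = 0" using True by (intro harmonic_poly_orth[OF v q]) auto
    finally have "?h x = 0" by (rule sphere_inner_definite[OF \<mu> h])
    then show ?thesis by (auto simp: vq)
  qed
qed

lemma harmonic_poly_diff:
  assumes "\<mu> \<ge> 0" "harmonic_poly \<mu> k p" "harmonic_poly \<mu> k q"
  shows "harmonic_poly \<mu> k (\<lambda>x. p x - q x)"
  using harmonic_poly_sum[of \<mu> UNIV k "\<lambda>b. if b then p else q" "\<lambda>b. if b then 1 else -1"] assms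
  by (simp add: UNIV_bool)

section \<open>Sampling identity, its dual, and the projection\<close>

context
  fixes \<mu> :: real and n k :: nat and y :: "nat \<Rightarrow> real"
  assumes \<mu>: "\<mu> \<ge> 0" and kn: "k \<le> n" and y: "\<And>\<nu>. y \<nu> = real \<nu> * pi / (real n + 1)"
begin

lemma even_harmonic_sampling:
  assumes v: "harmonic_poly \<mu> k v" and even: "\<And>x. v (reflect3 x) = v x"
  shows "v x = 1 / (real n + 1) * (\<Sum>\<nu>=0..n. v (equator (y \<nu>)) * kernel_poly \<mu> k (y \<nu>) x)"
proof -
  define w where "w = (\<lambda>x. \<Sum>\<nu>=0..n. (1 / (real n + 1) * v (equator (y \<nu>))) * kernel_poly \<mu> k (y \<nu>) x)"
  have w: "harmonic_poly \<mu> k w"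
    unfolding w_def by (intro harmonic_poly_sum \<mu> harmonic_kernel_poly)
  have "v x - w x = 0"
  proof (rule harmonic_equator_zero[OF \<mu> harmonic_poly_diff[OF \<mu> v w]])
    have "w (reflect3 x) = w x" for x
      by (simp add: w_def reflect3_def kernel_poly_even)
    then show "v (reflect3 x) - w (reflect3 x) = v x - w x" for x
      by (simp add: even)
    have form: "circle_form k (\<lambda>\<phi>. v (equator \<phi>))"
      using v by (intro circle_form_equator) (simp add: harmonic_poly_def)
    show "v (equator \<phi>) - w (equator \<phi>) = 0" for \<phi>
    proof -
      have "w (equator \<phi>) = 1 / (real n + 1) * (\<Sum>\<nu>=0..n. v (equator (y \<nu>)) *
          Re (\<Sum>m\<le>k. cis ((real k - 2 * real m) * (\<phi> - y \<nu>))))"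
        unfolding w_def kernel_poly_boundary[OF \<mu>] sum_distrib_left by (simp only: mult.assoc)
      also have "\<dots> = v (equator \<phi>)"
        unfolding y circle_form_sampling[OF form kn] by simp
      finally show ?thesis by simp
    qed
  qed
  then show ?thesis by (simp add: w_def sum_distrib_left mult.assoc)
qed

text \<open>Let v be the difference of the two sides. Sampling v inside its inner product with
  \<open>q\<close> gives the sum of b_\<nu> v(\<zeta>_\<nu>). By reproduction this is also the inner
  product of v with the right-hand side, so v is orthogonal to itself.\<close>

lemma even_harmonic_ridge_expansion:
  assumes q: "harmonic_poly \<mu> k q" and even: "\<And>x. q (reflect3 x) = q x"
  shows "q x = (\<Sum>\<nu>=0..n. (sphere_inner \<mu> q (kernel_poly \<mu> k (y \<nu>)) / (real n + 1)) * ridge_poly \<mu> k (y \<nu>) x)"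
proof -
  define b where "b = (\<lambda>\<nu>. sphere_inner \<mu> q (kernel_poly \<mu> k (y \<nu>)) / (real n + 1))"
  define w where "w = (\<lambda>x. \<Sum>\<nu>=0..n. b \<nu> * ridge_poly \<mu> k (y \<nu>) x)"
  have w: "harmonic_poly \<mu> k w"
    unfolding w_def by (intro harmonic_poly_sum \<mu> harmonic_ridge_poly)
  define v where "v = (\<lambda>x. q x - w x)"
  have v: "harmonic_poly \<mu> k v" unfolding v_def by (rule harmonic_poly_diff[OF \<mu> q w])
  have "w (reflect3 x) = w x" for x
    by (simp add: w_def reflect3_def ridge_poly_even[OF \<mu>])
  then have v_even: "v (reflect3 x) = v x" for x
    by (simp add: v_def even)
  have c: "continuous_on UNIV q" "continuous_on UNIV w" "continuous_on UNIV v"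
    by (rule harmonic_poly_continuous[OF q] harmonic_poly_continuous[OF w] harmonic_poly_continuous[OF v])+
  have "sphere_inner \<mu> q v = sphere_inner \<mu> q
      (\<lambda>x. \<Sum>\<nu>=0..n. (1 / (real n + 1) * v (equator (y \<nu>))) * kernel_poly \<mu> k (y \<nu>) x)"
  proof (rule sphere_inner_cong)
    show "v x = (\<Sum>\<nu>=0..n. (1 / (real n + 1) * v (equator (y \<nu>))) * kernel_poly \<mu> k (y \<nu>) x)" for x
      using even_harmonic_sampling[OF v v_even, of x] by (simp only: sum_distrib_left mult.assoc)
  qed simp
  also have "\<dots> = (\<Sum>\<nu>=0..n. sphere_inner \<mu> q (\<lambda>x. (1 / (real n + 1) * v (equator (y \<nu>))) * kernel_poly \<mu> k (y \<nu>) x))"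
    by (intro sphere_inner_sum_right[OF \<mu> continuous_in_sphere_L2[OF \<mu> c(1)]] continuous_intros
        harmonic_poly_continuous[OF harmonic_kernel_poly[OF \<mu>]])
  also have "\<dots> = (\<Sum>\<nu>=0..n. b \<nu> * v (equator (y \<nu>)))"
    unfolding sphere_inner_scale_right b_def by (simp add: mult.commute)
  also have "\<dots> = (\<Sum>\<nu>=0..n. sphere_inner \<mu> v (\<lambda>x. b \<nu> * ridge_poly \<mu> k (y \<nu>) x))"
    unfolding sphere_inner_scale_right sphere_inner_commute[of \<mu> v] ridge_poly_reproducing[OF \<mu> v] ..
  also have "\<dots> = sphere_inner \<mu> v w"
    unfolding w_def
    by (intro sphere_inner_sum_right[OF \<mu> continuous_in_sphere_L2[OF \<mu> c(3)], symmetric] continuous_intros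
        harmonic_poly_continuous[OF harmonic_ridge_poly[OF \<mu>]])
  finally have "sphere_inner \<mu> q v = sphere_inner \<mu> w v" by (simp add: sphere_inner_commute)
  moreover have "sphere_inner \<mu> v v = sphere_inner \<mu> q v - sphere_inner \<mu> w v"
    using sphere_inner_diff_left[OF \<mu> continuous_in_sphere_L2[OF \<mu> c(1)] c(2) c(3)] by (simp add: v_def)
  ultimately have "sphere_inner \<mu> v v = 0" by simp
  then have "v x = 0"
    using v by (intro sphere_inner_definite[OF \<mu>, of v k]) (simp_all add: harmonic_poly_def)
  then show ?thesis by (simp add: v_def w_def b_def)
qed

text \<open>For test functions that are not even: \<open>f\<close> and the candidate
  \<open>g\<close> are invariant under the reflection, so their inner products with \<open>q\<close>
  are half of those with \<open>q\<close> plus its reflection, and the even case applies.\<close>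

lemma proj_harmonics_eq_sampling:
  assumes f: "f \<in> sphere_L2 \<mu>" and f_even: "AE x in sphere_measure. f x = f (reflect3 x)"
    and x: "x \<in> sphere 0 1"
  shows "proj_harmonics \<mu> k f x =
    1 / (real n + 1) * (\<Sum>\<nu>=0..n. sphere_inner \<mu> f (ridge_poly \<mu> k (y \<nu>)) * kernel_poly \<mu> k (y \<nu>) x)"
proof -
  define g where "g = (\<lambda>x. \<Sum>\<nu>=0..n. (1 / (real n + 1) * sphere_inner \<mu> f (ridge_poly \<mu> k (y \<nu>))) * kernel_poly \<mu> k (y \<nu>) x)"
  have g: "harmonic_poly \<mu> k g"
    unfolding g_def by (intro harmonic_poly_sum \<mu> harmonic_kernel_poly)
  have g_even: "g (reflect3 x) = g x" for x
    by (simp add: g_def reflect3_def kernel_poly_even)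
  have f_meas: "f \<in> borel_measurable sphere_measure" using f by (simp add: sphere_L2_def)
  have gL: "g \<in> sphere_L2 \<mu>" by (rule continuous_in_sphere_L2[OF \<mu> harmonic_poly_continuous[OF g]])
  have even_case: "sphere_inner \<mu> f q = sphere_inner \<mu> g q"
    if q: "harmonic_poly \<mu> k q" and q_even: "\<And>x. q (reflect3 x) = q x" for q
  proof -
    define b where "b = (\<lambda>\<nu>. sphere_inner \<mu> q (kernel_poly \<mu> k (y \<nu>)) / (real n + 1))"
    have qR: "q = (\<lambda>x. \<Sum>\<nu>=0..n. b \<nu> * ridge_poly \<mu> k (y \<nu>) x)"
      unfolding b_def by (rule ext) (rule even_harmonic_ridge_expansion[OF q q_even])
    have "sphere_inner \<mu> f q = (\<Sum>\<nu>=0..n. sphere_inner \<mu> f (\<lambda>x. b \<nu> * ridge_poly \<mu> k (y \<nu>) x))"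
      by (subst qR) (intro sphere_inner_sum_right[OF \<mu> f] continuous_intros
        harmonic_poly_continuous[OF harmonic_ridge_poly[OF \<mu>]])
    also have "\<dots> = (\<Sum>\<nu>=0..n. sphere_inner \<mu> q (\<lambda>x. (1 / (real n + 1) * sphere_inner \<mu> f (ridge_poly \<mu> k (y \<nu>))) * kernel_poly \<mu> k (y \<nu>) x))"
      unfolding sphere_inner_scale_right b_def by (simp add: mult.commute)
    also have "\<dots> = sphere_inner \<mu> q g"
      unfolding g_def
      by (intro sphere_inner_sum_right[OF \<mu> continuous_in_sphere_L2[OF \<mu> harmonic_poly_continuous[OF q]], symmetric]
          continuous_intros harmonic_poly_continuous[OF harmonic_kernel_poly[OF \<mu>]])
    finally show ?thesis by (simp add: sphere_inner_commute)
  qed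
  have f_refl: "sphere_inner \<mu> f (\<lambda>x. q (reflect3 x)) = sphere_inner \<mu> f q" if q: "harmonic_poly \<mu> k q" for q
  proof -
    note qr = harmonic_reflect3[OF \<mu> q]
    have "(\<lambda>x. f (reflect3 x)) \<in> borel_measurable sphere_measure"
      using measurable_compose[OF reflect3_measurable, of f borel] f_meas
      by (simp add: measurable_cong_sets[OF sets_sphere_measure])
    \<comment> \<open>Evenness of \<open>f\<close> holds only almost everywhere, so the integrands
      agree up to a null set.\<close>
    then have "sphere_inner \<mu> f (\<lambda>x. q (reflect3 x)) = sphere_inner \<mu> (\<lambda>x. f (reflect3 x)) (\<lambda>x. q (reflect3 x))"
      unfolding sphere_inner_def
      using f_meas harmonic_poly_measurable[OF qr] borel_measurable_sphere[OF sphere_weight_measurable] f_even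
      by (intro integral_cong_AE borel_measurable_times) auto
    also have "\<dots> = sphere_inner \<mu> f q"
      by (rule sphere_inner_reflect3[OF f_meas harmonic_poly_measurable[OF q]])
    finally show ?thesis .
  qed
  have g_refl: "sphere_inner \<mu> g (\<lambda>x. q (reflect3 x)) = sphere_inner \<mu> g q" if q: "harmonic_poly \<mu> k q" for q
    using sphere_inner_reflect3[OF harmonic_poly_measurable[OF g] harmonic_poly_measurable[OF q], of \<mu>]
    by (simp add: g_even)
  have "sphere_inner \<mu> f q = sphere_inner \<mu> g q" if q: "harmonic_poly \<mu> k q" for q
  proof -
    \<comment> \<open>Twice the even part of \<open>q\<close>, as a sum over the two booleans so
      that \<open>harmonic_poly_sum\<close> applies.\<close>
    define s where "s = (\<lambda>x. \<Sum>b\<in>UNIV. 1 * (if b then q else (\<lambda>x. q (reflect3 x))) x)"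
    note qr = harmonic_reflect3[OF \<mu> q]
    have s_eq: "s = (\<lambda>x. q x + q (reflect3 x))" by (simp add: s_def UNIV_bool fun_eq_iff)
    have s: "harmonic_poly \<mu> k s"
      unfolding s_def using q qr by (intro harmonic_poly_sum \<mu>) auto
    have "sphere_inner \<mu> h s = sphere_inner \<mu> h q + sphere_inner \<mu> h (\<lambda>x. q (reflect3 x))" if "h \<in> sphere_L2 \<mu>" for h
      unfolding s_eq by (rule sphere_inner_add_right[OF \<mu> that harmonic_poly_continuous[OF q] harmonic_poly_continuous[OF qr]])
    then have "sphere_inner \<mu> f s = 2 * sphere_inner \<mu> f q" "sphere_inner \<mu> g s = 2 * sphere_inner \<mu> g q"
      using f gL f_refl[OF q] g_refl[OF q] by simp_all
    moreover have "sphere_inner \<mu> f s = sphere_inner \<mu> g s"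
      by (rule even_case[OF s]) (simp add: s_eq)
    ultimately show ?thesis by simp
  qed
  then have "proj_harmonics \<mu> k f x = g x"
    by (rule proj_harmonics_eqI[OF \<mu> f g _ x])
  then show ?thesis by (simp add: g_def sum_distrib_left mult.assoc)
qed

end

text \<open>On the circle at height t the polynomial has the constant value \<open>poly r t\<close>
  and leaves the inner integral. The factor 2 undoes the 1/2 in
  \<open>spherical_transform\<close>.\<close>

lemma sphere_inner_spherical_transform:
  assumes \<mu>: "\<mu> \<ge> 0" and f: "f \<in> sphere_L2 \<mu>"
  shows "sphere_inner \<mu> f (\<lambda>x. poly r (x$1 * cos \<theta> + x$2 * sin \<theta>)) =
    2 * (LBINT t:{-1..1}. spherical_transform \<mu> f (equator \<theta>) t * poly r t)"
proof -
  have int: "integrable sphere_measure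
      (\<lambda>x. f x * poly r (x$1 * cos \<theta> + x$2 * sin \<theta>) * sphere_weight \<mu> x)"
    by (rule sphere_L2_integrable[OF \<mu> f continuous_ridge[OF \<mu>]])
  have "sphere_inner \<mu> f (\<lambda>x. poly r (x$1 * cos \<theta> + x$2 * sin \<theta>)) =
      (LBINT t:{-1..1}. LBINT \<alpha>:{0..2 * pi}. f (circle_point (equator \<theta>) t \<alpha>) * poly r t *
         sphere_weight \<mu> (circle_point (equator \<theta>) t \<alpha>))"
    unfolding sphere_inner_def
    by (simp only: integral_sphere_circle_point[OF int, of \<theta>] circle_point_height)
  also have "\<dots> = (LBINT t:{-1..1}. 2 * (spherical_transform \<mu> f (equator \<theta>) t * poly r t))"
  proof (rule set_lebesgue_integral_cong)
    show "\<forall>t. t \<in> {-1..1} \<longrightarrow> (LBINT \<alpha>:{0..2 * pi}. f (circle_point (equator \<theta>) t \<alpha>) * poly r t *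
         sphere_weight \<mu> (circle_point (equator \<theta>) t \<alpha>)) = 2 * (spherical_transform \<mu> f (equator \<theta>) t * poly r t)"
    proof (intro allI impI)
      fix t :: real
      have "(LBINT \<alpha>:{0..2 * pi}. f (circle_point (equator \<theta>) t \<alpha>) * poly r t *
         sphere_weight \<mu> (circle_point (equator \<theta>) t \<alpha>)) =
         (LBINT \<alpha>:{0..2 * pi}. poly r t * (f (circle_point (equator \<theta>) t \<alpha>) *
         sphere_weight \<mu> (circle_point (equator \<theta>) t \<alpha>)))"
        by (simp only: mult_ac)
      then show "(LBINT \<alpha>:{0..2 * pi}. f (circle_point (equator \<theta>) t \<alpha>) * poly r t *
         sphere_weight \<mu> (circle_point (equator \<theta>) t \<alpha>)) = 2 * (spherical_transform \<mu> f (equator \<theta>) t * poly r t)"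
        by (simp add: spherical_transform_def)
    qed
  qed simp
  also have "\<dots> = 2 * (LBINT t:{-1..1}. spherical_transform \<mu> f (equator \<theta>) t * poly r t)"
    by (rule set_integral_mult_right)
  finally show ?thesis .
qed

theorem theorem3p2:
  fixes \<mu> :: real and n k :: nat and f :: "real^3 \<Rightarrow> real" and \<xi> :: "nat \<Rightarrow> real"
    and \<zeta> :: "nat \<Rightarrow> real^3" and x :: "real^3"
  assumes "\<mu> \<ge> 0" and "k \<le> n"
    and "\<And>\<nu>. \<xi> \<nu> = real \<nu> * pi / (real n + 1)"
    and "\<And>\<nu>. \<zeta> \<nu> = vector [cos (\<xi> \<nu>), sin (\<xi> \<nu>), 0]"
    and "f \<in> sphere_L2 \<mu>"
    and "AE y in sphere_measure. f y = f (vector [y$1, y$2, - y$3])"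
    and "x \<in> sphere 0 1"
  shows "proj_harmonics \<mu> k f x =
    1 / (real n + 1) *
    (\<Sum>\<nu>=0..n. disk_const \<mu> *
       (LBINT t:{-1..1}. spherical_transform \<mu> f (\<zeta> \<nu>) t * recon_kernel \<mu> k (\<xi> \<nu>) t (x$1) (x$2)))"
proof -
  note \<mu> = assms(1) and f = assms(5) and x = assms(7)
  have "sphere_inner \<mu> f (ridge_poly \<mu> k (\<xi> \<nu>)) * kernel_poly \<mu> k (\<xi> \<nu>) x =
      disk_const \<mu> * (LBINT t:{-1..1}. spherical_transform \<mu> f (\<zeta> \<nu>) t * recon_kernel \<mu> k (\<xi> \<nu>) t (x$1) (x$2))" for \<nu>
  proof -
    let ?C = "gegenbauer (\<mu> + 1/2) k" and ?D = "angular_kernel \<mu> k (\<xi> \<nu>) (x$1) (x$2)"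
      and ?c = "(real k + \<mu> + 1/2) / (\<mu> + 1/2)"
    \<comment> \<open>The angular kernel does not depend on t, so it leaves the integral together
      with the constant.\<close>
    have "(LBINT t:{-1..1}. spherical_transform \<mu> f (\<zeta> \<nu>) t * recon_kernel \<mu> k (\<xi> \<nu>) t (x$1) (x$2)) =
        (LBINT t:{-1..1}. (?c * ?D) * (spherical_transform \<mu> f (\<zeta> \<nu>) t * poly ?C t))"
      by (simp only: recon_kernel_def mult_ac)
    also have "\<dots> = (?c * ?D) * (LBINT t:{-1..1}. spherical_transform \<mu> f (\<zeta> \<nu>) t * poly ?C t)"
      by (rule set_integral_mult_right)
    also have "\<dots> = (?c * ?D) * (sphere_inner \<mu> f (\<lambda>x. poly ?C (x$1 * cos (\<xi> \<nu>) + x$2 * sin (\<xi> \<nu>))) / 2)"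
      by (simp add: sphere_inner_spherical_transform[OF \<mu> f] assms(4))
    finally have "disk_const \<mu> * (LBINT t:{-1..1}. spherical_transform \<mu> f (\<zeta> \<nu>) t * recon_kernel \<mu> k (\<xi> \<nu>) t (x$1) (x$2)) =
        (disk_const \<mu> / 2 * ?c * sphere_inner \<mu> f (\<lambda>x. poly ?C (x$1 * cos (\<xi> \<nu>) + x$2 * sin (\<xi> \<nu>)))) * ?D"
      by (simp only: mult_ac times_divide_eq_left times_divide_eq_right divide_divide_eq_left)
    also have "disk_const \<mu> / 2 * ?c * sphere_inner \<mu> f (\<lambda>x. poly ?C (x$1 * cos (\<xi> \<nu>) + x$2 * sin (\<xi> \<nu>))) =
        sphere_inner \<mu> f (ridge_poly \<mu> k (\<xi> \<nu>))"
      unfolding sphere_inner_commute[of \<mu> f] by (rule sphere_inner_ridge_poly[OF \<mu>, symmetric])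
    finally show ?thesis by (simp only: kernel_poly_on_sphere[OF \<mu> x])
  qed
  then show ?thesis
    using proj_harmonics_eq_sampling[OF \<mu> assms(2,3) f _ x] assms(6) by (simp add: reflect3_def)
qed

end
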